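(* Let $s,\ell\ge 1$ be integers, $d=2^s$, and let $\delta>0$ and $\epsilon,\beta\in(0,1/2]$. There is a quantum procedure, depending only on $s,\ell,\delta,\epsilon,\beta$ and accessing its inputs only through oracle calls, with the following guarantee. Let $A\in\mathbb{C}^{d\times d}$ be any matrix all of whose singular values lie in $[\delta,1-\delta]$, given through a unitary $U_A$ on $\ell+s$ qubits with $$A=(\langle 0|^{\otimes \ell}\otimes \mathbb{1})\,U_A\,(|0\rangle^{\otimes \ell}\otimes \mathbb{1}),$$ and let $|\psi\rangle\in\mathbb{C}^d$ be any unit vector prepared by one call to a state-preparation oracle $\mathcal{S}$. Let $A=\sum_i\sigma_i|w_i\rangle\langle v_i|$ be a singular value decomposition and put $$U_1=\sum_i\left(\sigma_i+i\sqrt{1-\sigma_i^2}\right)|w_i\rangle\langle v_i|,\qquad U_2=\sum_i\left(\sigma_i-i\sqrt{1-\sigma_i^2}\right)|w_i\rangle\langle v_i|,$$ which are unitary and satisfy $A=\frac12(U_1+U_2)$. Then there are operators $\tilde U_1,\tilde U_2$ on $\mathbb{C}^d$, not depending on $|\psi\rangle$, with $\|U_1-\tilde U_1\|\le\epsilon$ and $\|U_2-\tilde U_2\|\le\epsilon$, such that for each $j\in\{1,2\}$ the procedure implements $\tilde U_j|\psi\rangle$ with success probability at least $1-\beta$, success being flagged by the auxiliary qubits being found in the state $|0\rangle|0\rangle^{\otimes(\ell+1)}$ for $j=1$ and $|1\rangle|0\rangle^{\otimes(\ell+1)}$ for $j=2$. The procedure uses $\mathcal{O}\left(\frac1\delta\log\frac1\epsilon\,\log\frac1\beta\right)$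 calls to $U_A$ and $U_A^\dagger$, $\mathcal{O}\left(\log\frac1\beta\right)$ calls to $\mathcal{S}$, and $2$ auxiliary qubits in addition to the $\ell$ block-encoding qubits. The implied constants are absolute.
   Context: $\|\cdot\|$ is the operator norm (largest singular value). A quantum procedure here is a sequence of unitary gates, oracle calls and computational-basis measurements of the auxiliary qubits; it may be restarted on a freshly prepared copy of $|\psi\rangle$ (a new call to $\mathcal{S}$) and auxiliary qubits reset to $|0\rangle$, depending on measurement outcomes. Its gates other than the oracle calls do not depend on $A$, $U_A$ or $|\psi\rangle$. Calls to controlled versions of $U_A$ and $U_A^\dagger$ count as calls to these oracles. "Implements $\tilde U_j|\psi\rangle$" means that, conditioned on the success flag, the $s$-qubit system register is in the normalized state $\tilde U_j|\psi\rangle/\|\tilde U_j|\psi\rangle\|$ (up to a global phase). *)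

theory Defs
  imports Complex_Main
    "Jordan_Normal_Form.Matrix"
    "Jordan_Normal_Form.Conjugate"
    "Jordan_Normal_Form.Schur_Decomposition"
    "Jordan_Normal_Form.Char_Poly"
begin

section \<open>Linear algebra\<close>

definition unitary_mat :: "nat \<Rightarrow> complex mat \<Rightarrow> bool" where
  "unitary_mat n U \<longleftrightarrow>
     U \<in> carrier_mat n n \<and> mat_adjoint U * U = 1\<^sub>m n \<and> U * mat_adjoint U = 1\<^sub>m n"

definition vnorm :: "complex vec \<Rightarrow> real" where
  "vnorm v = sqrt (\<Sum>i<dim_vec v. (cmod (v $ i))\<^sup>2)"

definition singular_values :: "complex mat \<Rightarrow> real set" where
  "singular_values M =
     {\<sigma>. 0 \<le> \<sigma> \<and> eigenvalue (mat_adjoint M * M) (complex_of_real (\<sigma>\<^sup>2))}"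

definition op_norm :: "complex mat \<Rightarrow> real" where
  "op_norm M = Max (singular_values M)"

definition orthonormal_basis :: "nat \<Rightarrow> (nat \<Rightarrow> complex vec) \<Rightarrow> bool" where
  "orthonormal_basis d w \<longleftrightarrow>
     (\<forall>i<d. w i \<in> carrier_vec d) \<and>
     (\<forall>i<d. \<forall>j<d. w i \<bullet>c w j = (if i = j then 1 else 0))"

text \<open>The matrix \<open>\<Sum>i<d. f i |w i\<rangle>\<langle>v i|\<close>.\<close>

definition ketbra_sum ::
  "nat \<Rightarrow> (nat \<Rightarrow> complex) \<Rightarrow> (nat \<Rightarrow> complex vec) \<Rightarrow> (nat \<Rightarrow> complex vec) \<Rightarrow> complex mat" where
  "ketbra_sum d f w v =
     mat d d (\<lambda>(a, b). \<Sum>i<d. f i * (w i $ a) * cnj (v i $ b))"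

definition is_svd ::
  "nat \<Rightarrow> complex mat \<Rightarrow> (nat \<Rightarrow> real) \<Rightarrow> (nat \<Rightarrow> complex vec) \<Rightarrow> (nat \<Rightarrow> complex vec) \<Rightarrow> bool" where
  "is_svd d A \<sigma> w v \<longleftrightarrow>
     orthonormal_basis d w \<and> orthonormal_basis d v \<and> (\<forall>i<d. 0 \<le> \<sigma> i) \<and>
     A = ketbra_sum d (\<lambda>i. complex_of_real (\<sigma> i)) w v"

section \<open>Qubit registers\<close>

text \<open>
  An \<open>n\<close>-qubit register has basis states \<open>0, \<dots>, 2 ^ n - 1\<close>, read as bit strings whose
  first qubit (number 0) is the most significant one.  The left Kronecker factor is the
  most significant part of the register.
\<close>

definition kron :: "complex mat \<Rightarrow> complex mat \<Rightarrow> complex mat" where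
  "kron M N = mat (dim_row M * dim_row N) (dim_col M * dim_col N)
     (\<lambda>(i, j). M $$ (i div dim_row N, j div dim_col N) * N $$ (i mod dim_row N, j mod dim_col N))"

definition kron_vec :: "complex vec \<Rightarrow> complex vec \<Rightarrow> complex vec" where
  "kron_vec u v = vec (dim_vec u * dim_vec v)
     (\<lambda>i. u $ (i div dim_vec v) * v $ (i mod dim_vec v))"

text \<open>A basis state as a column; its adjoint is the corresponding bra.\<close>

definition ket :: "nat \<Rightarrow> nat \<Rightarrow> complex mat" where
  "ket n k = mat (2 ^ n) 1 (\<lambda>(i, _). if i = k then 1 else 0)"

definition qubit_value :: "nat \<Rightarrow> nat \<Rightarrow> nat \<Rightarrow> nat" where
  "qubit_value n q i = (i div 2 ^ (n - 1 - q)) mod 2"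

definition basis_projector :: "nat \<Rightarrow> (nat \<Rightarrow> bool) \<Rightarrow> complex mat" where
  "basis_projector n Q = mat_diag (2 ^ n) (\<lambda>i. if Q i then 1 else 0)"

definition block_encodes :: "nat \<Rightarrow> nat \<Rightarrow> complex mat \<Rightarrow> complex mat \<Rightarrow> bool" where
  "block_encodes l s U A \<longleftrightarrow>
     unitary_mat (2 ^ (l + s)) U \<and>
     A = kron (mat_adjoint (ket l 0)) (1\<^sub>m (2 ^ s)) * U * kron (ket l 0) (1\<^sub>m (2 ^ s))"

section \<open>Quantum procedures with oracle access\<close>

text \<open>
  The register consists of \<open>a\<close> extra auxiliary qubits, \<open>l\<close> block-encoding qubits and
  \<open>s\<close> system qubits, in this order; the first \<open>a + l\<close> are the auxiliary qubits.

  \<open>Oracle C dag\<close> applies the block-encoding unitary (its adjoint if \<open>dag\<close>) to the last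
  \<open>l + s\<close> qubits, controlled on all extra auxiliary qubits in \<open>C\<close> being 1;
  \<open>C = {}\<close> is the uncontrolled call.  \<open>Measure q P\<^sub>0 P\<^sub>1\<close> measures auxiliary qubit \<open>q\<close> and
  continues according to the outcome.  \<open>Prepare\<close> is a call to the state-preparation
  oracle: it discards the register and starts afresh with \<open>|0\<rangle>|\<psi>\<rangle>\<close>.
\<close>

datatype procedure =
    Halt
  | Gate "complex mat" procedure
  | Oracle "nat set" bool procedure
  | Measure nat procedure procedure
  | Prepare procedure

fun wf_procedure :: "nat \<Rightarrow> nat \<Rightarrow> nat \<Rightarrow> procedure \<Rightarrow> bool" where
  "wf_procedure a l s Halt = True"
| "wf_procedure a l s (Gate G P) = (unitary_mat (2 ^ (a + l + s)) G \<and> wf_procedure a l s P)"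
| "wf_procedure a l s (Oracle C dag P) = (C \<subseteq> {..<a} \<and> wf_procedure a l s P)"
| "wf_procedure a l s (Measure q P\<^sub>0 P\<^sub>1) =
     (q < a + l \<and> wf_procedure a l s P\<^sub>0 \<and> wf_procedure a l s P\<^sub>1)"
| "wf_procedure a l s (Prepare P) = wf_procedure a l s P"

text \<open>Numbers of oracle calls, in the worst case over all measurement outcomes.\<close>

fun unitary_calls :: "procedure \<Rightarrow> nat" where
  "unitary_calls Halt = 0"
| "unitary_calls (Gate G P) = unitary_calls P"
| "unitary_calls (Oracle C dag P) = Suc (unitary_calls P)"
| "unitary_calls (Measure q P\<^sub>0 P\<^sub>1) = max (unitary_calls P\<^sub>0) (unitary_calls P\<^sub>1)"
| "unitary_calls (Prepare P) = unitary_calls P"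

fun preparation_calls :: "procedure \<Rightarrow> nat" where
  "preparation_calls Halt = 0"
| "preparation_calls (Gate G P) = preparation_calls P"
| "preparation_calls (Oracle C dag P) = preparation_calls P"
| "preparation_calls (Measure q P\<^sub>0 P\<^sub>1) = max (preparation_calls P\<^sub>0) (preparation_calls P\<^sub>1)"
| "preparation_calls (Prepare P) = Suc (preparation_calls P)"

definition oracle_op :: "nat \<Rightarrow> nat \<Rightarrow> nat \<Rightarrow> complex mat \<Rightarrow> nat set \<Rightarrow> bool \<Rightarrow> complex mat" where
  "oracle_op a l s U C dag =
     (let on = (\<lambda>i. \<forall>q\<in>C. qubit_value a q i = 1) in
        kron (basis_projector a on) (if dag then mat_adjoint U else U) +
        kron (basis_projector a (\<lambda>i. \<not> on i)) (1\<^sub>m (2 ^ (l + s))))"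

definition measure_op :: "nat \<Rightarrow> nat \<Rightarrow> nat \<Rightarrow> nat \<Rightarrow> nat \<Rightarrow> complex mat" where
  "measure_op a l s q b =
     kron (basis_projector (a + l) (\<lambda>i. qubit_value (a + l) q i = b)) (1\<^sub>m (2 ^ s))"

text \<open>
  The final register states, one for each sequence of measurement outcomes.  They are not
  normalized: the squared norm of a state is the probability of its sequence of outcomes.
\<close>

fun final_states ::
  "nat \<Rightarrow> nat \<Rightarrow> nat \<Rightarrow> complex mat \<Rightarrow> complex vec \<Rightarrow> procedure \<Rightarrow> complex vec \<Rightarrow> complex vec list" where
  "final_states a l s U \<psi> Halt \<phi> = [\<phi>]"
| "final_states a l s U \<psi> (Gate G P) \<phi> = final_states a l s U \<psi> P (G *\<^sub>v \<phi>)"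
| "final_states a l s U \<psi> (Oracle C dag P) \<phi> =
     final_states a l s U \<psi> P (oracle_op a l s U C dag *\<^sub>v \<phi>)"
| "final_states a l s U \<psi> (Measure q P\<^sub>0 P\<^sub>1) \<phi> =
     final_states a l s U \<psi> P\<^sub>0 (measure_op a l s q 0 *\<^sub>v \<phi>) @
     final_states a l s U \<psi> P\<^sub>1 (measure_op a l s q 1 *\<^sub>v \<phi>)"
| "final_states a l s U \<psi> (Prepare P) \<phi> =
     final_states a l s U \<psi> P
       (complex_of_real (vnorm \<phi>) \<cdot>\<^sub>v kron_vec (unit_vec (2 ^ (a + l)) 0) \<psi>)"

text \<open>
  The procedure starts with all qubits in state 0.  Its auxiliary qubits are measured at the
  end; \<open>F\<close> is the basis state (a column) that flags success.  The unnormalized system states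
  of the successful runs are listed.
\<close>

definition success_states ::
  "nat \<Rightarrow> nat \<Rightarrow> nat \<Rightarrow> complex mat \<Rightarrow> complex vec \<Rightarrow> procedure \<Rightarrow> complex mat \<Rightarrow> complex vec list" where
  "success_states a l s U \<psi> P F =
     map (\<lambda>\<phi>. kron (mat_adjoint F) (1\<^sub>m (2 ^ s)) *\<^sub>v \<phi>)
       (final_states a l s U \<psi> P (unit_vec (2 ^ (a + l + s)) 0))"

definition success_probability ::
  "nat \<Rightarrow> nat \<Rightarrow> nat \<Rightarrow> complex mat \<Rightarrow> complex vec \<Rightarrow> procedure \<Rightarrow> complex mat \<Rightarrow> real" where
  "success_probability a l s U \<psi> P F =
     (\<Sum>\<chi>\<leftarrow>success_states a l s U \<psi> P F. (vnorm \<chi>)\<^sup>2)"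

definition normalized :: "complex vec \<Rightarrow> complex vec" where
  "normalized v = complex_of_real (1 / vnorm v) \<cdot>\<^sub>v v"

definition implements ::
  "nat \<Rightarrow> nat \<Rightarrow> nat \<Rightarrow> complex mat \<Rightarrow> complex vec \<Rightarrow> procedure \<Rightarrow> complex mat \<Rightarrow> complex mat \<Rightarrow> bool" where
  "implements a l s U \<psi> P F M \<longleftrightarrow>
     (\<forall>\<chi>\<in>set (success_states a l s U \<psi> P F). vnorm \<chi> \<noteq> 0 \<longrightarrow>
        (\<exists>\<theta>::real. normalized \<chi> = cis \<theta> \<cdot>\<^sub>v normalized (M *\<^sub>v \<psi>)))"

end

theory Submission
  imports Defs "HOL-Computational_Algebra.Fundamental_Theorem_Algebra"
begin

text \<open>
  Let \<open>R\<close> be the reflection about \<open>|0\<rangle>\<close> on the block-encoding qubits. If \<open>\<sigma> = cos \<theta>\<close> is a singular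
  value with vectors \<open>v, w\<close>, then \<open>|0\<rangle>v\<close> is a combination of two eigenvectors of the walk \<open>R U\<^sup>\<dagger> R U\<close>,
  with eigenvalues \<open>z\<^sup>2\<close> and \<open>z\<^sup>-\<^sup>2\<close> for \<open>z = exp (i \<theta>)\<close>. Applying \<open>f\<close> to the walk, then \<open>U\<close>, and
  projecting on \<open>|0\<rangle>\<close> gives \<open>(z f(z\<^sup>2) + z\<^sup>-\<^sup>1 f(z\<^sup>-\<^sup>2)) / 2\<close> times \<open>w\<close>. So it suffices that \<open>f\<close> is close to
  a constant on one half of the circle and close to 0 on the other half, and singular values in
  \<open>[\<delta>, 1 - \<delta>]\<close> keep \<open>Im (z\<^sup>2)\<close> at distance at least \<open>\<delta>\<close> from 0.

  Such an \<open>f\<close> of degree \<open>O(1/\<delta> log 1/\<epsilon>)\<close> is obtained by smoothing the indicator of a half circle with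
  a high power of the Fejer kernel, discretized at roots of unity. By Fejer-Riesz it has a
  complementary polynomial, and stripping off one degree at a time turns the pair into a sequence of
  rotations of a single qubit interleaved with controlled walks. Each attempt succeeds with
  probability at least 1/64, so \<open>O(log 1/\<beta>)\<close> attempts suffice.
\<close>

section \<open>Filters on the unit circle\<close>

text \<open>The circuit must be fixed before \<open>U\<close>, so its action is a polynomial
  identity in the eigenvalue of the walk, and one gate sequence serves all eigenvectors. The filter
  proper is \<open>F\<close> divided by \<open>z ^ M\<close>: only this Laurent polynomial is real
  on the circle, and the division is available because the walk can be undone with the same oracles.
  Smoothing by a finite sum over roots of unity keeps the filter an explicit polynomial, and
  discrete Parseval makes its normalization exactly independent of the point. The degree is
  1/\<delta> times log(1/\<epsilon>) because a kernel of width \<delta> has degree of order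
  1/\<delta>, and each further power of it halves the bound on the leakage outside that width. The
  bound 1/64 is the square of three factors 1/2: one leaves strict room for the complementary
  polynomial, one is the mean over the two eigenvalues, and one bounds the norm of the approximating
  operator on unit vectors from below. Of the two extra qubits, one carries the signal processing
  and the other the flag.\<close>

lemma sum_roots_of_unity_power:
  fixes k l N :: nat
  assumes "k < N" "l < N"
  shows "(\<Sum>j<N. cis (2 * pi * real j / real N) ^ k * cnj (cis (2 * pi * real j / real N)) ^ l) =
    (if k = l then of_nat N else 0)"
proof -
  define \<omega> where "\<omega> = cis (2 * pi * (real k - real l) / real N)"
  have N: "N > 0" using assms by auto
  have term_eq: "cis (2 * pi * real j / real N) ^ k * cnj (cis (2 * pi * real j / real N)) ^ l = \<omega> ^ j" for j
    unfolding \<omega>_def cis_cnj DeMoivre cis_mult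
    by (rule arg_cong[where f = cis]) (simp add: algebra_simps diff_divide_distrib)
  show ?thesis
  proof (cases "k = l")
    case True
    then show ?thesis unfolding term_eq by (simp add: \<omega>_def)
  next
    case False
    have "\<omega> \<noteq> 1"
    proof
      assume "\<omega> = 1"
      then have "cos (2 * pi * (real k - real l) / real N) = 1"
        unfolding \<omega>_def by (metis cis.sel(1) one_complex.sel(1))
      then obtain n :: int where "2 * pi * (real k - real l) / real N = of_int n * 2 * pi"
        using cos_one_2pi_int by blast
      then have "(2 * pi) * (real k - real l) = (2 * pi) * (of_int n * real N)"
        using N by (simp add: field_simps)
      then have "real k - real l = of_int n * real N"
        using pi_neq_zero by (simp only: mult_cancel_left) simp
      then have "real_of_int (int k - int l) = real_of_int (n * int N)" by simp
      then have "int k - int l = n * int N" by linarith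
      then have "int N dvd int k - int l" by simp
      moreover have "\<bar>int k - int l\<bar> < int N" using assms by linarith
      ultimately show False using False zdvd_imp_le[of "int N" "\<bar>int k - int l\<bar>"] by auto
    qed
    moreover have "\<omega> ^ N = cis (2 * pi * real_of_int (int k - int l))"
      unfolding \<omega>_def DeMoivre using N by (intro arg_cong[where f = cis]) (simp add: field_simps)
    then have "\<omega> ^ N = 1" using cis_multiple_2pi[of "of_int (int k - int l)"] by (simp only: Ints_of_int)
    ultimately show ?thesis unfolding term_eq using False
      by (simp add: sum_gp_strict)
  qed
qed

text \<open>Powers below \<open>N\<close> are orthogonal on the \<open>N\<close>-th roots of unity.
  The right side does not depend on \<open>z\<close>, which later makes the normalization of the
  filter a constant.\<close>

lemma parseval_roots_of_unity:
  fixes q :: "complex poly"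
  assumes "degree q < N" "cmod z = 1"
  shows "(\<Sum>j<N. (cmod (poly q (z * cnj (cis (2 * pi * real j / real N)))))\<^sup>2) =
    real N * (\<Sum>k<N. (cmod (coeff q k))\<^sup>2)"
proof -
  define w where "w = (\<lambda>j. cis (2 * pi * real j / real N))"
  have p: "poly q x = (\<Sum>k<N. coeff q k * x ^ k)" for x
    unfolding poly_altdef using assms(1) by (intro sum.mono_neutral_left) (auto simp: coeff_eq_0)
  have zz: "z ^ k * cnj z ^ k = 1" for k
    using assms(2) complex_norm_square[of z] by (metis mult_1 norm_one of_real_1 power_mult_distrib power_one)
  have "complex_of_real (\<Sum>j<N. (cmod (poly q (z * cnj (w j))))\<^sup>2) =
      (\<Sum>j<N. \<Sum>k<N. \<Sum>l<N. (coeff q k * cnj (coeff q l) * z ^ k * cnj z ^ l) * (w j ^ l * cnj (w j) ^ k))"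
    by (simp add: complex_norm_square p sum_product power_mult_distrib mult_ac del: of_real_power)
  also have "\<dots> = (\<Sum>k<N. \<Sum>l<N. (coeff q k * cnj (coeff q l) * z ^ k * cnj z ^ l) * (\<Sum>j<N. w j ^ l * cnj (w j) ^ k))"
    by (subst sum.swap, rule sum.cong[OF refl], subst sum.swap) (simp add: sum_distrib_left)
  also have "\<dots> = (\<Sum>k<N. \<Sum>l<N. (coeff q k * cnj (coeff q l) * z ^ k * cnj z ^ l) * (if l = k then of_nat N else 0))"
    unfolding w_def using sum_roots_of_unity_power by (intro sum.cong refl) auto
  also have "\<dots> = (\<Sum>k<N. of_nat N * (coeff q k * cnj (coeff q k)))"
    using zz by (intro sum.cong refl) (auto simp: if_distrib[where f = "\<lambda>x. _ * x"] sum.delta mult_ac cong: if_cong)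
  also have "\<dots> = complex_of_real (real N * (\<Sum>k<N. (cmod (coeff q k))\<^sup>2))"
    by (simp add: complex_norm_square sum_distrib_left del: of_real_power)
  finally show ?thesis unfolding w_def of_real_eq_iff .
qed

text \<open>Power mean inequality with weights \<open>a j\<close>: the weighted mean of
  \<open>a\<close> is at least \<open>y\<close>, so that of its \<open>k\<close>-th power is at
  least \<open>y ^ k\<close>. Bernoulli supplies the tangent at \<open>a j = y\<close>.\<close>

lemma sum_power_Suc_ge:
  fixes a :: "'a \<Rightarrow> real"
  assumes "\<And>j. j \<in> J \<Longrightarrow> a j \<ge> 0" "finite J" "sum a J > 0"
    and y: "y > 0" "y * sum a J \<le> (\<Sum>j\<in>J. (a j)\<^sup>2)"
  shows "(\<Sum>j\<in>J. a j ^ Suc k) \<ge> sum a J * y ^ k"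
proof -
  have "a j * (y ^ k * (1 + real k * (a j / y - 1))) \<le> a j ^ Suc k" if "j \<in> J" for j
  proof -
    have "1 + real k * (a j / y - 1) \<le> (1 + (a j / y - 1)) ^ k"
      using assms(1)[OF that] y by (intro Bernoulli_inequality) simp
    then have "y ^ k * (1 + real k * (a j / y - 1)) \<le> y ^ k * (a j / y) ^ k"
      using y by (intro mult_left_mono) auto
    also have "\<dots> = a j ^ k" using y by (simp add: power_divide)
    finally show ?thesis using assms(1)[OF that] by (simp add: mult_left_mono)
  qed
  then have "(\<Sum>j\<in>J. a j * (y ^ k * (1 + real k * (a j / y - 1)))) \<le> (\<Sum>j\<in>J. a j ^ Suc k)"
    by (intro sum_mono)
  moreover have "(\<Sum>j\<in>J. a j * (y ^ k * (1 + real k * (a j / y - 1)))) =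
      y ^ k * (sum a J + real k * ((\<Sum>j\<in>J. (a j)\<^sup>2) / y - sum a J))"
    by (simp add: sum_distrib_left sum_distrib_right sum.distrib sum_subtractf algebra_simps power2_eq_square sum_divide_distrib)
  moreover have "(\<Sum>j\<in>J. (a j)\<^sup>2) / y - sum a J \<ge> 0"
    using y by (simp add: field_simps)
  then have "y ^ k * (sum a J + real k * ((\<Sum>j\<in>J. (a j)\<^sup>2) / y - sum a J)) \<ge> y ^ k * sum a J"
    using y by (intro mult_left_mono) auto
  ultimately show ?thesis by (simp add: mult.commute)
qed


text \<open>Cauchy-Schwarz against the constant vector, from the nonnegativity of a scaled
  variance.\<close>

lemma square_sum_le_card:
  fixes a :: "'a \<Rightarrow> real"
  assumes "finite J"
  shows "(sum a J)\<^sup>2 \<le> (\<Sum>j\<in>J. (a j)\<^sup>2) * real (card J)"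
proof (cases "J = {}")
  case False
  define n where "n = real (card J)"
  have n: "n > 0" using False assms by (simp add: n_def card_gt_0_iff)
  have "0 \<le> (\<Sum>j\<in>J. (n * a j - sum a J)\<^sup>2)" by (intro sum_nonneg) auto
  also have "\<dots> = (\<Sum>j\<in>J. n\<^sup>2 * (a j)\<^sup>2 - 2 * n * sum a J * a j + (sum a J)\<^sup>2)"
    by (simp add: power2_eq_square algebra_simps)
  also have "\<dots> = n\<^sup>2 * (\<Sum>j\<in>J. (a j)\<^sup>2) - 2 * n * sum a J * sum a J + n * (sum a J)\<^sup>2"
    by (simp only: sum.distrib sum_subtractf flip: sum_distrib_left) (simp add: n_def)
  also have "\<dots> = n * (n * (\<Sum>j\<in>J. (a j)\<^sup>2) - (sum a J)\<^sup>2)"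
    by (simp add: power2_eq_square algebra_simps)
  finally show ?thesis using n by (simp add: zero_le_mult_iff n_def mult.commute)
qed simp

text \<open>The geometric sum is self-reciprocal, so \<open>g\<close> equals its own conjugate up to
  the phase \<open>w ^ (m - 1)\<close>. Hence the squared modulus of \<open>g\<close>, an
  unnormalized Fejer kernel, is a polynomial in \<open>w\<close> up to that phase.\<close>

lemma geometric_poly_square:
  fixes m :: nat and w :: complex
  assumes "cmod w = 1"
  defines "g \<equiv> \<Sum>k<m. w ^ k"
  shows "g\<^sup>2 = w ^ (m - 1) * of_real ((cmod g)\<^sup>2)"
proof -
  have ww: "w * cnj w = 1"
    using assms(1) complex_norm_square[of w] by simp
  have "w ^ (m - 1) * cnj (w ^ k) = w ^ (m - Suc k)" if "k < m" for k
  proof -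
    have "m - 1 = (m - Suc k) + k" using that by simp
    then have "w ^ (m - 1) * cnj (w ^ k) = w ^ (m - Suc k) * (w * cnj w) ^ k"
      by (simp only: power_add power_mult_distrib complex_cnj_power mult.assoc)
    then show ?thesis by (simp add: ww)
  qed
  then have "w ^ (m - 1) * cnj g = (\<Sum>k<m. w ^ (m - Suc k))"
    unfolding g_def by (simp add: sum_distrib_left)
  also have "\<dots> = g" unfolding g_def by (rule sum.nat_diff_reindex)
  finally have *: "w ^ (m - 1) * cnj g = g" .
  have "g\<^sup>2 = g * (w ^ (m - 1) * cnj g)" by (simp only: * power2_eq_square)
  then show ?thesis by (simp add: complex_norm_square mult_ac del: of_real_power)
qed

text \<open>\<open>t\<close> is the share of the kernel mass around \<open>z\<close> that falls on
  nodes in the half circle selected by \<open>\<tau>\<close>. If \<open>z\<close> is \<delta> away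
  from the real axis, every node on the other side is at distance at least \<delta>, where the
  kernel is small.\<close>

lemma half_circle_filter:
  fixes \<delta> \<eta> \<tau> :: real
  assumes "0 < \<delta>" "\<delta> \<le> 1" "0 < \<eta>" "\<eta> < 1" "\<bar>\<tau>\<bar> = 1"
  obtains M :: nat and F :: "complex poly" where
    "degree F \<le> 2 * M" "real M \<le> 5 / \<delta> * (log 2 (1 / \<eta>) + 2)"
    "\<And>z. cmod z = 1 \<Longrightarrow> \<exists>t. 0 \<le> t \<and> t \<le> 1 \<and> poly F z = z ^ M * of_real t \<and>
       (\<tau> * Im z \<ge> \<delta> \<longrightarrow> t \<ge> 1 - \<eta>) \<and> (\<tau> * Im z \<le> - \<delta> \<longrightarrow> t \<le> \<eta>)"
proof -
  \<comment> \<open>With m at least 4/\<delta>, the kernel bound 4/\<delta>^2 at far nodes is at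
    most m^2/4, half of the level m^2/2 guaranteed for the weighted mean. \<open>k\<close> such
    halvings bring the tail below \<eta>.\<close>
  define m where "m = nat \<lceil>4 / \<delta>\<rceil>"
  define k where "k = nat \<lceil>log 2 (1 / \<eta>)\<rceil>"
  define r where "r = Suc k"
  define M where "M = (m - 1) * r"
  \<comment> \<open>More nodes than the degree of \<open>g ^ i\<close> for all
    \<open>i \<le> 2 * r\<close>, so that Parseval is exact.\<close>
  define N where "N = 2 * r * m"
  define \<omega> where "\<omega> = (\<lambda>j. cis (2 * pi * real j / real N))"
  define g where "g = (\<Sum>k<m. monom (1::complex) k)"
  define a where "a = (\<lambda>z j. (cmod (poly g (z * cnj (\<omega> j))))\<^sup>2)"
  define T where "T = real N * (\<Sum>k<N. (cmod (coeff (g ^ r) k))\<^sup>2)"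
  define J where "J = {j\<in>{..<N}. \<tau> * Im (\<omega> j) > 0}"
  \<comment> \<open>The factor \<open>\<omega> j ^ M\<close> aligns the phases: on the circle each
    summand is \<open>z ^ M\<close> times the real kernel centred at
    \<open>\<omega> j\<close>.\<close>
  define F where "F = smult (of_real (1 / T)) (\<Sum>j\<in>J. smult (\<omega> j ^ M) (pcompose (g ^ (2 * r)) [:0, cnj (\<omega> j):]))"
  have m4: "real m \<ge> 4 / \<delta>" unfolding m_def by linarith
  have m_pos: "m > 0"
  proof -
    have "4 / \<delta> > 0" using assms by simp
    then show ?thesis using m4 by (metis gr0I not_less of_nat_0)
  qed
  have m5: "real m \<le> 5 / \<delta>"
  proof -
    have "4 / \<delta> > 0" "1 \<le> 1 / \<delta>" using assms by auto
    then have "real m \<le> 4 / \<delta> + 1" unfolding m_def by linarith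
    also have "\<dots> \<le> 4 / \<delta> + 1 / \<delta>" using \<open>1 \<le> 1 / \<delta>\<close> by simp
    finally show ?thesis by simp
  qed
  have log0: "log 2 (1 / \<eta>) \<ge> 0" using assms by simp
  have k_ge: "real k \<ge> log 2 (1 / \<eta>)" and k_le: "real k \<le> log 2 (1 / \<eta>) + 1"
    unfolding k_def using log0 by linarith+
  have half_k: "(1 / 2) ^ k \<le> \<eta>"
  proof -
    have "1 / \<eta> = 2 powr log 2 (1 / \<eta>)" using assms by simp
    also have "\<dots> \<le> 2 powr real k" using k_ge by (intro powr_mono) auto
    also have "\<dots> = 2 ^ k" by (simp add: powr_realpow)
    finally show ?thesis using assms by (simp add: field_simps power_divide)
  qed
  have N_pos: "N > 0" unfolding N_def r_def using m_pos by simp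
  have mod_w: "cmod (z * cnj (\<omega> j)) = 1" if "cmod z = 1" for z j
    using that by (simp add: \<omega>_def norm_mult)
  have w_cnj: "cnj (\<omega> j) * \<omega> j = 1" for j
    by (simp add: \<omega>_def cis_cnj cis_mult)
  have poly_g: "poly g x = (\<Sum>k<m. x ^ k)" for x
    by (simp add: g_def poly_sum poly_monom)
  have deg_g: "degree g \<le> m - 1"
    unfolding g_def by (intro degree_sum_le) (auto simp: degree_monom_eq)
  have coeff_g: "coeff g i = (if i < m then 1 else 0)" for i
    by (simp add: g_def coeff_sum if_distrib sum.delta cong: if_cong)
  have deg_pow: "degree (g ^ i) \<le> (m - 1) * i" for i
    using degree_power_le[of g i] deg_g by (meson le_trans mult_le_mono1)
  have deg_lt: "(m - 1) * i < N" if "i \<le> 2 * r" for i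
  proof -
    have "(m - 1) * i \<le> (m - 1) * (2 * r)" using that by simp
    also have "\<dots> < m * (2 * r)"
      by (rule mult_strict_right_mono) (use m_pos in \<open>auto simp: r_def\<close>)
    finally show ?thesis by (simp add: N_def mult_ac)
  qed
  have sum_a: "(\<Sum>j<N. a z j) = real N * real m" if "cmod z = 1" for z
  proof -
    have "(\<Sum>j<N. a z j) = real N * (\<Sum>k<N. (cmod (coeff g k))\<^sup>2)"
      unfolding a_def \<omega>_def using deg_g deg_lt[of 1] that
      by (intro parseval_roots_of_unity) (auto simp: r_def)
    also have "(\<Sum>k<N. (cmod (coeff g k))\<^sup>2) = (\<Sum>k<m. 1)"
      using m_pos by (intro sum.mono_neutral_cong_right) (auto simp: coeff_g N_def r_def)
    finally show ?thesis by simp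
  qed
  \<comment> \<open>The coefficients of \<open>g ^ 2\<close> sum to m^2 and at most 2m of them are
    nonzero, so by Cauchy-Schwarz their squared moduli sum to at least m^3/2.\<close>
  have sum_a2: "(\<Sum>j<N. (a z j)\<^sup>2) \<ge> (real m)\<^sup>2 / 2 * (real N * real m)" if "cmod z = 1" for z
  proof -
    have "(\<Sum>j<N. (a z j)\<^sup>2) = real N * (\<Sum>k<N. (cmod (coeff (g ^ 2) k))\<^sup>2)"
      using deg_pow[of 2] deg_lt[of 2] that parseval_roots_of_unity[of "g ^ 2" N z]
      by (simp add: a_def \<omega>_def r_def norm_power)
    moreover have "(\<Sum>k<N. (cmod (coeff (g ^ 2) k))\<^sup>2) \<ge> (real m) ^ 3 / 2"
    proof -
      have d: "degree (g ^ 2) < 2 * m" using deg_pow[of 2] m_pos by linarith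
      have "(of_nat m)\<^sup>2 = poly (g ^ 2) 1" by (simp add: poly_g)
      also have "\<dots> = (\<Sum>k<2*m. coeff (g ^ 2) k)"
        unfolding poly_altdef using d by (intro sum.mono_neutral_cong_left) (auto simp: coeff_eq_0)
      finally have "(real m)\<^sup>2 = cmod (\<Sum>k<2*m. coeff (g ^ 2) k)"
        by (metis norm_of_nat norm_power)
      also have "\<dots> \<le> (\<Sum>k<2*m. cmod (coeff (g ^ 2) k))" by (rule norm_sum)
      finally have "((real m)\<^sup>2)\<^sup>2 \<le> (\<Sum>k<2*m. cmod (coeff (g ^ 2) k))\<^sup>2"
        by (intro power_mono) auto
      also have "\<dots> \<le> (\<Sum>k<2*m. (cmod (coeff (g ^ 2) k))\<^sup>2) * card {..<2*m}"
        by (rule square_sum_le_card) simp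
      also have "(\<Sum>k<2*m. (cmod (coeff (g ^ 2) k))\<^sup>2) \<le> (\<Sum>k<N. (cmod (coeff (g ^ 2) k))\<^sup>2)"
        by (intro sum_mono2) (auto simp: N_def r_def)
      finally have "((real m)\<^sup>2)\<^sup>2 \<le> (\<Sum>k<N. (cmod (coeff (g ^ 2) k))\<^sup>2) * card {..<2*m}"
        by (simp add: mult_right_mono)
      then have "real m * (real m ^ 3 / 2) \<le> real m * (\<Sum>k<N. (cmod (coeff (g ^ 2) k))\<^sup>2)"
        by (simp add: power2_eq_square power3_eq_cube mult_ac)
      then show ?thesis using m_pos by simp
    qed
    ultimately have "(\<Sum>j<N. (a z j)\<^sup>2) \<ge> real N * (real m ^ 3 / 2)" using N_pos by simp
    then show ?thesis by (simp add: power2_eq_square power3_eq_cube mult_ac)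
  qed
  have sum_ar: "(\<Sum>j<N. a z j ^ r) = T" if "cmod z = 1" for z
    using deg_pow[of r] deg_lt[of r] that parseval_roots_of_unity[of "g ^ r" N z]
    by (simp add: a_def \<omega>_def T_def norm_power power_mult[symmetric] mult.commute)
  have T_ge: "T \<ge> real N * real m * ((real m)\<^sup>2 / 2) ^ k"
    unfolding sum_ar[of 1, simplified, symmetric] r_def sum_a[of 1, simplified, symmetric]
    using sum_a2[of 1] sum_a[of 1] m_pos N_pos
    by (intro sum_power_Suc_ge) (auto simp: a_def)
  have T_pos: "T > 0"
    using N_pos m_pos by (intro less_le_trans[OF _ T_ge]) auto
  \<comment> \<open>Away from 1 the geometric sum is at most 2 / |w - 1|. One factor
    \<open>a z j\<close> is kept aside, because its sum over all nodes is known exactly.\<close>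
  have tail: "(\<Sum>j\<in>I. a z j ^ r) / T \<le> \<eta>"
    if z: "cmod z = 1" and I: "I \<subseteq> {..<N}" and far: "\<And>j. j \<in> I \<Longrightarrow> cmod (z - \<omega> j) \<ge> \<delta>" for z I
  proof -
    have a_le: "a z j \<le> 4 / \<delta>\<^sup>2" if "j \<in> I" for j
    proof -
      let ?w = "z * cnj (\<omega> j)"
      have "(?w - 1) * \<omega> j = z * (cnj (\<omega> j) * \<omega> j) - \<omega> j" by (simp add: algebra_simps)
      then have "z - \<omega> j = (?w - 1) * \<omega> j" using w_cnj by simp
      then have "cmod (?w - 1) = cmod (z - \<omega> j)" by (simp add: norm_mult \<omega>_def)
      then have d: "cmod (?w - 1) \<ge> \<delta>" using far[OF that] by simp
      have "(?w - 1) * poly g ?w = ?w ^ m - 1"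
        unfolding poly_g using power_diff_1_eq[of ?w m] by simp
      then have "cmod (?w - 1) * cmod (poly g ?w) \<le> 2"
        using norm_triangle_ineq4[of "?w ^ m" 1] mod_w[OF z, of j]
        by (metis norm_mult norm_one norm_power one_add_one power_one)
      then have "\<delta> * cmod (poly g ?w) \<le> 2"
        using d by (meson mult_right_mono norm_ge_zero order_trans)
      then have "cmod (poly g ?w) \<le> 2 / \<delta>" using assms by (simp add: field_simps)
      then have "(cmod (poly g ?w))\<^sup>2 \<le> (2 / \<delta>)\<^sup>2" by (intro power_mono) auto
      then show ?thesis by (simp add: a_def power_divide)
    qed
    have "(\<Sum>j\<in>I. a z j ^ r) \<le> (\<Sum>j\<in>I. a z j * (4 / \<delta>\<^sup>2) ^ k)"
      using a_le by (intro sum_mono) (auto simp: r_def a_def intro!: mult_left_mono power_mono)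
    also have "\<dots> = (\<Sum>j\<in>I. a z j) * (4 / \<delta>\<^sup>2) ^ k" by (simp add: sum_distrib_right)
    also have "\<dots> \<le> (\<Sum>j<N. a z j) * (4 / \<delta>\<^sup>2) ^ k"
      using I by (intro mult_right_mono sum_mono2) (auto simp: a_def)
    also have "\<dots> = real N * real m * (4 / \<delta>\<^sup>2) ^ k" using sum_a[OF z] by simp
    also have "4 / \<delta>\<^sup>2 \<le> (real m)\<^sup>2 / 2 * (1 / 2)"
    proof -
      have "(4 / \<delta>)\<^sup>2 \<le> (real m)\<^sup>2" using m4 assms by (intro power_mono) auto
      then show ?thesis by (simp add: power_divide)
    qed
    then have "real N * real m * (4 / \<delta>\<^sup>2) ^ k \<le> real N * real m * ((real m)\<^sup>2 / 2 * (1 / 2)) ^ k"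
      by (intro mult_left_mono power_mono) auto
    also have "\<dots> = real N * real m * ((real m)\<^sup>2 / 2) ^ k * (1 / 2) ^ k"
      by (simp only: power_mult_distrib mult.assoc)
    also have "\<dots> \<le> T * \<eta>" using T_ge half_k T_pos by (intro mult_mono) auto
    finally show ?thesis using T_pos by (simp add: field_simps)
  qed
  show ?thesis
  proof
    have "degree (pcompose (g ^ (2 * r)) [:0, cnj (\<omega> j):]) \<le> 2 * M" for j
    proof -
      have "degree (pcompose (g ^ (2 * r)) [:0, cnj (\<omega> j):]) \<le> degree (g ^ (2 * r)) * degree [:0, cnj (\<omega> j):]"
        by (rule degree_pcompose_le)
      also have "\<dots> \<le> degree (g ^ (2 * r)) * 1" by (intro mult_left_mono) auto
      also have "\<dots> \<le> 2 * M" using deg_pow[of "2 * r"] by (simp add: M_def mult_ac)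
      finally show ?thesis .
    qed
    then show "degree F \<le> 2 * M"
      unfolding F_def
      by (intro order_trans[OF degree_smult_le] degree_sum_le) (auto simp: J_def intro: order_trans[OF degree_smult_le])
    have "real M \<le> real m * real r" by (simp add: M_def mult_right_mono of_nat_diff m_pos del: of_nat_Suc)
    also have "\<dots> \<le> 5 / \<delta> * (log 2 (1 / \<eta>) + 2)"
      using m5 k_le assms by (intro mult_mono) (auto simp: r_def)
    finally show "real M \<le> 5 / \<delta> * (log 2 (1 / \<eta>) + 2)" .
  next
    fix z :: complex assume z: "cmod z = 1"
    define t where "t = (\<Sum>j\<in>J. a z j ^ r) / T"
    define I where "I = {..<N} - J"
    have "(\<Sum>j\<in>I. a z j ^ r) + (\<Sum>j\<in>J. a z j ^ r) = T"
      unfolding I_def sum_ar[OF z, symmetric] by (intro sum.subset_diff[symmetric]) (auto simp: J_def)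
    then have "t = (T - (\<Sum>j\<in>I. a z j ^ r)) / T"
      by (simp add: t_def algebra_simps)
    then have t_compl: "t = 1 - (\<Sum>j\<in>I. a z j ^ r) / T"
      using T_pos by (simp add: diff_divide_distrib)
    have "t \<ge> 0" "(\<Sum>j\<in>I. a z j ^ r) / T \<ge> 0"
      unfolding t_def using T_pos by (auto intro!: divide_nonneg_pos sum_nonneg simp: a_def)
    moreover have "poly F z = z ^ M * of_real t"
    proof -
      have "\<omega> j ^ M * poly g (z * cnj (\<omega> j)) ^ (2 * r) = z ^ M * of_real (a z j ^ r)" for j
      proof -
        let ?w = "z * cnj (\<omega> j)"
        have "\<omega> j * ?w = z * (cnj (\<omega> j) * \<omega> j)" by (simp add: mult_ac)
        then have "\<omega> j * ?w = z" using w_cnj by simp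
        have "poly g ?w ^ (2 * r) = (?w ^ (m - 1) * of_real (a z j)) ^ r"
          unfolding power_mult a_def poly_g using geometric_poly_square[OF mod_w[OF z, of j], of m] by simp
        also have "\<dots> = ?w ^ M * of_real (a z j ^ r)"
          by (simp add: power_mult_distrib power_mult[symmetric] M_def)
        finally have "\<omega> j ^ M * poly g ?w ^ (2 * r) = (\<omega> j * ?w) ^ M * of_real (a z j ^ r)"
          by (simp add: power_mult_distrib mult_ac)
        then show ?thesis using \<open>\<omega> j * ?w = z\<close> by simp
      qed
      then show ?thesis
        by (simp add: F_def poly_sum poly_pcompose t_def sum_distrib_left mult.commute[of _ z] flip: of_real_power)
          (simp add: sum_divide_distrib)
    qed
    moreover have "(\<Sum>j\<in>I. a z j ^ r) / T \<le> \<eta>" if "\<tau> * Im z \<ge> \<delta>"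
    proof (rule tail[OF z])
      fix j assume "j \<in> I"
      then have "\<tau> * Im (\<omega> j) \<le> 0" by (auto simp: I_def J_def)
      then have "\<delta> \<le> \<bar>\<tau>\<bar> * \<bar>Im (z - \<omega> j)\<bar>"
        using that by (simp flip: abs_mult add: algebra_simps)
      then show "\<delta> \<le> cmod (z - \<omega> j)"
        using abs_Im_le_cmod[of "z - \<omega> j"] assms by simp
    qed (auto simp: I_def)
    moreover have "t \<le> \<eta>" if "\<tau> * Im z \<le> - \<delta>"
      unfolding t_def
    proof (rule tail[OF z])
      fix j assume "j \<in> J"
      then have "\<tau> * Im (\<omega> j) \<ge> 0" by (auto simp: J_def)
      then have "\<delta> \<le> \<bar>\<tau>\<bar> * \<bar>Im (z - \<omega> j)\<bar>"
        using that by (simp flip: abs_mult add: algebra_simps)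
      then show "\<delta> \<le> cmod (z - \<omega> j)"
        using abs_Im_le_cmod[of "z - \<omega> j"] assms by simp
    qed (auto simp: J_def)
    ultimately show "\<exists>t. 0 \<le> t \<and> t \<le> 1 \<and> poly F z = z ^ M * of_real t \<and>
       (\<tau> * Im z \<ge> \<delta> \<longrightarrow> t \<ge> 1 - \<eta>) \<and> (\<tau> * Im z \<le> - \<delta> \<longrightarrow> t \<le> \<eta>)"
      using t_compl by (intro exI[of _ t]) auto
  qed
qed

section \<open>Complementary polynomials and layer stripping\<close>

text \<open>Turns identities on the circle into identities of coefficients. The circle is infinite
  because \<open>cis\<close> is injective on {0..1}, an interval inside {0..pi}.\<close>

lemma poly_eq_on_unit_circle:
  fixes p q :: "complex poly"
  assumes "\<And>z. cmod z = 1 \<Longrightarrow> poly p z = poly q z"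
  shows "p = q"
proof (rule ccontr)
  assume "p \<noteq> q"
  then have "finite {z. poly (p - q) z = 0}" by (intro poly_roots_finite) simp
  moreover have "{z. cmod z = 1} \<subseteq> {z. poly (p - q) z = 0}" using assms by auto
  ultimately have "finite {z. cmod z = 1}" by (rule rev_finite_subset)
  moreover have "inj_on cis {0..1}"
  proof (rule inj_onI)
    fix x y :: real assume "x \<in> {0..1}" "y \<in> {0..1}" "cis x = cis y"
    moreover from this have "cos x = cos y" by (metis cis.sel(1))
    moreover have "(1::real) \<le> pi" using pi_ge_two by simp
    ultimately show "x = y" using cos_inj_pi[of x y] by auto
  qed
  then have "infinite (cis ` {0..1})" using finite_imageD infinite_Icc[of 0 "1::real"] by auto
  moreover have "cis ` {0..1} \<subseteq> {z. cmod z = 1}" by auto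
  ultimately show False using finite_subset by blast
qed

text \<open>The reciprocal polynomial for formal degree \<open>n\<close>. On the circle it is
  \<open>z ^ n\<close> times the conjugate of \<open>p\<close>, which makes squared moduli
  polynomial.\<close>

definition conj_reverse :: "nat \<Rightarrow> complex poly \<Rightarrow> complex poly" where
  "conj_reverse n p = (\<Sum>k\<le>n. monom (cnj (coeff p (n - k))) k)"

lemma coeff_conj_reverse: "coeff (conj_reverse n p) k = (if k \<le> n then cnj (coeff p (n - k)) else 0)"
  by (simp add: conj_reverse_def coeff_sum if_distrib sum.delta cong: if_cong)

lemma degree_conj_reverse: "degree (conj_reverse n p) \<le> n"
  by (intro degree_le) (simp add: coeff_conj_reverse)

lemma poly_conj_reverse:
  assumes "degree p \<le> n" "z \<noteq> 0"
  shows "poly (conj_reverse n p) z = z ^ n * cnj (poly p (1 / cnj z))"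
proof -
  have "poly (conj_reverse n p) z = (\<Sum>k\<le>n. cnj (coeff p (n - k)) * z ^ k)"
    by (simp add: conj_reverse_def poly_sum poly_monom)
  also have "\<dots> = (\<Sum>k\<le>n. cnj (coeff p k) * z ^ (n - k))"
    by (rule sum.reindex_bij_witness[of _ "\<lambda>k. n - k" "\<lambda>k. n - k"]) auto
  also have "\<dots> = (\<Sum>k\<le>n. z ^ n * (cnj (coeff p k) * (1 / z) ^ k))"
    using assms(2) by (intro sum.cong refl) (simp add: power_diff power_one_over field_simps)
  also have "\<dots> = z ^ n * cnj (\<Sum>k\<le>n. coeff p k * (1 / cnj z) ^ k)"
    by (simp add: sum_distrib_left)
  also have "(\<Sum>k\<le>n. coeff p k * (1 / cnj z) ^ k) = poly p (1 / cnj z)"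
    unfolding poly_altdef using assms(1) by (intro sum.mono_neutral_right) (auto simp: coeff_eq_0)
  finally show ?thesis .
qed

lemma unit_inverse_cnj: "cmod z = 1 \<Longrightarrow> 1 / cnj z = z"
  using complex_norm_square[of z] by (auto simp: divide_eq_eq)

lemma poly_conj_reverse_circle:
  assumes "degree p \<le> n" "cmod z = 1"
  shows "poly (conj_reverse n p) z = z ^ n * cnj (poly p z)"
proof -
  have "z \<noteq> 0" using assms(2) by auto
  then show ?thesis using poly_conj_reverse[OF assms(1)] unit_inverse_cnj[OF assms(2)] by simp
qed

text \<open>
  Strict positivity on the circle keeps the roots off it, so they come in distinct
  pairs \<open>r, 1 / cnj r\<close>, each pair contributing the factor \<open>(z - r) * (1 - cnj r * z) = z * |z - r|\<^sup>2\<close>.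
\<close>

lemma fejer_riesz:
  fixes R :: "complex poly"
  assumes "degree R \<le> 2 * n" "\<And>z. cmod z = 1 \<Longrightarrow> \<exists>t::real. t > 0 \<and> poly R z = z ^ n * of_real t"
  shows "\<exists>G. degree G \<le> n \<and> (\<forall>z. cmod z = 1 \<longrightarrow> poly R z = z ^ n * of_real ((cmod (poly G z))\<^sup>2))"
  using assms
proof (induction n arbitrary: R)
  case 0
  then obtain c where R: "R = [:c:]" by (metis degree_eq_zeroE le_zero_eq mult_0_right)
  obtain t :: real where t: "t > 0" "c = of_real t" using 0(2)[of 1] R by auto
  show ?case
    by (rule exI[of _ "[:of_real (sqrt t):]"]) (use R t in auto)
next
  case (Suc n)
  have circle_nz: "z \<noteq> 0" if "cmod z = 1" for z using that by auto
  \<comment> \<open>\<open>R\<close> divided by \<open>z ^ Suc n\<close> is real on the circle, so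
    \<open>R\<close> is its own reciprocal: coefficients at opposite ends are conjugate, and nonzero
    roots are symmetric in the circle.\<close>
  have self: "conj_reverse (2 * Suc n) R = R"
  proof (rule poly_eq_on_unit_circle)
    fix z :: complex assume z: "cmod z = 1"
    obtain t :: real where t: "poly R z = z ^ Suc n * of_real t" using Suc.prems(2)[OF z] by auto
    have zz: "z * cnj z = 1" using z complex_norm_square[of z] by simp
    have "poly (conj_reverse (2 * Suc n) R) z = z ^ (2 * Suc n) * cnj (z ^ Suc n * of_real t)"
      using poly_conj_reverse_circle[OF Suc.prems(1) z] t by simp
    also have "z ^ (2 * Suc n) = z ^ Suc n * z ^ Suc n" by (simp only: mult_2 power_add)
    also have "z ^ Suc n * z ^ Suc n * cnj (z ^ Suc n * of_real t) = z ^ Suc n * of_real t * (z * cnj z) ^ Suc n"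
      by (simp only: power_add power_mult_distrib complex_cnj_mult complex_cnj_power complex_cnj_complex_of_real mult_ac)
    finally show "poly (conj_reverse (2 * Suc n) R) z = poly R z" using zz t by simp
  qed
  have top: "coeff R (2 * Suc n) = cnj (coeff R 0)"
    using coeff_conj_reverse[of "2 * Suc n" R "2 * Suc n"] unfolding self by simp
  show ?case
  proof (cases "coeff R 0 = 0")
    \<comment> \<open>A vanishing constant coefficient forces a vanishing top one, so removing one
      factor \<open>z\<close> lowers the formal degree by two.\<close>
    case True
    then obtain R' where R': "R = pCons 0 R'" by (metis coeff_pCons_0 pCons_cases)
    have "degree R \<noteq> 2 * Suc n"
      using True top by (metis coeff_0 complex_cnj_zero degree_0 leading_coeff_0_iff nat.distinct(1) mult_eq_0_iff zero_neq_numeral)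
    then have "degree R' \<le> 2 * n \<or> R' = 0" using Suc.prems(1) R' by (auto split: if_splits simp: degree_pCons_eq_if)
    moreover have "coeff R (2 * Suc n) = 0" using True top by simp
    then have "coeff R' (2 * n + 1) = 0" using R' by (simp add: coeff_pCons)
    ultimately have deg: "degree R' \<le> 2 * n"
      by auto
    have pos: "\<exists>t::real. t > 0 \<and> poly R' z = z ^ n * of_real t" if "cmod z = 1" for z
      using Suc.prems(2)[OF that] circle_nz[OF that] by (auto simp: R')
    from Suc.IH[OF deg pos] obtain G where "degree G \<le> n"
      "\<And>z. cmod z = 1 \<Longrightarrow> poly R' z = z ^ n * of_real ((cmod (poly G z))\<^sup>2)" by blast
    then show ?thesis by (intro exI[of _ G]) (auto simp: R')
  next
    case False
    then have "coeff R (2 * Suc n) \<noteq> 0" using top by simp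
    then have "degree R \<noteq> 0" using le_degree by fastforce
    then have "\<not> constant (poly R)" by (simp add: constant_degree)
    then obtain r where r: "poly R r = 0" using fundamental_theorem_of_algebra by blast
    have r0: "r \<noteq> 0" using False r by (auto simp: poly_0_coeff_0)
    have off_circle: "poly R z \<noteq> 0" if "cmod z = 1" for z
      using Suc.prems(2)[OF that] circle_nz[OF that] by auto
    then have r1: "cmod r \<noteq> 1" using r by auto
    define r' where "r' = 1 / cnj r"
    have "r' \<noteq> 0" using r0 by (simp add: r'_def)
    then have "poly R r' = r' ^ (2 * Suc n) * cnj (poly R r)"
      using poly_conj_reverse[OF Suc.prems(1), of r'] unfolding self by (simp add: r'_def)
    then have "poly R r' = 0" using r by simp
    have "r \<noteq> r'"
    proof
      assume "r = r'"
      then have "r * cnj r = 1" using r0 by (simp add: r'_def field_simps)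
      then have "(cmod r)\<^sup>2 = 1" using complex_norm_square[of r] by (metis of_real_1 of_real_eq_iff)
      then show False using r1 by (simp add: power2_eq_1_iff) (metis norm_ge_zero not_one_le_zero le_minus_one_simps(3))
    qed
    obtain R1 where R1: "R = [:- r, 1:] * R1" using r by (metis dvdE poly_eq_0_iff_dvd)
    then have "poly R1 r' = 0" using \<open>poly R r' = 0\<close> \<open>r \<noteq> r'\<close> by simp
    then obtain R2 where R2: "R1 = [:- r', 1:] * R2" by (metis dvdE poly_eq_0_iff_dvd)
    define R3 where "R3 = smult (- 1 / cnj r) R2"
    have "[:- r', 1:] = smult (- 1 / cnj r) [:1, - cnj r:]" using r0 by (simp add: r'_def)
    then have fac: "R = [:- r, 1:] * [:1, - cnj r:] * R3"
      by (simp only: R1 R2 R3_def mult_smult_left mult_smult_right mult.assoc)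
    have "R \<noteq> 0" using \<open>degree R \<noteq> 0\<close> by auto
    then have "R3 \<noteq> 0" using fac by auto
    then have "degree R = 2 + degree R3"
      using r0 unfolding fac by (subst degree_mult_eq; simp)+
    then have deg: "degree R3 \<le> 2 * n" using Suc.prems(1) by simp
    have on_circle: "poly R z = z * of_real ((cmod (z - r))\<^sup>2) * poly R3 z" if "cmod z = 1" for z
    proof -
      have zz: "z * cnj z = 1" using that complex_norm_square[of z] by simp
      have "z * of_real ((cmod (z - r))\<^sup>2) = (z - r) * (z * cnj z - cnj r * z)"
        by (simp add: complex_norm_square algebra_simps del: of_real_power)
      then have "z * of_real ((cmod (z - r))\<^sup>2) = (z - r) * (1 - cnj r * z)" unfolding zz .
      moreover have "poly R z = (z - r) * (1 - cnj r * z) * poly R3 z"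
        unfolding fac by (simp add: algebra_simps)
      ultimately show ?thesis by simp
    qed
    have pos: "\<exists>t::real. t > 0 \<and> poly R3 z = z ^ n * of_real t" if z: "cmod z = 1" for z
    proof -
      obtain t :: real where t: "t > 0" "poly R z = z ^ Suc n * of_real t" using Suc.prems(2)[OF z] by auto
      have d: "cmod (z - r) > 0" using r1 z by auto
      have "of_real ((cmod (z - r))\<^sup>2) * poly R3 z = z ^ n * of_real t"
        using on_circle[OF z] t circle_nz[OF z] by simp
      then have "poly R3 z = z ^ n * of_real (t / (cmod (z - r))\<^sup>2)"
        using d by (simp add: field_simps)
      then show ?thesis using t d by (intro exI[of _ "t / (cmod (z - r))\<^sup>2"]) auto
    qed
    from Suc.IH[OF deg pos] obtain G where G: "degree G \<le> n"
      "\<And>z. cmod z = 1 \<Longrightarrow> poly R3 z = z ^ n * of_real ((cmod (poly G z))\<^sup>2)" by blast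
    show ?thesis
    proof (intro exI[of _ "[:- r, 1:] * G"] conjI allI impI)
      have "degree ([:- r, 1:] * G) \<le> degree [:- r, 1:] + degree G" by (rule degree_mult_le)
      then show "degree ([:- r, 1:] * G) \<le> Suc n" using G(1) by simp
      show "poly R z = z ^ Suc n * of_real ((cmod (poly ([:- r, 1:] * G) z))\<^sup>2)" if "cmod z = 1" for z
      proof -
        have "poly ([:- r, 1:] * G) z = (z - r) * poly G z" by (simp add: algebra_simps)
        then show ?thesis
          using on_circle[OF that] G(2)[OF that] by (simp only: norm_mult power_mult_distrib) (simp add: mult_ac)
      qed
    qed
  qed
qed

text \<open>Fejer-Riesz for \<open>z ^ n\<close> times 1 - |F|^2, written as a polynomial with the
  help of the reciprocal of \<open>F\<close>. The strict bound on \<open>F\<close> supplies the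
  strict positivity required there.\<close>

lemma complementary_poly:
  fixes F :: "complex poly"
  assumes "degree F \<le> n" "\<And>z. cmod z = 1 \<Longrightarrow> cmod (poly F z) < 1"
  obtains G where "degree G \<le> n"
    "\<And>z. cmod z = 1 \<Longrightarrow> (cmod (poly F z))\<^sup>2 + (cmod (poly G z))\<^sup>2 = 1"
proof -
  define R where "R = monom 1 n - F * conj_reverse n F"
  have R: "poly R z = z ^ n * of_real (1 - (cmod (poly F z))\<^sup>2)" if "cmod z = 1" for z
    by (simp add: R_def poly_monom poly_conj_reverse_circle[OF assms(1) that] complex_norm_square algebra_simps del: of_real_power)
  have "degree (F * conj_reverse n F) \<le> 2 * n"
    using degree_mult_le[of F "conj_reverse n F"] assms(1) degree_conj_reverse[of n F] by linarith
  then have "degree R \<le> 2 * n"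
    unfolding R_def by (intro degree_diff_le) (auto intro: order_trans[OF degree_monom_le])
  moreover have "\<exists>t::real. t > 0 \<and> poly R z = z ^ n * of_real t" if "cmod z = 1" for z
    using R[OF that] assms(2)[OF that]
    by (intro exI[of _ "1 - (cmod (poly F z))\<^sup>2"]) (auto simp: power_less_one_iff)
  ultimately obtain G where G: "degree G \<le> n"
    "\<And>z. cmod z = 1 \<Longrightarrow> poly R z = z ^ n * of_real ((cmod (poly G z))\<^sup>2)"
    using fejer_riesz by blast
  have "(cmod (poly F z))\<^sup>2 + (cmod (poly G z))\<^sup>2 = 1" if "cmod z = 1" for z
  proof -
    have "z \<noteq> 0" using that by auto
    then have "complex_of_real (1 - (cmod (poly F z))\<^sup>2) = of_real ((cmod (poly G z))\<^sup>2)"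
      using R[OF that] G(2)[OF that] by simp
    then have "1 - (cmod (poly F z))\<^sup>2 = (cmod (poly G z))\<^sup>2" by (simp only: of_real_eq_iff)
    then show ?thesis by simp
  qed
  with G(1) that show ?thesis by blast
qed

text \<open>One layer: a rotation makes the constant coefficient of \<open>F\<close> and the top coefficient of \<open>G\<close>
  vanish, which is possible because the vectors of constant and of top coefficients are orthogonal.\<close>

lemma peel_rotation:
  fixes F G :: "complex poly"
  assumes "degree F \<le> Suc n" "degree G \<le> Suc n"
    and one: "\<And>z. cmod z = 1 \<Longrightarrow> (cmod (poly F z))\<^sup>2 + (cmod (poly G z))\<^sup>2 = 1"
  obtains a b F' G' where "(cmod a)\<^sup>2 + (cmod b)\<^sup>2 = 1" "degree F' \<le> n" "degree G' \<le> n"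
    "\<And>z. cmod z = 1 \<Longrightarrow> (cmod (poly F' z))\<^sup>2 + (cmod (poly G' z))\<^sup>2 = 1"
    "\<And>z. poly F z = a * (z * poly F' z) - cnj b * poly G' z"
    "\<And>z. poly G z = b * (z * poly F' z) + cnj a * poly G' z"
proof -
  let ?f = "coeff F" and ?g = "coeff G" and ?n = "Suc n"
  \<comment> \<open>The normalization on the circle as a polynomial identity. Its constant
    coefficient is 0 because \<open>Suc n\<close> is positive, and it is also the inner product of
    the constant pair with the top pair.\<close>
  have "F * conj_reverse ?n F + G * conj_reverse ?n G = monom 1 ?n"
  proof (rule poly_eq_on_unit_circle)
    fix z :: complex assume z: "cmod z = 1"
    have "poly (F * conj_reverse ?n F + G * conj_reverse ?n G) z =
        z ^ ?n * (poly F z * cnj (poly F z) + poly G z * cnj (poly G z))"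
      using assms(1,2) z by (simp add: poly_conj_reverse_circle algebra_simps del: power_Suc)
    also have "\<dots> = z ^ ?n * of_real ((cmod (poly F z))\<^sup>2 + (cmod (poly G z))\<^sup>2)"
      by (simp only: of_real_add complex_norm_square)
    finally show "poly (F * conj_reverse ?n F + G * conj_reverse ?n G) z = poly (monom 1 ?n) z"
      unfolding one[OF z] by (simp add: poly_monom)
  qed
  then have "coeff (F * conj_reverse ?n F + G * conj_reverse ?n G) 0 = 0" by simp
  then have orth: "?f 0 * cnj (?f ?n) + ?g 0 * cnj (?g ?n) = 0"
    by (simp add: coeff_mult coeff_conj_reverse)
  have normalize: "\<exists>a b. (cmod a)\<^sup>2 + (cmod b)\<^sup>2 = 1 \<and> (\<exists>\<nu>. p = \<nu> * a \<and> q = \<nu> * b \<and> \<nu> \<noteq> 0)"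
    if "p \<noteq> 0 \<or> q \<noteq> 0" for p q :: complex
  proof -
    define \<nu> where "\<nu> = sqrt ((cmod p)\<^sup>2 + (cmod q)\<^sup>2)"
    have "(cmod p)\<^sup>2 + (cmod q)\<^sup>2 > 0"
      using that by (metis add_nonneg_pos add_pos_nonneg zero_le_power2 zero_less_norm_iff zero_less_power)
    then have "\<nu> > 0" "\<nu>\<^sup>2 = (cmod p)\<^sup>2 + (cmod q)\<^sup>2" by (auto simp: \<nu>_def)
    then show ?thesis
      by (intro exI[of _ "p / of_real \<nu>"] exI[of _ "q / of_real \<nu>"] conjI exI[of _ "of_real \<nu>"])
        (auto simp: norm_divide power_divide add_divide_distrib[symmetric])
  qed
  \<comment> \<open>Rotate the top pair onto the first axis; orthogonality then clears the first
    constant coefficient. If the top pair is zero, rotate the constant pair onto the second axis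
    instead; if both vanish, the identity rotation will do.\<close>
  have "\<exists>a b. (cmod a)\<^sup>2 + (cmod b)\<^sup>2 = 1 \<and> cnj a * ?f 0 + cnj b * ?g 0 = 0 \<and> - b * ?f ?n + a * ?g ?n = 0"
  proof (cases "?f ?n = 0 \<and> ?g ?n = 0")
    case False
    then obtain a b \<nu> where ab: "(cmod a)\<^sup>2 + (cmod b)\<^sup>2 = 1" "?f ?n = \<nu> * a" "?g ?n = \<nu> * b" "\<nu> \<noteq> 0"
      using normalize by blast
    have "cnj \<nu> * (cnj a * ?f 0 + cnj b * ?g 0) = 0" using orth ab by (simp add: algebra_simps)
    then show ?thesis using ab by (intro exI[of _ a] exI[of _ b]) auto
  next
    case top: True
    show ?thesis
    proof (cases "?f 0 = 0 \<and> ?g 0 = 0")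
      case True
      then show ?thesis using top by (intro exI[of _ 1] exI[of _ 0]) auto
    next
      case False
      then obtain a b \<nu> where "(cmod a)\<^sup>2 + (cmod b)\<^sup>2 = 1" "?f 0 = \<nu> * a" "?g 0 = \<nu> * b"
        using normalize by blast
      then show ?thesis using top
        by (intro exI[of _ "cnj b"] exI[of _ "- cnj a"]) (auto simp: algebra_simps)
    qed
  qed
  then obtain a b where ab: "(cmod a)\<^sup>2 + (cmod b)\<^sup>2 = 1"
    and low: "cnj a * ?f 0 + cnj b * ?g 0 = 0" and high: "- b * ?f ?n + a * ?g ?n = 0" by blast
  \<comment> \<open>The inverse rotation applied to the pair: \<open>H\<close> has no constant
    coefficient and becomes \<open>z\<close> times \<open>F'\<close>, while \<open>G'\<close> loses
    its top coefficient.\<close>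
  define H where "H = smult (cnj a) F + smult (cnj b) G"
  define G' where "G' = smult (- b) F + smult a G"
  have "coeff H 0 = 0" using low by (simp add: H_def)
  then obtain F' where F': "H = pCons 0 F'" by (metis coeff_pCons_0 pCons_cases)
  have "degree H \<le> ?n" unfolding H_def
    using assms(1,2) by (intro degree_add_le) (auto intro: order_trans[OF degree_smult_le])
  then have degF': "degree F' \<le> n" by (simp add: F' degree_pCons_eq_if split: if_splits)
  have "degree G' \<le> ?n" unfolding G'_def
    using assms(1,2) by (intro degree_add_le) (auto intro: order_trans[OF degree_smult_le])
  moreover have "coeff G' ?n = 0" using high by (simp add: G'_def)
  ultimately have degG': "degree G' \<le> n"
    by (intro degree_le allI impI) (metis Suc_leI coeff_eq_0 le_neq_implies_less less_le_trans)
  have ab1: "a * cnj a + b * cnj b = 1"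
    using ab by (metis complex_norm_square of_real_1 of_real_add)
  have zF': "z * poly F' z = cnj a * poly F z + cnj b * poly G z" for z
    using arg_cong[OF F', of "\<lambda>p. poly p z"] by (simp add: H_def)
  have polyG': "poly G' z = - b * poly F z + a * poly G z" for z
    by (simp add: G'_def)
  have F: "poly F z = a * (z * poly F' z) - cnj b * poly G' z" for z
  proof -
    have "a * (z * poly F' z) - cnj b * poly G' z = (a * cnj a + b * cnj b) * poly F z"
      unfolding zF' polyG' by (simp add: algebra_simps)
    then show ?thesis by (simp add: ab1)
  qed
  have G: "poly G z = b * (z * poly F' z) + cnj a * poly G' z" for z
  proof -
    have "b * (z * poly F' z) + cnj a * poly G' z = (a * cnj a + b * cnj b) * poly G z"
      unfolding zF' polyG' by (simp add: algebra_simps)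
    then show ?thesis by (simp add: ab1)
  qed
  have "(cmod (poly F' z))\<^sup>2 + (cmod (poly G' z))\<^sup>2 = 1" if z: "cmod z = 1" for z
  proof -
    have isom: "x * cnj x + y * cnj y =
        (a * x - cnj b * y) * cnj (a * x - cnj b * y) + (b * x + cnj a * y) * cnj (b * x + cnj a * y)" for x y
    proof -
      have "(a * x - cnj b * y) * cnj (a * x - cnj b * y) + (b * x + cnj a * y) * cnj (b * x + cnj a * y)
        = (a * cnj a + b * cnj b) * (x * cnj x + y * cnj y)" by (simp add: algebra_simps)
      then show ?thesis by (simp add: ab1)
    qed
    have "complex_of_real ((cmod (z * poly F' z))\<^sup>2 + (cmod (poly G' z))\<^sup>2) =
        of_real ((cmod (poly F z))\<^sup>2 + (cmod (poly G z))\<^sup>2)"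
      unfolding of_real_add complex_norm_square F[of z] G[of z] by (rule isom)
    then have "(cmod (z * poly F' z))\<^sup>2 + (cmod (poly G' z))\<^sup>2 = 1"
      unfolding of_real_eq_iff one[OF z] .
    then show ?thesis using z by (simp add: norm_mult)
  qed
  with ab degF' degG' F G that show ?thesis by blast
qed

section \<open>Adjoints, norms and singular value decompositions\<close>

lemma dim_mat_adjoint [simp]:
  "dim_row (mat_adjoint A) = dim_col A" "dim_col (mat_adjoint A) = dim_row A"
  by (auto simp: mat_adjoint_def)

lemma mat_adjoint_carrier: "A \<in> carrier_mat n m \<Longrightarrow> mat_adjoint A \<in> carrier_mat m n"
  by auto

lemma index_mat_adjoint [simp]:
  fixes A :: "complex mat"
  shows "i < dim_col A \<Longrightarrow> j < dim_row A \<Longrightarrow> mat_adjoint A $$ (i, j) = cnj (A $$ (j, i))"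
  by (simp add: mat_adjoint_def mat_of_rows_index)

lemma mat_adjoint_adjoint [simp]:
  fixes A :: "complex mat"
  shows "mat_adjoint (mat_adjoint A) = A"
  by (rule eq_matI) auto

lemma mat_adjoint_one [simp]: "mat_adjoint (1\<^sub>m n :: complex mat) = 1\<^sub>m n"
  by (rule eq_matI) auto

lemma mat_adjoint_mult:
  fixes A B :: "complex mat"
  assumes "dim_col A = dim_row B"
  shows "mat_adjoint (A * B) = mat_adjoint B * mat_adjoint A"
  using assms by (intro eq_matI) (auto simp: scalar_prod_def mult.commute intro!: sum.cong)

lemma cscalar_prod_mat_vec:
  fixes A :: "complex mat"
  assumes "A \<in> carrier_mat n m" "x \<in> carrier_vec m" "y \<in> carrier_vec n"
  shows "(A *\<^sub>v x) \<bullet>c y = x \<bullet>c (mat_adjoint A *\<^sub>v y)"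
proof -
  have "(A *\<^sub>v x) \<bullet>c y = (\<Sum>i = 0..<n. \<Sum>j = 0..<m. A $$ (i, j) * x $ j * cnj (y $ i))"
    using assms by (simp add: scalar_prod_def sum_distrib_right)
  also have "\<dots> = (\<Sum>j = 0..<m. \<Sum>i = 0..<n. A $$ (i, j) * x $ j * cnj (y $ i))"
    by (rule sum.swap)
  also have "\<dots> = x \<bullet>c (mat_adjoint A *\<^sub>v y)"
    using assms by (simp add: scalar_prod_def sum_distrib_left mult_ac)
  finally show ?thesis .
qed

lemma vnorm_nonneg [simp]: "vnorm v \<ge> 0"
  by (simp add: vnorm_def sum_nonneg)

lemma vnorm_power2: "(vnorm v)\<^sup>2 = (\<Sum>i<dim_vec v. (cmod (v $ i))\<^sup>2)"
  by (simp add: vnorm_def sum_nonneg)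

lemma vnorm_cscalar_prod: "complex_of_real ((vnorm v)\<^sup>2) = v \<bullet>c v"
  by (simp add: vnorm_power2 scalar_prod_def complex_norm_square lessThan_atLeast0 del: of_real_power)

lemma vnorm_smult: "vnorm (c \<cdot>\<^sub>v v) = cmod c * vnorm v"
  by (simp add: vnorm_def norm_mult power_mult_distrib real_sqrt_mult flip: sum_distrib_left)

lemma vnorm_eq_0_iff: "vnorm v = 0 \<longleftrightarrow> v = 0\<^sub>v (dim_vec v)"
proof
  assume "vnorm v = 0"
  then have "\<forall>i<dim_vec v. v $ i = 0" by (simp add: vnorm_def sum_nonneg_eq_0_iff)
  then show "v = 0\<^sub>v (dim_vec v)" by (intro eq_vecI) auto
next
  assume "v = 0\<^sub>v (dim_vec v)"
  then have "v $ i = 0" if "i < dim_vec v" for i using that by (metis index_zero_vec(1))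
  then show "vnorm v = 0" by (simp add: vnorm_def)
qed

lemma unitary_mat_carrier: "unitary_mat n U \<Longrightarrow> U \<in> carrier_mat n n"
  by (simp add: unitary_mat_def)

lemma unitary_mat_one: "unitary_mat n (1\<^sub>m n)"
  by (simp add: unitary_mat_def)

lemma unitary_mat_adjoint: "unitary_mat n U \<Longrightarrow> unitary_mat n (mat_adjoint U)"
  by (auto simp: unitary_mat_def)

lemma unitary_mat_mult:
  assumes "unitary_mat n U" "unitary_mat n V"
  shows "unitary_mat n (U * V)"
proof -
  have carrier: "U \<in> carrier_mat n n" "V \<in> carrier_mat n n"
    "mat_adjoint U \<in> carrier_mat n n" "mat_adjoint V \<in> carrier_mat n n"
    using assms by (auto simp: unitary_mat_def)
  have "mat_adjoint V * mat_adjoint U * (U * V) = mat_adjoint V * (mat_adjoint U * U) * V"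
    using carrier by (simp add: assoc_mult_mat[of _ n n _ n _ n])
  moreover have "U * V * (mat_adjoint V * mat_adjoint U) = U * (V * mat_adjoint V) * mat_adjoint U"
    using carrier by (simp add: assoc_mult_mat[of _ n n _ n _ n])
  moreover have "mat_adjoint (U * V) = mat_adjoint V * mat_adjoint U"
    using carrier by (intro mat_adjoint_mult) auto
  ultimately show ?thesis
    using assms carrier by (simp add: unitary_mat_def)
qed

lemma unitary_mat_diag:
  assumes "\<And>i. i < n \<Longrightarrow> f i * cnj (f i) = 1"
  shows "unitary_mat n (mat_diag n f)"
proof -
  have adj: "mat_adjoint (mat_diag n f) = mat_diag n (\<lambda>i. cnj (f i))"
    by (rule eq_matI) (auto simp: mat_diag_def)
  have "mat_diag n (\<lambda>i. f i * cnj (f i)) = 1\<^sub>m n" "mat_diag n (\<lambda>i. cnj (f i) * f i) = 1\<^sub>m n"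
    using assms by (auto simp: mat_diag_def mult.commute intro!: eq_matI)
  then show ?thesis by (simp add: unitary_mat_def adj)
qed

lemma unitary_mult_adjoint_vec:
  assumes "unitary_mat n U" "x \<in> carrier_vec n"
  shows "mat_adjoint U *\<^sub>v (U *\<^sub>v x) = x" "U *\<^sub>v (mat_adjoint U *\<^sub>v x) = x"
proof -
  have c: "U \<in> carrier_mat n n" "mat_adjoint U \<in> carrier_mat n n"
    using assms by (auto simp: unitary_mat_def)
  show "mat_adjoint U *\<^sub>v (U *\<^sub>v x) = x"
    using assoc_mult_mat_vec[OF c(2) c(1) assms(2)] assms by (simp add: unitary_mat_def)
  show "U *\<^sub>v (mat_adjoint U *\<^sub>v x) = x"
    using assoc_mult_mat_vec[OF c(1) c(2) assms(2)] assms by (simp add: unitary_mat_def)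
qed

lemma vnorm_unitary:
  assumes "unitary_mat n U" "x \<in> carrier_vec n"
  shows "vnorm (U *\<^sub>v x) = vnorm x"
proof -
  have U: "U \<in> carrier_mat n n" using assms(1) by (rule unitary_mat_carrier)
  then have "(U *\<^sub>v x) \<bullet>c (U *\<^sub>v x) = x \<bullet>c x"
    using cscalar_prod_mat_vec[OF U assms(2), of "U *\<^sub>v x"] unitary_mult_adjoint_vec(1)[OF assms] assms(2) by simp
  then have "(vnorm (U *\<^sub>v x))\<^sup>2 = (vnorm x)\<^sup>2"
    by (simp only: of_real_eq_iff flip: vnorm_cscalar_prod)
  then show ?thesis by simp
qed

section \<open>Orthonormal bases and operators that are diagonal between two of them\<close>

lemma orthonormal_basisD:
  assumes "orthonormal_basis d v" "i < d"
  shows "v i \<in> carrier_vec d" "v i \<bullet>c v i = 1" "\<And>j. j < d \<Longrightarrow> i \<noteq> j \<Longrightarrow> v i \<bullet>c v j = 0"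
  using assms by (auto simp: orthonormal_basis_def)

lemma unitary_basis_mat:
  assumes "orthonormal_basis d v"
  shows "unitary_mat d (mat d d (\<lambda>(a, i). v i $ a))"
proof -
  let ?C = "mat d d (\<lambda>(a, i). v i $ a)"
  have C: "?C \<in> carrier_mat d d" by simp
  have "mat_adjoint ?C * ?C = 1\<^sub>m d"
  proof (rule eq_matI)
    fix i j assume "i < dim_row (1\<^sub>m d :: complex mat)" "j < dim_col (1\<^sub>m d :: complex mat)"
    then have ij: "i < d" "j < d" by auto
    have "(mat_adjoint ?C * ?C) $$ (i, j) = v j \<bullet>c v i"
      using ij orthonormal_basisD(1)[OF assms ij(1)] orthonormal_basisD(1)[OF assms ij(2)]
      by (simp add: scalar_prod_def mult.commute)
    then show "(mat_adjoint ?C * ?C) $$ (i, j) = 1\<^sub>m d $$ (i, j)"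
      using assms ij by (auto simp: orthonormal_basis_def)
  qed auto
  moreover from this have "?C * mat_adjoint ?C = 1\<^sub>m d"
    by (rule mat_mult_left_right_inverse[rotated 2]) auto
  ultimately show ?thesis by (simp add: unitary_mat_def)
qed

lemma parseval_basis:
  assumes "orthonormal_basis d v" "x \<in> carrier_vec d"
  shows "(vnorm x)\<^sup>2 = (\<Sum>i<d. (cmod (x \<bullet>c v i))\<^sup>2)"
proof -
  let ?C = "mat_adjoint (mat d d (\<lambda>(a, i). v i $ a))"
  have "(?C *\<^sub>v x) $ i = x \<bullet>c v i" if "i < d" for i
    using that assms(2) orthonormal_basisD(1)[OF assms(1) that]
    by (simp add: scalar_prod_def mult.commute)
  moreover have "vnorm x = vnorm (?C *\<^sub>v x)"
    using vnorm_unitary[OF unitary_mat_adjoint[OF unitary_basis_mat[OF assms(1)]] assms(2)] by simp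
  ultimately show ?thesis by (simp add: vnorm_power2)
qed

text \<open>The matrix with the basis vectors as columns is unitary and can be cancelled on the
  right.\<close>

lemma mat_eq_on_basis:
  assumes "orthonormal_basis d v" "A \<in> carrier_mat n d" "B \<in> carrier_mat n d"
    and "\<And>i. i < d \<Longrightarrow> A *\<^sub>v v i = B *\<^sub>v v i"
  shows "A = B"
proof -
  let ?C = "mat d d (\<lambda>(a, i). v i $ a)"
  have C: "?C \<in> carrier_mat d d" "mat_adjoint ?C \<in> carrier_mat d d" "?C * mat_adjoint ?C = 1\<^sub>m d"
    using unitary_basis_mat[OF assms(1)] by (auto simp: unitary_mat_def)
  have col: "col ?C i = v i" if "i < d" for i
    using that orthonormal_basisD(1)[OF assms(1) that] by (intro eq_vecI) auto
  have "A * ?C = B * ?C"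
    by (intro mat_col_eqI) (use assms(2-4) col in \<open>auto simp: col_mult2[of _ n d _ d]\<close>)
  then have "A * (?C * mat_adjoint ?C) = B * (?C * mat_adjoint ?C)"
    unfolding assoc_mult_mat[OF assms(2) C(1,2), symmetric] assoc_mult_mat[OF assms(3) C(1,2), symmetric] by simp
  then show ?thesis using C(3) assms(2,3) by simp
qed

lemma ketbra_sum_carrier [simp]: "ketbra_sum d f w v \<in> carrier_mat d d"
  by (simp add: ketbra_sum_def)

lemma ketbra_sum_mult_basis:
  assumes "orthonormal_basis d v" "orthonormal_basis d w" "i < d"
  shows "ketbra_sum d f w v *\<^sub>v v i = f i \<cdot>\<^sub>v w i"
proof (rule eq_vecI)
  note vi = orthonormal_basisD(1)[OF assms(1)] and wi = orthonormal_basisD(1)[OF assms(2)]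
  fix a assume "a < dim_vec (f i \<cdot>\<^sub>v w i)"
  then have a: "a < d" using wi[OF assms(3)] by simp
  have "(ketbra_sum d f w v *\<^sub>v v i) $ a = (\<Sum>b = 0..<d. \<Sum>j<d. f j * w j $ a * cnj (v j $ b) * v i $ b)"
    using a vi[OF assms(3)] by (simp add: ketbra_sum_def scalar_prod_def sum_distrib_right)
  also have "\<dots> = (\<Sum>j<d. f j * w j $ a * (\<Sum>b = 0..<d. v i $ b * cnj (v j $ b)))"
    by (subst sum.swap) (simp add: sum_distrib_left mult_ac)
  also have "\<dots> = (\<Sum>j<d. f j * w j $ a * (v i \<bullet>c v j))"
    using carrier_vecD[OF vi] by (intro sum.cong) (simp_all add: scalar_prod_def)
  also have "\<dots> = (\<Sum>j<d. if j = i then f i * w i $ a else 0)"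
    using assms(1,3) by (intro sum.cong) (auto simp: orthonormal_basis_def)
  finally show "(ketbra_sum d f w v *\<^sub>v v i) $ a = (f i \<cdot>\<^sub>v w i) $ a"
    using assms(3) a wi[OF assms(3)] by simp
qed (use orthonormal_basisD(1)[OF assms(2,3)] in \<open>auto simp: ketbra_sum_def\<close>)

lemma mat_adjoint_ketbra_sum: "mat_adjoint (ketbra_sum d f w v) = ketbra_sum d (\<lambda>i. cnj (f i)) v w"
  by (rule eq_matI) (auto simp: ketbra_sum_def mult_ac intro!: sum.cong)

lemma ketbra_sum_mult:
  assumes "orthonormal_basis d u" "orthonormal_basis d v" "orthonormal_basis d w"
  shows "ketbra_sum d f u v * ketbra_sum d g v w = ketbra_sum d (\<lambda>i. f i * g i) u w"
proof (rule mat_eq_on_basis[OF assms(3)])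
  show "ketbra_sum d f u v * ketbra_sum d g v w \<in> carrier_mat d d"
    by (rule mult_carrier_mat[OF ketbra_sum_carrier ketbra_sum_carrier])
  fix i assume i: "i < d"
  note c = orthonormal_basisD(1)[OF assms(2) i] orthonormal_basisD(1)[OF assms(3) i]
  have "ketbra_sum d f u v * ketbra_sum d g v w *\<^sub>v w i = ketbra_sum d f u v *\<^sub>v (g i \<cdot>\<^sub>v v i)"
    using c by (simp add: assoc_mult_mat_vec[of _ d d _ d] ketbra_sum_mult_basis[OF assms(3,2) i])
  also have "\<dots> = g i \<cdot>\<^sub>v (f i \<cdot>\<^sub>v u i)"
    using c by (simp add: mult_mat_vec[of _ d d] ketbra_sum_mult_basis[OF assms(2,1) i])
  finally show "ketbra_sum d f u v * ketbra_sum d g v w *\<^sub>v w i = ketbra_sum d (\<lambda>i. f i * g i) u w *\<^sub>v w i"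
    by (simp add: ketbra_sum_mult_basis[OF assms(3,1) i] smult_smult_assoc mult.commute)
qed simp

lemma ketbra_sum_one:
  assumes "orthonormal_basis d v"
  shows "ketbra_sum d (\<lambda>_. 1) v v = 1\<^sub>m d"
  using orthonormal_basisD(1)[OF assms]
  by (intro mat_eq_on_basis[OF assms]) (auto simp: ketbra_sum_mult_basis[OF assms assms])

lemma unitary_ketbra_sum:
  assumes "orthonormal_basis d w" "orthonormal_basis d v" "\<And>i. i < d \<Longrightarrow> f i * cnj (f i) = 1"
  shows "unitary_mat d (ketbra_sum d f w v)"
proof -
  have "ketbra_sum d (\<lambda>i. f i * cnj (f i)) w w = ketbra_sum d (\<lambda>_. 1) w w"
    "ketbra_sum d (\<lambda>i. cnj (f i) * f i) v v = ketbra_sum d (\<lambda>_. 1) v v"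
    using assms(3) by (auto simp: ketbra_sum_def mult.commute intro!: eq_matI sum.cong)
  then show ?thesis
    using assms by (simp add: unitary_mat_def mat_adjoint_ketbra_sum ketbra_sum_mult ketbra_sum_one)
qed

text \<open>The image has coefficient \<open>f i * (x \<bullet>c v i)\<close> along
  \<open>w i\<close>; the rest is Parseval.\<close>

lemma vnorm_ketbra_sum:
  assumes "orthonormal_basis d w" "orthonormal_basis d v" "x \<in> carrier_vec d"
  shows "(vnorm (ketbra_sum d f w v *\<^sub>v x))\<^sup>2 = (\<Sum>i<d. (cmod (f i))\<^sup>2 * (cmod (x \<bullet>c v i))\<^sup>2)"
proof -
  have "(ketbra_sum d f w v *\<^sub>v x) \<bullet>c w i = f i * (x \<bullet>c v i)" if i: "i < d" for i
  proof -
    note c = orthonormal_basisD(1)[OF assms(1) i] orthonormal_basisD(1)[OF assms(2) i]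
    have "(ketbra_sum d f w v *\<^sub>v x) \<bullet>c w i = x \<bullet>c (cnj (f i) \<cdot>\<^sub>v v i)"
      by (simp add: cscalar_prod_mat_vec[OF ketbra_sum_carrier assms(3) c(1)] mat_adjoint_ketbra_sum
          ketbra_sum_mult_basis[OF assms(1,2) i])
    then show ?thesis using c assms(3) by (simp add: conjugate_smult_vec)
  qed
  moreover have "ketbra_sum d f w v *\<^sub>v x \<in> carrier_vec d" by (metis ketbra_sum_carrier mult_mat_vec_carrier assms(3))
  ultimately show ?thesis
    by (simp add: parseval_basis[OF assms(1)] norm_mult power_mult_distrib)
qed

text \<open>Phases of \<open>f\<close> cancel in the product with the adjoint, which is diagonal in
  \<open>v\<close> with the squared moduli as entries. Any eigenvector overlaps some
  \<open>v i\<close>, and self-adjointness then forces its eigenvalue to be the \<open>i\<close>-th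
  entry.\<close>

lemma singular_values_ketbra_sum:
  assumes w: "orthonormal_basis d w" and v: "orthonormal_basis d v"
  shows "singular_values (ketbra_sum d f w v) = (\<lambda>i. cmod (f i)) ` {..<d}"
proof -
  define N where "N = ketbra_sum d (\<lambda>i. complex_of_real ((cmod (f i))\<^sup>2)) v v"
  have N: "mat_adjoint (ketbra_sum d f w v) * ketbra_sum d f w v = N"
    unfolding N_def mat_adjoint_ketbra_sum ketbra_sum_mult[OF v w v] complex_norm_square
    by (simp add: mult.commute)
  have Nc: "N \<in> carrier_mat d d" by (simp add: N_def)
  have Nv: "N *\<^sub>v v i = complex_of_real ((cmod (f i))\<^sup>2) \<cdot>\<^sub>v v i" if "i < d" for i
    unfolding N_def by (rule ketbra_sum_mult_basis[OF v v that])
  have adjN: "mat_adjoint N = N"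
    by (simp add: N_def mat_adjoint_ketbra_sum)
  show ?thesis
  proof (intro equalityI subsetI)
    fix \<sigma> assume "\<sigma> \<in> singular_values (ketbra_sum d f w v)"
    then obtain x where \<sigma>: "\<sigma> \<ge> 0" and x: "x \<in> carrier_vec d" "x \<noteq> 0\<^sub>v d"
      and eig: "N *\<^sub>v x = complex_of_real (\<sigma>\<^sup>2) \<cdot>\<^sub>v x"
      using Nc by (auto simp: singular_values_def N eigenvalue_def eigenvector_def)
    have "vnorm x \<noteq> 0" using x by (simp add: vnorm_eq_0_iff)
    then have "(\<Sum>i<d. (cmod (x \<bullet>c v i))\<^sup>2) \<noteq> 0" using parseval_basis[OF v x(1)] by (metis power_not_zero)
    then obtain i where i: "i < d" "x \<bullet>c v i \<noteq> 0"
      by (metis (no_types, lifting) lessThan_iff norm_zero sum.neutral zero_power2)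
    note vi = orthonormal_basisD(1)[OF v i(1)]
    have "complex_of_real (\<sigma>\<^sup>2) * (x \<bullet>c v i) = (N *\<^sub>v x) \<bullet>c v i"
      using eig x vi by simp
    also have "\<dots> = x \<bullet>c (N *\<^sub>v v i)"
      using cscalar_prod_mat_vec[OF Nc x(1) vi] adjN by simp
    also have "\<dots> = complex_of_real ((cmod (f i))\<^sup>2) * (x \<bullet>c v i)"
      using x vi by (simp add: Nv[OF i(1)] conjugate_smult_vec)
    finally have "complex_of_real (\<sigma>\<^sup>2) = complex_of_real ((cmod (f i))\<^sup>2)"
      using i(2) by (simp only: mult_cancel_right) simp
    then have "\<sigma>\<^sup>2 = (cmod (f i))\<^sup>2" by (simp only: of_real_eq_iff)
    then have "\<sigma> = cmod (f i)" using \<sigma> by (simp add: power2_eq_iff_nonneg)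
    then show "\<sigma> \<in> (\<lambda>i. cmod (f i)) ` {..<d}" using i by simp
  next
    fix \<sigma> assume "\<sigma> \<in> (\<lambda>i. cmod (f i)) ` {..<d}"
    then obtain i where i: "i < d" "\<sigma> = cmod (f i)" by auto
    have "v i \<noteq> 0\<^sub>v d" using orthonormal_basisD(2)[OF v i(1)] by auto
    then show "\<sigma> \<in> singular_values (ketbra_sum d f w v)"
      using i orthonormal_basisD(1)[OF v i(1)] Nv[OF i(1)] Nc
      by (auto simp: singular_values_def N eigenvalue_def eigenvector_def)
  qed
qed

text \<open>Reduces operator norm estimates to one scalar estimate per singular vector. Positivity
  of \<open>d\<close> makes the set under \<open>Max\<close> nonempty.\<close>

lemma op_norm_ketbra_sum_le:
  assumes "orthonormal_basis d w" "orthonormal_basis d v" "d > 0" "\<And>i. i < d \<Longrightarrow> cmod (f i) \<le> \<epsilon>"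
  shows "op_norm (ketbra_sum d f w v) \<le> \<epsilon>"
  unfolding op_norm_def singular_values_ketbra_sum[OF assms(1,2)]
  using assms(3,4) by (subst Max_le_iff) auto

lemma ketbra_sum_diff: "ketbra_sum d f w v - ketbra_sum d g w v = ketbra_sum d (\<lambda>i. f i - g i) w v"
  by (rule eq_matI) (auto simp: ketbra_sum_def sum_subtractf algebra_simps)

lemma ketbra_sum_add: "ketbra_sum d f w v + ketbra_sum d g w v = ketbra_sum d (\<lambda>i. f i + g i) w v"
  by (rule eq_matI) (auto simp: ketbra_sum_def sum.distrib algebra_simps)

lemma ketbra_sum_smult: "c \<cdot>\<^sub>m ketbra_sum d f w v = ketbra_sum d (\<lambda>i. c * f i) w v"
  by (rule eq_matI) (auto simp: ketbra_sum_def sum_distrib_left algebra_simps)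

section \<open>Kronecker products\<close>

text \<open>Splits a register index into the digit of the left Kronecker factor and that of the
  right one.\<close>

lemma sum_lessThan_mult:
  fixes f :: "nat \<Rightarrow> 'a :: comm_monoid_add"
  shows "(\<Sum>i<m * n. f i) = (\<Sum>k<m. \<Sum>j<n. f (k * n + j))"
proof (induction m)
  case (Suc m)
  have split: "(\<Sum>i<a + b. f i) = (\<Sum>i<a. f i) + (\<Sum>j<b. f (a + j))" for a b
    by (induction b) (simp_all add: add.assoc)
  have "(\<Sum>i<Suc m * n. f i) = (\<Sum>i<m * n. f i) + (\<Sum>j<n. f (m * n + j))"
    unfolding split[symmetric] by (simp add: add.commute)
  then show ?case using Suc by simp
qed simp

lemma dim_kron [simp]:
  "dim_row (kron M N) = dim_row M * dim_row N" "dim_col (kron M N) = dim_col M * dim_col N"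
  by (auto simp: kron_def)

lemma div_mod_less:
  fixes i m n :: nat
  assumes "i < m * n"
  shows "i div n < m" "i mod n < n"
proof -
  have "n > 0" using assms by (cases n) auto
  then show "i mod n < n" by simp
  show "i div n < m" using assms by (simp add: less_mult_imp_div_less)
qed

lemma index_kron [simp]:
  "i < dim_row M * dim_row N \<Longrightarrow> j < dim_col M * dim_col N \<Longrightarrow>
   kron M N $$ (i, j) = M $$ (i div dim_row N, j div dim_col N) * N $$ (i mod dim_row N, j mod dim_col N)"
  by (simp add: kron_def)

lemma mult_add_less_mult: "k < m \<Longrightarrow> j < n \<Longrightarrow> k * n + j < m * (n::nat)"
  using div_less_iff_less_mult[of n "k * n + j" m] by simp

lemma kron_mult_vec_index:
  assumes "dim_vec \<phi> = dim_col M * dim_col N" "i < dim_row M * dim_row N"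
  shows "(kron M N *\<^sub>v \<phi>) $ i =
    (\<Sum>k<dim_col M. \<Sum>j<dim_col N. M $$ (i div dim_row N, k) * N $$ (i mod dim_row N, j) * \<phi> $ (k * dim_col N + j))"
  using assms
  by (simp add: scalar_prod_def atLeast0LessThan sum_lessThan_mult mult_add_less_mult div_mod_less cong: sum.cong_simp)

lemma kron_mult:
  assumes "dim_col A = dim_row C" "dim_col B = dim_row D"
  shows "kron A B * kron C D = kron (A * C) (B * D)"
proof (rule eq_matI)
  fix i j assume "i < dim_row (kron (A * C) (B * D))" "j < dim_col (kron (A * C) (B * D))"
  then have i: "i < dim_row A * dim_row B" and j: "j < dim_col C * dim_col D" by auto
  note lt = div_mod_less[OF i] div_mod_less[OF j]
  let ?i = "i div dim_row B" and ?i' = "i mod dim_row B" and ?j = "j div dim_col D" and ?j' = "j mod dim_col D"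
  have "(kron A B * kron C D) $$ (i, j) = (\<Sum>k<dim_row C. \<Sum>k'<dim_row D.
      A $$ (?i, k) * B $$ (?i', k') * (C $$ (k, ?j) * D $$ (k', ?j')))"
    using i j assms
    by (simp add: scalar_prod_def atLeast0LessThan sum_lessThan_mult mult_add_less_mult cong: sum.cong_simp)
  also have "\<dots> = (\<Sum>k<dim_row C. A $$ (?i, k) * C $$ (k, ?j)) * (\<Sum>k'<dim_row D. B $$ (?i', k') * D $$ (k', ?j'))"
    by (simp add: sum_product mult_ac)
  also have "\<dots> = kron (A * C) (B * D) $$ (i, j)"
    using i j lt assms by (simp add: scalar_prod_def atLeast0LessThan)
  finally show "(kron A B * kron C D) $$ (i, j) = kron (A * C) (B * D) $$ (i, j)" .
qed auto

lemma mat_adjoint_kron: "mat_adjoint (kron A B) = kron (mat_adjoint A) (mat_adjoint B)"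
  by (rule eq_matI) (auto simp: div_mod_less)

lemma kron_one: "kron (1\<^sub>m m) (1\<^sub>m n) = 1\<^sub>m (m * n)"
proof (rule eq_matI)
  fix i j assume "i < dim_row (1\<^sub>m (m * n) :: complex mat)" "j < dim_col (1\<^sub>m (m * n) :: complex mat)"
  then have ij: "i < m * n" "j < m * n" by auto
  have "i = j \<longleftrightarrow> i div n = j div n \<and> i mod n = j mod n" by (metis div_mult_mod_eq)
  then show "kron (1\<^sub>m m) (1\<^sub>m n) $$ (i, j) = 1\<^sub>m (m * n) $$ (i, j)"
    using ij div_mod_less[OF ij(1)] div_mod_less[OF ij(2)] by auto
qed auto

lemma unitary_kron:
  assumes "unitary_mat m A" "unitary_mat n B"
  shows "unitary_mat (m * n) (kron A B)"
  using assms unfolding unitary_mat_def by (auto simp: mat_adjoint_kron kron_mult kron_one)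

section \<open>Registers and gates\<close>

text \<open>The auxiliary qubits are the most significant ones, so |0>x is \<open>x\<close> followed
  by zeros, and applying the bra of |0> keeps the leading entries. \<open>pad\<close> and
  \<open>truncate\<close> stand for these two Kronecker products.\<close>

definition pad :: "nat \<Rightarrow> complex vec \<Rightarrow> complex vec" where
  "pad D x = vec D (\<lambda>i. if i < dim_vec x then x $ i else 0)"

definition truncate :: "nat \<Rightarrow> complex vec \<Rightarrow> complex vec" where
  "truncate d x = vec d (\<lambda>i. x $ i)"

lemma pad_carrier [simp]: "pad D x \<in> carrier_vec D" and dim_pad [simp]: "dim_vec (pad D x) = D"
  by (simp_all add: pad_def)

lemma truncate_carrier [simp]: "truncate d x \<in> carrier_vec d" and dim_top [simp]: "dim_vec (truncate d x) = d"
  by (simp_all add: truncate_def)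

text \<open>The register state \<open>|00\<rangle>x + |01\<rangle>y\<close>, where \<open>x, y\<close> are states of the last \<open>l + s\<close> qubits.\<close>

definition two_level :: "nat \<Rightarrow> complex vec \<Rightarrow> complex vec \<Rightarrow> complex vec" where
  "two_level D x y = vec (4 * D)
     (\<lambda>i. if i div D = 0 then x $ (i mod D) else if i div D = 1 then y $ (i mod D) else 0)"

lemma two_level_carrier [simp]: "two_level D x y \<in> carrier_vec (4 * D)"
  and dim_two_level [simp]: "dim_vec (two_level D x y) = 4 * D"
  by (simp_all add: two_level_def)

lemma truncate_two_level: "d \<le> D \<Longrightarrow> truncate d (two_level D x y) = truncate d x"
  by (intro eq_vecI) (auto simp: truncate_def two_level_def)

lemma mat_diag_mult_vec_index:
  fixes f :: "nat \<Rightarrow> complex"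
  assumes "i < n" "dim_vec x = n"
  shows "(mat_diag n f *\<^sub>v x) $ i = f i * x $ i"
proof -
  have "(mat_diag n f *\<^sub>v x) $ i = (\<Sum>j = 0..<n. if j = i then f i * x $ i else 0)"
    using assms by (auto simp: mat_diag_def scalar_prod_def simp del: sum.delta sum.delta' intro!: sum.cong)
  then show ?thesis using assms by simp
qed

lemma kron_one_mult_vec_index:
  assumes "dim_vec \<phi> = dim_col M * n" "i < dim_row M * n"
  shows "(kron M (1\<^sub>m n) *\<^sub>v \<phi>) $ i = (\<Sum>k<dim_col M. M $$ (i div n, k) * \<phi> $ (k * n + i mod n))"
proof -
  have "i mod n < n" using div_mod_less[OF assms(2)] by simp
  then have "(\<Sum>j<n. M $$ (i div n, k) * 1\<^sub>m n $$ (i mod n, j) * \<phi> $ (k * n + j)) =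
      (\<Sum>j<n. if j = i mod n then M $$ (i div n, k) * \<phi> $ (k * n + i mod n) else 0)" for k
    by (intro sum.cong) auto
  then show ?thesis using assms \<open>i mod n < n\<close> by (simp add: kron_mult_vec_index del: index_mult_mat_vec)
qed

lemma kron_ket_mult_vec:
  assumes "x \<in> carrier_vec d"
  shows "kron (ket l 0) (1\<^sub>m d) *\<^sub>v x = pad (2 ^ l * d) x"
proof (rule eq_vecI)
  fix i assume "i < dim_vec (pad (2 ^ l * d) x)"
  then have i: "i < 2 ^ l * d" by simp
  have "i div d = 0 \<longleftrightarrow> i < d" using div_mod_less[OF i] by (cases "d = 0") (auto simp: div_eq_0_iff)
  then show "(kron (ket l 0) (1\<^sub>m d) *\<^sub>v x) $ i = pad (2 ^ l * d) x $ i"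
    using assms i div_mod_less[OF i] by (subst kron_one_mult_vec_index) (auto simp: ket_def pad_def)
qed (simp add: ket_def)

lemma kron_bra_mult_vec:
  assumes "dim_vec \<phi> = 2 ^ n * d" "q < 2 ^ n"
  shows "kron (mat_adjoint (ket n q)) (1\<^sub>m d) *\<^sub>v \<phi> = vec d (\<lambda>i. \<phi> $ (q * d + i))"
proof (rule eq_vecI)
  fix i assume "i < dim_vec (vec d (\<lambda>i. \<phi> $ (q * d + i)))"
  then have i: "i < d" by simp
  have "(kron (mat_adjoint (ket n q)) (1\<^sub>m d) *\<^sub>v \<phi>) $ i =
      (\<Sum>k<2 ^ n. mat_adjoint (ket n q) $$ (0, k) * \<phi> $ (k * d + i))"
    using assms i by (subst kron_one_mult_vec_index) (auto simp: ket_def)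
  also have "\<dots> = (\<Sum>k<2 ^ n. if k = q then \<phi> $ (q * d + i) else 0)"
    by (intro sum.cong) (auto simp: ket_def)
  finally show "(kron (mat_adjoint (ket n q)) (1\<^sub>m d) *\<^sub>v \<phi>) $ i = vec d (\<lambda>i. \<phi> $ (q * d + i)) $ i"
    using assms i by simp
qed (simp add: ket_def)

text \<open>The adjoint of \<open>U\<close> block-encodes the adjoint of \<open>A\<close>. Both
  halves are wanted because the walk alternates the two oracles.\<close>

lemma block_encoding_truncate:
  assumes "block_encodes l s U A" "x \<in> carrier_vec (2 ^ s)"
  shows "truncate (2 ^ s) (U *\<^sub>v pad (2 ^ (l + s)) x) = A *\<^sub>v x"
    and "truncate (2 ^ s) (mat_adjoint U *\<^sub>v pad (2 ^ (l + s)) x) = mat_adjoint A *\<^sub>v x"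
proof -
  let ?K = "kron (ket l 0) (1\<^sub>m (2 ^ s))"
  let ?B = "kron (mat_adjoint (ket l 0)) (1\<^sub>m (2 ^ s))"
  let ?D = "2 ^ (l + s) :: nat" and ?d = "2 ^ s :: nat"
  have dims: "?K \<in> carrier_mat ?D ?d" "?B \<in> carrier_mat ?d ?D"
    by (auto simp: ket_def power_add)
  have U: "U \<in> carrier_mat ?D ?D" and A: "A = ?B * U * ?K"
    using assms(1) by (auto simp: block_encodes_def unitary_mat_def)
  have adj: "mat_adjoint ?K = ?B" "mat_adjoint ?B = ?K"
    by (simp_all add: mat_adjoint_kron)
  have "mat_adjoint A = mat_adjoint ?K * mat_adjoint (?B * U)"
    unfolding A using U dims by (intro mat_adjoint_mult) auto
  moreover have "mat_adjoint (?B * U) = mat_adjoint U * mat_adjoint ?B"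
    using U dims by (intro mat_adjoint_mult) auto
  ultimately have "mat_adjoint A = ?B * (mat_adjoint U * ?K)"
    unfolding adj by simp
  then have A': "mat_adjoint A = ?B * mat_adjoint U * ?K"
    using mat_adjoint_carrier[OF U] dims by (simp add: assoc_mult_mat[of _ ?d ?D _ ?D _ ?d])
  have pad: "?K *\<^sub>v x = pad ?D x"
    using kron_ket_mult_vec[OF assms(2), of l] by (simp add: power_add)
  have truncate: "?B *\<^sub>v \<phi> = truncate ?d \<phi>" if "\<phi> \<in> carrier_vec ?D" for \<phi>
    using that kron_bra_mult_vec[of \<phi> l ?d 0] by (simp add: power_add truncate_def)
  have "?B * N * ?K *\<^sub>v x = truncate ?d (N *\<^sub>v pad ?D x)" if "N \<in> carrier_mat ?D ?D" for N
  proof -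
    have "?B * N * ?K *\<^sub>v x = ?B *\<^sub>v (N *\<^sub>v (?K *\<^sub>v x))"
      using that dims assms(2)
      by (simp add: assoc_mult_mat_vec[of _ ?d ?D _ ?d] assoc_mult_mat_vec[of _ ?d ?D _ ?D] pad)
    also have "\<dots> = truncate ?d (N *\<^sub>v pad ?D x)"
      unfolding pad using that by (intro truncate) simp
    finally show ?thesis .
  qed
  from this[OF U] this[OF mat_adjoint_carrier[OF U]]
  show "truncate ?d (U *\<^sub>v pad ?D x) = A *\<^sub>v x" "truncate ?d (mat_adjoint U *\<^sub>v pad ?D x) = mat_adjoint A *\<^sub>v x"
    using A A' by auto
qed

text \<open>Blocks 10 and 11 of the state are zero, so only columns 0 and 1 of the 4 by 4 factor
  contribute.\<close>

lemma kron_mult_two_level_index: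
  assumes "M \<in> carrier_mat 4 4" "N \<in> carrier_mat D D" "x \<in> carrier_vec D" "y \<in> carrier_vec D" "i < 4 * D"
  shows "(kron M N *\<^sub>v two_level D x y) $ i =
    M $$ (i div D, 0) * (N *\<^sub>v x) $ (i mod D) + M $$ (i div D, 1) * (N *\<^sub>v y) $ (i mod D)"
proof -
  have im: "i mod D < D" using div_mod_less[OF assms(5)] by simp
  have four: "{..<4::nat} = {0, 1, 2, 3}" by auto
  have lt: "D + j < 4 * D" "2 * D + j < 4 * D" "3 * D + j < 4 * D" if "j < D" for j using that by auto
  have div: "(D + j) div D = 1" "(2 * D + j) div D = 2" "(3 * D + j) div D = 3" if "j < D" for j
    using that by auto
  have "(kron M N *\<^sub>v two_level D x y) $ i =
    (\<Sum>k<4. \<Sum>j<D. M $$ (i div D, k) * N $$ (i mod D, j) * two_level D x y $ (k * D + j))"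
    using assms by (subst kron_mult_vec_index) auto
  also have "\<dots> = (\<Sum>j<D. M $$ (i div D, 0) * N $$ (i mod D, j) * x $ j) +
      (\<Sum>j<D. M $$ (i div D, 1) * N $$ (i mod D, j) * y $ j)"
    unfolding four using lt div by (simp add: two_level_def)
  finally show ?thesis
    using assms im by (simp add: scalar_prod_def atLeast0LessThan sum_distrib_left mult.assoc)
qed

lemma kron_one_mult_two_level:
  assumes "N \<in> carrier_mat D D" "x \<in> carrier_vec D" "y \<in> carrier_vec D"
  shows "kron (1\<^sub>m 4) N *\<^sub>v two_level D x y = two_level D (N *\<^sub>v x) (N *\<^sub>v y)"
proof (rule eq_vecI)
  fix i assume "i < dim_vec (two_level D (N *\<^sub>v x) (N *\<^sub>v y))"
  then have i: "i < 4 * D" by simp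
  then show "(kron (1\<^sub>m 4) N *\<^sub>v two_level D x y) $ i = two_level D (N *\<^sub>v x) (N *\<^sub>v y) $ i"
    unfolding kron_mult_two_level_index[OF one_carrier_mat assms i]
    using div_mod_less[OF i] by (auto simp: two_level_def)
qed (use assms in simp)

text \<open>Acts on the second extra qubit when the first is 0, as an element of SU(2) if (a, b) is
  a unit vector. The first extra qubit is left for the flag.\<close>

definition rotation :: "nat \<Rightarrow> complex \<Rightarrow> complex \<Rightarrow> complex mat" where
  "rotation D a b = kron (mat 4 4 (\<lambda>(i, j).
     if i = 0 \<and> j = 0 then a else if i = 0 \<and> j = 1 then - cnj b
     else if i = 1 \<and> j = 0 then b else if i = 1 \<and> j = 1 then cnj a
     else if i = j then 1 else 0)) (1\<^sub>m D)"

lemma unitary_rotation: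
  assumes "(cmod a)\<^sup>2 + (cmod b)\<^sup>2 = 1"
  shows "unitary_mat (4 * D) (rotation D a b)"
proof -
  have ab: "a * cnj a + b * cnj b = 1"
    using assms by (metis complex_norm_square of_real_1 of_real_add)
  have four: "{0..<4::nat} = {0, 1, 2, 3}" by auto
  have lt4: "i = 0 \<or> i = 1 \<or> i = 2 \<or> i = 3" if "i < 4" for i :: nat using that by auto
  show ?thesis
    unfolding rotation_def
  proof (intro unitary_kron unitary_mat_one)
    let ?Q = "mat 4 4 (\<lambda>(i, j).
     if i = 0 \<and> j = 0 then a else if i = 0 \<and> j = 1 then - cnj b
     else if i = 1 \<and> j = 0 then b else if i = 1 \<and> j = 1 then cnj a
     else if i = j then 1 else (0::complex))"
    have "mat_adjoint ?Q * ?Q = 1\<^sub>m 4"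
    proof (rule eq_matI)
      fix i j assume "i < dim_row (1\<^sub>m 4 :: complex mat)" "j < dim_col (1\<^sub>m 4 :: complex mat)"
      then have "i < 4" "j < 4" by auto
      from lt4[OF this(1)] lt4[OF this(2)] ab show "(mat_adjoint ?Q * ?Q) $$ (i, j) = 1\<^sub>m 4 $$ (i, j)"
        by (elim disjE) (simp_all add: scalar_prod_def four algebra_simps)
    qed auto
    moreover from this have "?Q * mat_adjoint ?Q = 1\<^sub>m 4"
      by (rule mat_mult_left_right_inverse[rotated 2]) auto
    ultimately show "unitary_mat 4 ?Q" by (simp add: unitary_mat_def)
  qed
qed

lemma rotation_mult_two_level:
  assumes "x \<in> carrier_vec D" "y \<in> carrier_vec D"
  shows "rotation D a b *\<^sub>v two_level D x y =
    two_level D (a \<cdot>\<^sub>v x - cnj b \<cdot>\<^sub>v y) (b \<cdot>\<^sub>v x + cnj a \<cdot>\<^sub>v y)"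
proof (rule eq_vecI)
  fix i assume "i < dim_vec (two_level D (a \<cdot>\<^sub>v x - cnj b \<cdot>\<^sub>v y) (b \<cdot>\<^sub>v x + cnj a \<cdot>\<^sub>v y))"
  then have i: "i < 4 * D" by simp
  show "(rotation D a b *\<^sub>v two_level D x y) $ i =
      two_level D (a \<cdot>\<^sub>v x - cnj b \<cdot>\<^sub>v y) (b \<cdot>\<^sub>v x + cnj a \<cdot>\<^sub>v y) $ i"
    unfolding rotation_def
    by (subst kron_mult_two_level_index) (use i assms div_mod_less[OF i] in \<open>auto simp: two_level_def\<close>)
qed (simp add: rotation_def)

text \<open>The operator 2|0><0| - 1 on the block-encoding qubits, tensored with the
  identity.\<close>

definition reflection :: "nat \<Rightarrow> nat \<Rightarrow> complex mat" where
  "reflection d D = mat_diag D (\<lambda>i. if i < d then 1 else -1)"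

text \<open>Reflects block 00 only. As the processed states live in blocks 00 and 01, this amounts
  to a control on the second extra qubit being 0.\<close>

definition controlled_reflection :: "nat \<Rightarrow> nat \<Rightarrow> complex mat" where
  "controlled_reflection d D = mat_diag (4 * D) (\<lambda>i. if i div D = 0 \<and> d \<le> i mod D then -1 else 1)"

lemma reflection_carrier [simp]: "reflection d D \<in> carrier_mat D D"
  by (simp add: reflection_def mat_diag_def)

lemma unitary_reflection: "unitary_mat D (reflection d D)"
  unfolding reflection_def by (rule unitary_mat_diag) auto

lemma unitary_controlled_reflection: "unitary_mat (4 * D) (controlled_reflection d D)"
  unfolding controlled_reflection_def by (rule unitary_mat_diag) auto

lemma reflection_mult_vec:
  assumes "x \<in> carrier_vec D" "d \<le> D"
  shows "reflection d D *\<^sub>v x = 2 \<cdot>\<^sub>v pad D (truncate d x) - x"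
  using assms
  by (intro eq_vecI) (auto simp: reflection_def mat_diag_mult_vec_index pad_def truncate_def simp del: index_mult_mat_vec, simp_all add: mat_diag_def)

lemma reflection_reflection:
  assumes "x \<in> carrier_vec D"
  shows "reflection d D *\<^sub>v (reflection d D *\<^sub>v x) = x"
proof (rule eq_vecI)
  have c: "dim_vec (reflection d D *\<^sub>v x) = D" by (simp add: reflection_def mat_diag_def)
  fix i assume "i < dim_vec x"
  then have "i < D" "dim_vec x = D" using assms by auto
  then show "(reflection d D *\<^sub>v (reflection d D *\<^sub>v x)) $ i = x $ i"
    using c unfolding reflection_def by (simp add: mat_diag_mult_vec_index del: index_mult_mat_vec)
qed (use assms in \<open>simp add: reflection_def mat_diag_def\<close>)

lemma controlled_reflection_mult_two_level:
  assumes "x \<in> carrier_vec D" "y \<in> carrier_vec D"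
  shows "controlled_reflection d D *\<^sub>v two_level D x y = two_level D (reflection d D *\<^sub>v x) y"
proof (rule eq_vecI)
  fix i assume "i < dim_vec (two_level D (reflection d D *\<^sub>v x) y)"
  then have i: "i < 4 * D" by simp
  then show "(controlled_reflection d D *\<^sub>v two_level D x y) $ i = two_level D (reflection d D *\<^sub>v x) y $ i"
    using assms div_mod_less[OF i] unfolding controlled_reflection_def reflection_def
    by (simp add: mat_diag_mult_vec_index two_level_def del: index_mult_mat_vec)
qed (simp add: controlled_reflection_def mat_diag_def)

section \<open>Measurement-free segments\<close>

text \<open>Lists, because measurement-free circuits have to be concatenated and repeated, whereas a
  \<open>procedure\<close> is a tree of continuations; \<open>prepend\<close> grafts the one onto
  the other. All oracle calls here are uncontrolled.\<close>

datatype step = GateStep "complex mat" | OracleStep bool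

fun step_mat :: "complex mat \<Rightarrow> step \<Rightarrow> complex mat" where
  "step_mat U (GateStep G) = G"
| "step_mat U (OracleStep dag) = kron (1\<^sub>m 4) (if dag then mat_adjoint U else U)"

fun steps_mat :: "nat \<Rightarrow> complex mat \<Rightarrow> step list \<Rightarrow> complex mat" where
  "steps_mat n U [] = 1\<^sub>m n"
| "steps_mat n U (t # ts) = steps_mat n U ts * step_mat U t"

fun prepend :: "step list \<Rightarrow> procedure \<Rightarrow> procedure" where
  "prepend [] P = P"
| "prepend (GateStep G # ts) P = Gate G (prepend ts P)"
| "prepend (OracleStep dag # ts) P = Oracle {} dag (prepend ts P)"

fun oracle_steps :: "step list \<Rightarrow> nat" where
  "oracle_steps [] = 0"
| "oracle_steps (GateStep G # ts) = oracle_steps ts"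
| "oracle_steps (OracleStep dag # ts) = Suc (oracle_steps ts)"

definition wf_steps :: "nat \<Rightarrow> step list \<Rightarrow> bool" where
  "wf_steps n ts \<longleftrightarrow> (\<forall>G. GateStep G \<in> set ts \<longrightarrow> unitary_mat n G)"

lemma wf_steps_simps [simp]:
  "wf_steps n []" "wf_steps n (GateStep G # ts) \<longleftrightarrow> unitary_mat n G \<and> wf_steps n ts"
  "wf_steps n (OracleStep dag # ts) \<longleftrightarrow> wf_steps n ts"
  "wf_steps n (ss @ ts) \<longleftrightarrow> wf_steps n ss \<and> wf_steps n ts"
  by (auto simp: wf_steps_def)

lemma oracle_steps_append: "oracle_steps (ss @ ts) = oracle_steps ss + oracle_steps ts"
  by (induction ss rule: oracle_steps.induct) auto

lemma unitary_step_mat: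
  assumes "wf_steps (4 * D) [t]" "unitary_mat D U"
  shows "unitary_mat (4 * D) (step_mat U t)"
  using assms by (cases t) (auto intro!: unitary_kron unitary_mat_one unitary_mat_adjoint)

lemma unitary_steps_mat:
  assumes "wf_steps (4 * D) ts" "unitary_mat D U"
  shows "unitary_mat (4 * D) (steps_mat (4 * D) U ts)"
  using assms
proof (induction ts)
  case (Cons t ts)
  have "wf_steps (4 * D) [t]" "wf_steps (4 * D) ts" using Cons.prems(1) by (auto simp: wf_steps_def)
  then show ?case using Cons unitary_step_mat by (auto intro!: unitary_mat_mult)
qed (simp add: unitary_mat_one)

lemma steps_mat_gate: "unitary_mat n G \<Longrightarrow> steps_mat n U [GateStep G] = G"
  using left_mult_one_mat[OF unitary_mat_carrier] by simp

lemma steps_mat_Cons_vec: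
  assumes "wf_steps (4 * D) (t # ts)" "unitary_mat D U" "\<phi> \<in> carrier_vec (4 * D)"
  shows "steps_mat (4 * D) U (t # ts) *\<^sub>v \<phi> = steps_mat (4 * D) U ts *\<^sub>v (step_mat U t *\<^sub>v \<phi>)"
proof -
  have "wf_steps (4 * D) [t]" "wf_steps (4 * D) ts" using assms(1) by (auto simp: wf_steps_def)
  then show ?thesis
    using unitary_mat_carrier[OF unitary_step_mat[OF _ assms(2)]] unitary_mat_carrier[OF unitary_steps_mat[OF _ assms(2)]] assms(3)
    by (simp add: assoc_mult_mat_vec[of _ "4 * D" "4 * D" _ "4 * D"])
qed

lemma steps_mat_append_vec:
  assumes "wf_steps (4 * D) (ss @ ts)" "unitary_mat D U" "\<phi> \<in> carrier_vec (4 * D)"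
  shows "steps_mat (4 * D) U (ss @ ts) *\<^sub>v \<phi> = steps_mat (4 * D) U ts *\<^sub>v (steps_mat (4 * D) U ss *\<^sub>v \<phi>)"
  using assms(1,3)
proof (induction ss arbitrary: \<phi>)
  case (Cons t ss)
  have wf: "wf_steps (4 * D) (t # ss @ ts)" "wf_steps (4 * D) (t # ss)" "wf_steps (4 * D) [t]" "wf_steps (4 * D) (ss @ ts)"
    using Cons.prems(1) by (auto simp: wf_steps_def)
  have "step_mat U t *\<^sub>v \<phi> \<in> carrier_vec (4 * D)"
    using unitary_mat_carrier[OF unitary_step_mat[OF wf(3) assms(2)]] Cons.prems(2) by simp
  then show ?case
    using Cons.IH[OF wf(4)] steps_mat_Cons_vec[OF wf(1) assms(2) Cons.prems(2)]
      steps_mat_Cons_vec[OF wf(2) assms(2) Cons.prems(2)] by simp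
qed simp

section \<open>Quantum signal processing for the walk operator\<close>

definition walk :: "nat \<Rightarrow> nat \<Rightarrow> complex mat \<Rightarrow> complex vec \<Rightarrow> complex vec" where
  "walk d D U x = reflection d D *\<^sub>v (mat_adjoint U *\<^sub>v (reflection d D *\<^sub>v (U *\<^sub>v x)))"

text \<open>Only the reflections are controlled: without them, the two oracle calls cancel.\<close>

definition controlled_walk :: "nat \<Rightarrow> nat \<Rightarrow> step list" where
  "controlled_walk d D = [OracleStep False, GateStep (controlled_reflection d D),
     OracleStep True, GateStep (controlled_reflection d D)]"

text \<open>Uncontrolled, since both branches are to be divided by the same power of the
  eigenvalue.\<close>

definition inverse_walk :: "nat \<Rightarrow> nat \<Rightarrow> step list" where
  "inverse_walk d D = [GateStep (kron (1\<^sub>m 4) (reflection d D)), OracleStep False,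
     GateStep (kron (1\<^sub>m 4) (reflection d D)), OracleStep True]"

lemma wf_walk_steps: "wf_steps (4 * D) (controlled_walk d D)" "wf_steps (4 * D) (inverse_walk d D)"
  by (auto simp: controlled_walk_def inverse_walk_def unitary_controlled_reflection
      intro: unitary_kron unitary_mat_one unitary_reflection)

context
  fixes d D :: nat and U :: "complex mat"
  assumes U: "unitary_mat D U"
begin

lemma oracle_carrier [simp]: "U \<in> carrier_mat D D" "mat_adjoint U \<in> carrier_mat D D"
  using unitary_mat_carrier[OF U] by auto

lemma walk_carrier [simp]: "x \<in> carrier_vec D \<Longrightarrow> walk d D U x \<in> carrier_vec D"
  unfolding walk_def by (intro mult_mat_vec_carrier[of _ D D]) simp_all

lemma walk_smult: "x \<in> carrier_vec D \<Longrightarrow> walk d D U (c \<cdot>\<^sub>v x) = c \<cdot>\<^sub>v walk d D U x"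
  unfolding walk_def by (simp add: mult_mat_vec[of _ D D] mult_mat_vec_carrier[of _ D D])

lemma walk_diff:
  "x \<in> carrier_vec D \<Longrightarrow> y \<in> carrier_vec D \<Longrightarrow> walk d D U (x - y) = walk d D U x - walk d D U y"
  unfolding walk_def by (simp add: mult_minus_distrib_mat_vec[of _ D D] mult_mat_vec_carrier[of _ D D])

lemma controlled_walk_two_level:
  assumes "x \<in> carrier_vec D" "y \<in> carrier_vec D"
  shows "steps_mat (4 * D) U (controlled_walk d D) *\<^sub>v two_level D x y = two_level D (walk d D U x) y"
proof -
  have c: "U *\<^sub>v x \<in> carrier_vec D" "U *\<^sub>v y \<in> carrier_vec D" "reflection d D *\<^sub>v (U *\<^sub>v x) \<in> carrier_vec D"
    "mat_adjoint U *\<^sub>v (reflection d D *\<^sub>v (U *\<^sub>v x)) \<in> carrier_vec D"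
    using assms by (simp_all add: mult_mat_vec_carrier[of _ D D])
  have cg: "unitary_mat (4 * D) (controlled_reflection d D)" by (rule unitary_controlled_reflection)
  note Cons = steps_mat_Cons_vec[OF _ U]
  show ?thesis
    unfolding controlled_walk_def
    using assms c cg unitary_mult_adjoint_vec(1)[OF U assms(2)]
    by (simp add: Cons kron_one_mult_two_level controlled_reflection_mult_two_level walk_def del: steps_mat.simps(2))
qed

lemma inverse_walk_two_level:
  assumes "x \<in> carrier_vec D" "y \<in> carrier_vec D"
  shows "steps_mat (4 * D) U (inverse_walk d D) *\<^sub>v two_level D (walk d D U x) (walk d D U y) = two_level D x y"
proof -
  have undo: "mat_adjoint U *\<^sub>v (reflection d D *\<^sub>v (U *\<^sub>v (reflection d D *\<^sub>v walk d D U x))) = x"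
    if "x \<in> carrier_vec D" for x
    using that unfolding walk_def
    by (simp add: reflection_reflection unitary_mult_adjoint_vec[OF U] mult_mat_vec_carrier[of _ D D])
  have g: "unitary_mat (4 * D) (kron (1\<^sub>m 4) (reflection d D))"
    by (intro unitary_kron unitary_mat_one unitary_reflection)
  note Cons = steps_mat_Cons_vec[OF _ U]
  show ?thesis
    unfolding inverse_walk_def
    using assms g undo
    by (simp add: Cons kron_one_mult_two_level mult_mat_vec_carrier[of _ D D] del: steps_mat.simps(2))
qed

lemma inverse_walk_power_two_level:
  assumes "x \<in> carrier_vec D" "walk d D U x = \<mu> \<cdot>\<^sub>v x" "\<mu> \<noteq> 0"
  shows "steps_mat (4 * D) U (concat (replicate M (inverse_walk d D))) *\<^sub>v two_level D (f \<cdot>\<^sub>v x) (g \<cdot>\<^sub>v x) =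
    two_level D ((f / \<mu> ^ M) \<cdot>\<^sub>v x) ((g / \<mu> ^ M) \<cdot>\<^sub>v x)"
proof (induction M arbitrary: f g)
  case 0
  then show ?case by (simp add: one_mult_mat_vec[of _ "4 * D"])
next
  case (Suc M)
  have wf: "wf_steps (4 * D) (concat (replicate (Suc M) (inverse_walk d D)))"
    using wf_walk_steps(2) by (induction M) auto
  have scale: "c \<cdot>\<^sub>v x = walk d D U ((c / \<mu>) \<cdot>\<^sub>v x)" for c
    using assms by (simp add: walk_smult smult_smult_assoc)
  have "steps_mat (4 * D) U (concat (replicate (Suc M) (inverse_walk d D))) *\<^sub>v two_level D (f \<cdot>\<^sub>v x) (g \<cdot>\<^sub>v x) =
      steps_mat (4 * D) U (concat (replicate M (inverse_walk d D))) *\<^sub>v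
        (steps_mat (4 * D) U (inverse_walk d D) *\<^sub>v two_level D (f \<cdot>\<^sub>v x) (g \<cdot>\<^sub>v x))"
    using steps_mat_append_vec[OF _ U] wf by simp
  also have "steps_mat (4 * D) U (inverse_walk d D) *\<^sub>v two_level D (f \<cdot>\<^sub>v x) (g \<cdot>\<^sub>v x) =
      two_level D ((f / \<mu>) \<cdot>\<^sub>v x) ((g / \<mu>) \<cdot>\<^sub>v x)"
    unfolding scale[of f] scale[of g] using assms(1) by (intro inverse_walk_two_level) auto
  finally show ?case unfolding Suc.IH by (simp add: divide_divide_eq_left)
qed

end

text \<open>Peeling one layer expresses the pair \<open>F, G\<close> by \<open>z * F'\<close> and
  \<open>G'\<close> through a rotation. Read as a circuit, this is a controlled walk, which
  multiplies the first branch by the eigenvalue, followed by that rotation. The list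
  \<open>ts\<close> is chosen before \<open>U\<close>, so it works for every eigenvector of every
  walk.\<close>

lemma signal_processing_steps:
  fixes F G :: "complex poly"
  assumes "degree F \<le> n" "degree G \<le> n"
    "\<And>z. cmod z = 1 \<Longrightarrow> (cmod (poly F z))\<^sup>2 + (cmod (poly G z))\<^sup>2 = 1"
  shows "\<exists>ts. wf_steps (4 * D) ts \<and> oracle_steps ts = 2 * n \<and>
    (\<forall>U x \<mu>. unitary_mat D U \<longrightarrow> x \<in> carrier_vec D \<longrightarrow> walk d D U x = \<mu> \<cdot>\<^sub>v x \<longrightarrow>
      steps_mat (4 * D) U ts *\<^sub>v two_level D x (0\<^sub>v D) = two_level D (poly F \<mu> \<cdot>\<^sub>v x) (poly G \<mu> \<cdot>\<^sub>v x))"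
  using assms
proof (induction n arbitrary: F G)
  case 0
  then obtain f g where fg: "F = [:f:]" "G = [:g:]" by (metis degree_eq_zeroE le_zero_eq)
  have one: "(cmod f)\<^sup>2 + (cmod g)\<^sup>2 = 1" using "0.prems"(3)[of 1] fg by simp
  show ?case
  proof (rule exI[of _ "[GateStep (rotation D f g)]"], intro conjI allI impI)
    show "wf_steps (4 * D) [GateStep (rotation D f g)]" by (simp add: unitary_rotation one)
    fix U x \<mu> assume U: "unitary_mat D U" and x: "x \<in> carrier_vec D" and "walk d D U x = \<mu> \<cdot>\<^sub>v x"
    have "f \<cdot>\<^sub>v x - cnj g \<cdot>\<^sub>v 0\<^sub>v D = f \<cdot>\<^sub>v x" "g \<cdot>\<^sub>v x + cnj f \<cdot>\<^sub>v 0\<^sub>v D = g \<cdot>\<^sub>v x"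
      using x by (auto intro!: eq_vecI)
    then show "steps_mat (4 * D) U [GateStep (rotation D f g)] *\<^sub>v two_level D x (0\<^sub>v D) =
        two_level D (poly F \<mu> \<cdot>\<^sub>v x) (poly G \<mu> \<cdot>\<^sub>v x)"
      using x steps_mat_gate[OF unitary_rotation[OF one]] by (simp add: fg rotation_mult_two_level del: steps_mat.simps)
  qed simp
next
  case (Suc n)
  obtain a b F' G' where ab: "(cmod a)\<^sup>2 + (cmod b)\<^sup>2 = 1" and deg: "degree F' \<le> n" "degree G' \<le> n"
    and one: "\<And>z. cmod z = 1 \<Longrightarrow> (cmod (poly F' z))\<^sup>2 + (cmod (poly G' z))\<^sup>2 = 1"
    and F: "\<And>z. poly F z = a * (z * poly F' z) - cnj b * poly G' z"
    and G: "\<And>z. poly G z = b * (z * poly F' z) + cnj a * poly G' z"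
    using peel_rotation[OF Suc.prems] by metis
  obtain ts where ts: "wf_steps (4 * D) ts" "oracle_steps ts = 2 * n"
    "\<And>U x \<mu>. unitary_mat D U \<Longrightarrow> x \<in> carrier_vec D \<Longrightarrow> walk d D U x = \<mu> \<cdot>\<^sub>v x \<Longrightarrow>
      steps_mat (4 * D) U ts *\<^sub>v two_level D x (0\<^sub>v D) = two_level D (poly F' \<mu> \<cdot>\<^sub>v x) (poly G' \<mu> \<cdot>\<^sub>v x)"
    using Suc.IH[OF deg one] by blast
  let ?R = "[GateStep (rotation D a b)]"
  have wf: "wf_steps (4 * D) ?R" by (simp add: unitary_rotation ab)
  show ?case
  proof (rule exI[of _ "ts @ controlled_walk d D @ ?R"], intro conjI allI impI)
    show "wf_steps (4 * D) (ts @ controlled_walk d D @ ?R)" using wf ts(1) wf_walk_steps by simp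
    show "oracle_steps (ts @ controlled_walk d D @ ?R) = 2 * Suc n"
      using ts(2) by (simp add: oracle_steps_append controlled_walk_def)
    fix U x \<mu> assume U: "unitary_mat D U" and x: "x \<in> carrier_vec D" and eig: "walk d D U x = \<mu> \<cdot>\<^sub>v x"
    have "steps_mat (4 * D) U (ts @ controlled_walk d D @ ?R) *\<^sub>v two_level D x (0\<^sub>v D) =
        steps_mat (4 * D) U (controlled_walk d D @ ?R) *\<^sub>v (two_level D (poly F' \<mu> \<cdot>\<^sub>v x) (poly G' \<mu> \<cdot>\<^sub>v x))"
      using ts(1) wf wf_walk_steps by (subst steps_mat_append_vec[OF _ U]) (auto simp: ts(3)[OF U x eig])
    also have "\<dots> = steps_mat (4 * D) U ?R *\<^sub>v two_level D (walk d D U (poly F' \<mu> \<cdot>\<^sub>v x)) (poly G' \<mu> \<cdot>\<^sub>v x)"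
      using wf wf_walk_steps x
      by (subst steps_mat_append_vec[OF _ U]) (auto simp: controlled_walk_two_level[OF U])
    also have "walk d D U (poly F' \<mu> \<cdot>\<^sub>v x) = (poly F' \<mu> * \<mu>) \<cdot>\<^sub>v x"
      using walk_smult[OF U x] eig by (simp add: smult_smult_assoc)
    also have "steps_mat (4 * D) U ?R *\<^sub>v two_level D ((poly F' \<mu> * \<mu>) \<cdot>\<^sub>v x) (poly G' \<mu> \<cdot>\<^sub>v x) =
        two_level D (a \<cdot>\<^sub>v ((poly F' \<mu> * \<mu>) \<cdot>\<^sub>v x) - cnj b \<cdot>\<^sub>v (poly G' \<mu> \<cdot>\<^sub>v x))
          (b \<cdot>\<^sub>v ((poly F' \<mu> * \<mu>) \<cdot>\<^sub>v x) + cnj a \<cdot>\<^sub>v (poly G' \<mu> \<cdot>\<^sub>v x))"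
      using x steps_mat_gate[OF unitary_rotation[OF ab]] by (simp add: rotation_mult_two_level del: steps_mat.simps)
    also have "a \<cdot>\<^sub>v ((poly F' \<mu> * \<mu>) \<cdot>\<^sub>v x) - cnj b \<cdot>\<^sub>v (poly G' \<mu> \<cdot>\<^sub>v x) = poly F \<mu> \<cdot>\<^sub>v x"
      using x by (intro eq_vecI) (auto simp: F algebra_simps)
    also have "b \<cdot>\<^sub>v ((poly F' \<mu> * \<mu>) \<cdot>\<^sub>v x) + cnj a \<cdot>\<^sub>v (poly G' \<mu> \<cdot>\<^sub>v x) = poly G \<mu> \<cdot>\<^sub>v x"
      using x by (intro eq_vecI) (auto simp: G algebra_simps)
    finally show "steps_mat (4 * D) U (ts @ controlled_walk d D @ ?R) *\<^sub>v two_level D x (0\<^sub>v D) =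
        two_level D (poly F \<mu> \<cdot>\<^sub>v x) (poly G \<mu> \<cdot>\<^sub>v x)" .
  qed
qed

section \<open>From eigenvectors of the walk to singular vectors\<close>

lemma two_level_pad: "dim_vec x \<le> D \<Longrightarrow> two_level D (pad D x) (0\<^sub>v D) = pad (4 * D) x"
proof (rule eq_vecI)
  fix i assume x: "dim_vec x \<le> D" and "i < dim_vec (pad (4 * D) x)"
  then have i: "i < 4 * D" by simp
  show "two_level D (pad D x) (0\<^sub>v D) $ i = pad (4 * D) x $ i"
  proof (cases "i < D")
    case False
    then have "i div D \<noteq> 0" using div_mod_less(2)[OF i] by (auto simp: div_eq_0_iff)
    then show ?thesis using False i x div_mod_less[OF i] by (simp add: two_level_def pad_def)
  qed (use i in \<open>simp add: two_level_def pad_def\<close>)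
qed simp

lemma pad_smult: "pad D (c \<cdot>\<^sub>v x) = c \<cdot>\<^sub>v pad D x"
  by (rule eq_vecI) (auto simp: pad_def)

lemma truncate_pad: "x \<in> carrier_vec d \<Longrightarrow> d \<le> D \<Longrightarrow> truncate d (pad D x) = x"
  by (intro eq_vecI) (auto simp: pad_def truncate_def)

lemma truncate_smult: "d \<le> dim_vec x \<Longrightarrow> truncate d (c \<cdot>\<^sub>v x) = c \<cdot>\<^sub>v truncate d x"
  by (intro eq_vecI) (auto simp: truncate_def)

lemma truncate_diff: "d \<le> dim_vec x \<Longrightarrow> d \<le> dim_vec y \<Longrightarrow> truncate d (x - y) = truncate d x - truncate d y"
  by (intro eq_vecI) (auto simp: truncate_def)

lemma two_level_smult_diff:
  assumes "x \<in> carrier_vec D" "y \<in> carrier_vec D"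
  shows "two_level D (c \<cdot>\<^sub>v (x - y)) (0\<^sub>v D) = c \<cdot>\<^sub>v (two_level D x (0\<^sub>v D) - two_level D y (0\<^sub>v D))"
proof (rule eq_vecI)
  fix i assume "i < dim_vec (c \<cdot>\<^sub>v (two_level D x (0\<^sub>v D) - two_level D y (0\<^sub>v D)))"
  then have i: "i < 4 * D" by simp
  show "two_level D (c \<cdot>\<^sub>v (x - y)) (0\<^sub>v D) $ i = (c \<cdot>\<^sub>v (two_level D x (0\<^sub>v D) - two_level D y (0\<^sub>v D))) $ i"
    using assms i div_mod_less[OF i] by (auto simp: two_level_def)
qed simp

text \<open>
  With \<open>u = |0\<rangle>v\<close>, \<open>e = U\<^sup>\<dagger>|0\<rangle>w\<close> and \<open>\<sigma> = (z + cnj z) / 2\<close>, the walk preserves the span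
  of \<open>u\<close> and \<open>e\<close>, where \<open>e - z u\<close> and \<open>e - cnj z u\<close> are eigenvectors for \<open>z\<^sup>2\<close> and \<open>cnj z\<^sup>2\<close>.
\<close>

lemma walk_eigenvector:
  assumes U: "unitary_mat D U" and dD: "d \<le> D" and v: "v \<in> carrier_vec d" and w: "w \<in> carrier_vec d"
    and Uv: "truncate d (U *\<^sub>v pad D v) = complex_of_real \<sigma> \<cdot>\<^sub>v w"
    and Uw: "truncate d (mat_adjoint U *\<^sub>v pad D w) = complex_of_real \<sigma> \<cdot>\<^sub>v v"
    and z: "z * z' = 1" "z + z' = complex_of_real (2 * \<sigma>)"
  defines "x \<equiv> mat_adjoint U *\<^sub>v pad D w - z \<cdot>\<^sub>v pad D v"
  shows "walk d D U x = z\<^sup>2 \<cdot>\<^sub>v x" "truncate d (U *\<^sub>v x) = ((1 - z\<^sup>2) / 2) \<cdot>\<^sub>v w"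
proof -
  let ?u = "pad D v" and ?e = "mat_adjoint U *\<^sub>v pad D w" and ?R = "reflection d D"
  have Uc: "U \<in> carrier_mat D D" "mat_adjoint U \<in> carrier_mat D D"
    using unitary_mat_carrier[OF U] by auto
  have c: "U *\<^sub>v ?u \<in> carrier_vec D" "?e \<in> carrier_vec D"
    using Uc by (auto intro!: mult_mat_vec_carrier[of _ D D])
  have Ue: "U *\<^sub>v ?e = pad D w"
    using unitary_mult_adjoint_vec(2)[OF U] by simp
  have R_pad: "?R *\<^sub>v pad D y = pad D y" if "y \<in> carrier_vec d" for y
    using that by (subst reflection_mult_vec[OF _ dD]) (auto simp: truncate_pad dD intro!: eq_vecI)
  \<comment> \<open>The component of \<open>e\<close> along |0> is known from the encoding of the
    adjoint, so the reflection stays in the span of \<open>u\<close> and \<open>e\<close>.\<close>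
  have Re: "?R *\<^sub>v ?e = complex_of_real (2 * \<sigma>) \<cdot>\<^sub>v ?u - ?e"
    using c by (subst reflection_mult_vec[OF _ dD]) (auto simp: Uw pad_smult smult_smult_assoc)
  have "?R *\<^sub>v (U *\<^sub>v ?u) = complex_of_real (2 * \<sigma>) \<cdot>\<^sub>v pad D w - U *\<^sub>v ?u"
    using c by (subst reflection_mult_vec[OF _ dD]) (auto simp: Uv pad_smult smult_smult_assoc)
  then have "mat_adjoint U *\<^sub>v (?R *\<^sub>v (U *\<^sub>v ?u)) = complex_of_real (2 * \<sigma>) \<cdot>\<^sub>v ?e - ?u"
    using Uc c unitary_mult_adjoint_vec(1)[OF U, of ?u]
    by (simp add: mult_minus_distrib_mat_vec[of _ D D] mult_mat_vec[of _ D D])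
  then have walk_u: "walk d D U ?u = complex_of_real (2 * \<sigma>) \<cdot>\<^sub>v (complex_of_real (2 * \<sigma>) \<cdot>\<^sub>v ?u - ?e) - ?u"
    using c by (simp add: walk_def mult_minus_distrib_mat_vec[of _ D D] mult_mat_vec[of _ D D] Re R_pad[OF v])
  have walk_e: "walk d D U ?e = complex_of_real (2 * \<sigma>) \<cdot>\<^sub>v ?u - ?e"
    by (simp add: walk_def Ue R_pad[OF w] Re)
  have z2: "z * (z + z') = z\<^sup>2 + 1" using z(1) by (simp add: algebra_simps power2_eq_square)
  have "walk d D U x = walk d D U ?e - z \<cdot>\<^sub>v walk d D U ?u"
    unfolding x_def using c by (simp add: walk_diff[OF U] walk_smult[OF U])
  also have "\<dots> = z\<^sup>2 \<cdot>\<^sub>v x"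
  proof (rule eq_vecI)
    fix i assume "i < dim_vec (z\<^sup>2 \<cdot>\<^sub>v x)"
    then have i: "i < D" by (simp add: x_def)
    \<comment> \<open>The eigenvector equation entrywise, with \<open>a\<close>, \<open>b\<close>
      for the entries of \<open>u\<close>, \<open>e\<close>. It rests on \<open>z2\<close> alone,
      used twice.\<close>
    have "(z + z') * a - b - z * ((z + z') * ((z + z') * a - b) - a) = z\<^sup>2 * (b - z * a)" for a b :: complex
    proof -
      have "(z + z') * a - b - z * ((z + z') * ((z + z') * a - b) - a) =
          (z + z') * a - b - z * (z + z') * (z + z') * a + z * (z + z') * b + z * a"
        by (simp add: algebra_simps)
      also have "\<dots> = (z + z') * a - b - (z\<^sup>2 + 1) * (z + z') * a + (z\<^sup>2 + 1) * b + z * a"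
        unfolding z2 ..
      also have "\<dots> = z\<^sup>2 * b - z * (z * (z + z')) * a + z * a"
        by (simp add: algebra_simps power2_eq_square)
      also have "\<dots> = z\<^sup>2 * (b - z * a)"
        unfolding z2 by (simp add: algebra_simps power2_eq_square)
      finally show ?thesis .
    qed
    then show "(walk d D U ?e - z \<cdot>\<^sub>v walk d D U ?u) $ i = (z\<^sup>2 \<cdot>\<^sub>v x) $ i"
      using i c Uc unfolding walk_u walk_e x_def z(2)[symmetric] by (simp del: index_mult_mat_vec)
  qed (use Uc in \<open>simp add: x_def walk_u\<close>)
  finally show "walk d D U x = z\<^sup>2 \<cdot>\<^sub>v x" .
  have "U *\<^sub>v x = pad D w - z \<cdot>\<^sub>v (U *\<^sub>v ?u)"
    unfolding x_def using Uc c by (simp add: mult_minus_distrib_mat_vec[of _ D D] mult_mat_vec[of _ D D] Ue)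
  then have "truncate d (U *\<^sub>v x) = w - z \<cdot>\<^sub>v (complex_of_real \<sigma> \<cdot>\<^sub>v w)"
    using dD Uc w by (simp add: truncate_diff truncate_smult truncate_pad Uv)
  also have "\<dots> = (1 - z * complex_of_real \<sigma>) \<cdot>\<^sub>v w"
    using w by (intro eq_vecI) (auto simp: algebra_simps)
  also have "1 - z * complex_of_real \<sigma> = (1 - z\<^sup>2) / 2"
    using z2 unfolding z(2) by (simp add: field_simps)
  finally show "truncate d (U *\<^sub>v x) = ((1 - z\<^sup>2) / 2) \<cdot>\<^sub>v w" .
qed

text \<open>As \<open>z\<close> and \<open>z'\<close> differ, |0>v is a multiple of the difference
  of two eigenvectors, and on each of them \<open>S\<close> acts by the scalar \<open>f\<close>.
  Projecting brings in the factors (1 - z^2)/2 and (1 - z'^2)/2, and \<open>z * z' = 1\<close>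
  cancels the denominator.\<close>

lemma singular_vector_transform:
  fixes f :: "complex \<Rightarrow> complex"
  assumes U: "unitary_mat D U" and dD: "d \<le> D" and v: "v \<in> carrier_vec d" and w: "w \<in> carrier_vec d"
    and Uv: "truncate d (U *\<^sub>v pad D v) = complex_of_real \<sigma> \<cdot>\<^sub>v w"
    and Uw: "truncate d (mat_adjoint U *\<^sub>v pad D w) = complex_of_real \<sigma> \<cdot>\<^sub>v v"
    and z: "z * z' = 1" "z + z' = complex_of_real (2 * \<sigma>)" "z \<noteq> z'"
    and S: "S \<in> carrier_mat (4 * D) (4 * D)"
      "\<And>x \<mu>. x \<in> carrier_vec D \<Longrightarrow> \<mu> \<noteq> 0 \<Longrightarrow> walk d D U x = \<mu> \<cdot>\<^sub>v x \<Longrightarrow>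
        truncate d (S *\<^sub>v two_level D x (0\<^sub>v D)) = f \<mu> \<cdot>\<^sub>v truncate d (U *\<^sub>v x)"
  shows "truncate d (S *\<^sub>v two_level D (pad D v) (0\<^sub>v D)) = ((z * f (z\<^sup>2) + z' * f (z'\<^sup>2)) / 2) \<cdot>\<^sub>v w"
proof -
  define x where "x = mat_adjoint U *\<^sub>v pad D w - z \<cdot>\<^sub>v pad D v"
  define x' where "x' = mat_adjoint U *\<^sub>v pad D w - z' \<cdot>\<^sub>v pad D v"
  have Uc: "U \<in> carrier_mat D D" "mat_adjoint U \<in> carrier_mat D D"
    using unitary_mat_carrier[OF U] by auto
  have c: "x \<in> carrier_vec D" "x' \<in> carrier_vec D"
    using Uc by (auto simp: x_def x'_def)
  have nz: "z\<^sup>2 \<noteq> 0" "z'\<^sup>2 \<noteq> 0" using z(1) by auto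
  note eig = walk_eigenvector[OF U dD v w Uv Uw z(1,2), folded x_def]
  have "z' * z = 1" "z' + z = complex_of_real (2 * \<sigma>)" using z by (auto simp: mult.commute add.commute)
  note eig' = walk_eigenvector[OF U dD v w Uv Uw this, folded x'_def]
  let ?t = "\<lambda>x. two_level D x (0\<^sub>v D)"
  have "pad D v = (1 / (z - z')) \<cdot>\<^sub>v (x' - x)"
    using z(3) Uc by (intro eq_vecI) (auto simp: x_def x'_def field_simps)
  then have "S *\<^sub>v ?t (pad D v) = (1 / (z - z')) \<cdot>\<^sub>v (S *\<^sub>v ?t x' - S *\<^sub>v ?t x)"
    using S(1) c by (simp add: two_level_smult_diff mult_mat_vec[of _ "4 * D" "4 * D"]
        mult_minus_distrib_mat_vec[of _ "4 * D" "4 * D"])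
  then have "truncate d (S *\<^sub>v ?t (pad D v)) = (1 / (z - z')) \<cdot>\<^sub>v (truncate d (S *\<^sub>v ?t x') - truncate d (S *\<^sub>v ?t x))"
    using S(1) dD by (simp add: truncate_smult truncate_diff)
  also have "\<dots> = (1 / (z - z')) \<cdot>\<^sub>v (f (z'\<^sup>2) \<cdot>\<^sub>v (((1 - z'\<^sup>2) / 2) \<cdot>\<^sub>v w) - f (z\<^sup>2) \<cdot>\<^sub>v (((1 - z\<^sup>2) / 2) \<cdot>\<^sub>v w))"
    by (simp only: S(2)[OF c(1) nz(1) eig(1)] S(2)[OF c(2) nz(2) eig'(1)] eig(2) eig'(2))
  also have "\<dots> = ((f (z'\<^sup>2) * (1 - z'\<^sup>2) - f (z\<^sup>2) * (1 - z\<^sup>2)) / (2 * (z - z'))) \<cdot>\<^sub>v w"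
  proof -
    have "1 / (z - z') * (a * (b / 2 * c) - a' * (b' / 2 * c)) = (a * b - a' * b') / (2 * (z - z')) * c"
      for a a' b b' c :: complex
      using z(3) by (simp add: divide_simps) (simp add: algebra_simps)
    then show ?thesis using w by (intro eq_vecI) auto
  qed
  also have "1 - z'\<^sup>2 = z' * (z - z')" using z(1) by (simp add: algebra_simps power2_eq_square)
  also have "1 - z\<^sup>2 = - z * (z - z')" using z(1) by (simp add: algebra_simps power2_eq_square)
  also have "(f (z'\<^sup>2) * (z' * (z - z')) - f (z\<^sup>2) * (- z * (z - z'))) / (2 * (z - z')) =
      (z * f (z\<^sup>2) + z' * f (z'\<^sup>2)) / 2"
    using z(3) by (simp add: divide_simps) (simp add: algebra_simps)
  finally show ?thesis .
qed

lemma svd_apply: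
  assumes "is_svd d A \<sigma> w v" "i < d"
  shows "A *\<^sub>v v i = complex_of_real (\<sigma> i) \<cdot>\<^sub>v w i" "mat_adjoint A *\<^sub>v w i = complex_of_real (\<sigma> i) \<cdot>\<^sub>v v i"
  using assms by (auto simp: is_svd_def mat_adjoint_ketbra_sum ketbra_sum_mult_basis)

text \<open>The circuit block-encodes \<open>N\<close> with \<open>l + 2\<close> auxiliary qubits;
  stated on vectors, the form in which the semantics of procedures meets it.\<close>

definition realizes :: "nat \<Rightarrow> nat \<Rightarrow> complex mat \<Rightarrow> step list \<Rightarrow> complex mat \<Rightarrow> bool" where
  "realizes l s U ts N \<longleftrightarrow> (\<forall>\<psi>\<in>carrier_vec (2 ^ s).
     truncate (2 ^ s) (steps_mat (4 * 2 ^ (l + s)) U ts *\<^sub>v pad (4 * 2 ^ (l + s)) \<psi>) = N *\<^sub>v \<psi>)"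

text \<open>\<open>F\<close> represents the Laurent polynomial \<open>F(\<mu>) / \<mu> ^ M\<close>; the division is done by \<open>M\<close> inverse walks.\<close>

lemma singular_value_transform_steps:
  fixes F :: "complex poly"
  assumes "degree F \<le> 2 * M" "\<And>z. cmod z = 1 \<Longrightarrow> cmod (poly F z) < 1"
  defines "f \<equiv> \<lambda>\<mu>. poly F \<mu> / \<mu> ^ M"
  obtains ts where "wf_steps (4 * 2 ^ (l + s)) ts" "oracle_steps ts = 6 * M + 1"
    "\<forall>U A \<sigma> w v \<zeta>. block_encodes l s U A \<longrightarrow> is_svd (2 ^ s) A \<sigma> w v \<longrightarrow>
      (\<forall>i<2 ^ s. \<zeta> i * cnj (\<zeta> i) = 1 \<and> Re (\<zeta> i) = \<sigma> i \<and> Im (\<zeta> i) \<noteq> 0) \<longrightarrow>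
      realizes l s U ts (ketbra_sum (2 ^ s)
        (\<lambda>i. (\<zeta> i * f ((\<zeta> i)\<^sup>2) + cnj (\<zeta> i) * f ((cnj (\<zeta> i))\<^sup>2)) / 2) w v)"
proof -
  define d where "d = (2::nat) ^ s"
  define D where "D = (2::nat) ^ (l + s)"
  have dD: "d \<le> D" by (simp add: d_def D_def)
  obtain G where G: "degree G \<le> 2 * M"
    "\<And>z. cmod z = 1 \<Longrightarrow> (cmod (poly F z))\<^sup>2 + (cmod (poly G z))\<^sup>2 = 1"
    using complementary_poly[OF assms(1,2)] by metis
  obtain ss where ss: "wf_steps (4 * D) ss" "oracle_steps ss = 2 * (2 * M)"
    "\<And>U x \<mu>. unitary_mat D U \<Longrightarrow> x \<in> carrier_vec D \<Longrightarrow> walk d D U x = \<mu> \<cdot>\<^sub>v x \<Longrightarrow>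
      steps_mat (4 * D) U ss *\<^sub>v two_level D x (0\<^sub>v D) = two_level D (poly F \<mu> \<cdot>\<^sub>v x) (poly G \<mu> \<cdot>\<^sub>v x)"
    using signal_processing_steps[OF assms(1) G, of D d] by metis
  define vs where "vs = concat (replicate M (inverse_walk d D))"
  \<comment> \<open>The processing multiplies by \<open>poly F \<mu>\<close>, the inverse walks
    divide by \<open>\<mu> ^ M\<close>, and the last oracle call leads from right to left singular
    vectors. The calls are 4M + 2M + 1.\<close>
  define ts where "ts = ss @ vs @ [OracleStep False]"
  have wf_vs: "wf_steps (4 * D) vs" unfolding vs_def by (induction M) (auto simp: wf_walk_steps)
  then have wf: "wf_steps (4 * D) ts" using ss(1) by (simp add: ts_def)
  have "oracle_steps vs = 2 * M"
    unfolding vs_def by (induction M) (auto simp: oracle_steps_append inverse_walk_def)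
  then have count: "oracle_steps ts = 6 * M + 1"
    using ss(2) by (simp add: ts_def oracle_steps_append)
  have act: "truncate d (steps_mat (4 * D) U ts *\<^sub>v two_level D x (0\<^sub>v D)) = f \<mu> \<cdot>\<^sub>v truncate d (U *\<^sub>v x)"
    if U: "unitary_mat D U" and x: "x \<in> carrier_vec D" and \<mu>: "\<mu> \<noteq> 0" and eig: "walk d D U x = \<mu> \<cdot>\<^sub>v x" for U x \<mu>
  proof -
    have Uc: "U \<in> carrier_mat D D" using U by (rule unitary_mat_carrier)
    have "steps_mat (4 * D) U ts *\<^sub>v two_level D x (0\<^sub>v D) =
        steps_mat (4 * D) U (vs @ [OracleStep False]) *\<^sub>v two_level D (poly F \<mu> \<cdot>\<^sub>v x) (poly G \<mu> \<cdot>\<^sub>v x)"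
      unfolding ts_def using ss(1) wf_vs by (subst steps_mat_append_vec[OF _ U]) (auto simp: ss(3)[OF U x eig])
    also have "\<dots> = steps_mat (4 * D) U [OracleStep False] *\<^sub>v
        two_level D (f \<mu> \<cdot>\<^sub>v x) ((poly G \<mu> / \<mu> ^ M) \<cdot>\<^sub>v x)"
      using wf_vs
      by (subst steps_mat_append_vec[OF _ U])
        (auto simp: vs_def f_def inverse_walk_power_two_level[OF U x eig \<mu>])
    also have "\<dots> = two_level D (U *\<^sub>v (f \<mu> \<cdot>\<^sub>v x)) (U *\<^sub>v ((poly G \<mu> / \<mu> ^ M) \<cdot>\<^sub>v x))"
      using x Uc unitary_mat_carrier[OF unitary_kron[OF unitary_mat_one U], of 4]
      by (simp add: steps_mat_Cons_vec[OF _ U] kron_one_mult_two_level del: steps_mat.simps(2))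
    finally show ?thesis
      using x Uc dD by (simp add: truncate_two_level mult_mat_vec[of _ D D] truncate_smult)
  qed
  have main: "truncate d (steps_mat (4 * D) U ts *\<^sub>v pad (4 * D) \<psi>) =
      ketbra_sum d (\<lambda>i. (\<zeta> i * f ((\<zeta> i)\<^sup>2) + cnj (\<zeta> i) * f ((cnj (\<zeta> i))\<^sup>2)) / 2) w v *\<^sub>v \<psi>"
    if enc: "block_encodes l s U A" and svd: "is_svd d A \<sigma> w v" and \<psi>: "\<psi> \<in> carrier_vec d"
      and \<zeta>: "\<And>i. i < d \<Longrightarrow> \<zeta> i * cnj (\<zeta> i) = 1 \<and> Re (\<zeta> i) = \<sigma> i \<and> Im (\<zeta> i) \<noteq> 0" for U A \<sigma> w v \<zeta> \<psi>
  proof -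
    have U: "unitary_mat D U" using enc by (simp add: block_encodes_def D_def)
    have basis: "orthonormal_basis d w" "orthonormal_basis d v" using svd by (auto simp: is_svd_def)
    let ?S = "steps_mat (4 * D) U ts"
    \<comment> \<open>The compressed circuit is a matrix, hence determined by its values on the
      \<open>v i\<close>. Viewing it as a block encoding with two more qubits makes the earlier
      lemma compute them.\<close>
    let ?N = "kron (mat_adjoint (ket (l + 2) 0)) (1\<^sub>m (2 ^ s)) * ?S * kron (ket (l + 2) 0) (1\<^sub>m (2 ^ s))"
    have D4: "2 ^ (l + 2 + s) = 4 * D" by (simp add: D_def power_add)
    have S: "unitary_mat (4 * D) ?S" by (rule unitary_steps_mat[OF wf U])
    have "block_encodes (l + 2) s ?S ?N"
      unfolding block_encodes_def D4 using S by simp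
    from block_encoding_truncate(1)[OF this]
    have N: "truncate d (?S *\<^sub>v pad (4 * D) x) = ?N *\<^sub>v x" if "x \<in> carrier_vec d" for x
      using that unfolding d_def D4 by blast
    have "?N = ketbra_sum d (\<lambda>i. (\<zeta> i * f ((\<zeta> i)\<^sup>2) + cnj (\<zeta> i) * f ((cnj (\<zeta> i))\<^sup>2)) / 2) w v"
    proof (rule mat_eq_on_basis[OF basis(2)])
      show "?N \<in> carrier_mat d d"
        using unitary_mat_carrier[OF S] by (auto simp: d_def ket_def)
      fix i assume i: "i < d"
      note vi = orthonormal_basisD(1)[OF basis(2) i] and wi = orthonormal_basisD(1)[OF basis(1) i]
      have enc_v: "truncate d (U *\<^sub>v pad D (v i)) = complex_of_real (\<sigma> i) \<cdot>\<^sub>v w i"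
        "truncate d (mat_adjoint U *\<^sub>v pad D (w i)) = complex_of_real (\<sigma> i) \<cdot>\<^sub>v v i"
        using block_encoding_truncate[OF enc] vi wi svd_apply[OF svd i] unfolding d_def D_def by auto
      have z: "\<zeta> i * cnj (\<zeta> i) = 1" "\<zeta> i + cnj (\<zeta> i) = complex_of_real (2 * \<sigma> i)" "\<zeta> i \<noteq> cnj (\<zeta> i)"
        using \<zeta>[OF i] by (auto simp: complex_eq_iff)
      have "?N *\<^sub>v v i = truncate d (?S *\<^sub>v two_level D (pad D (v i)) (0\<^sub>v D))"
        using N[OF vi] vi dD by (simp add: two_level_pad)
      also have "\<dots> = ((\<zeta> i * f ((\<zeta> i)\<^sup>2) + cnj (\<zeta> i) * f ((cnj (\<zeta> i))\<^sup>2)) / 2) \<cdot>\<^sub>v w i"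
        by (rule singular_vector_transform[OF U dD vi wi enc_v z unitary_mat_carrier[OF S] act[OF U]])
      finally show "?N *\<^sub>v v i = ketbra_sum d (\<lambda>i. (\<zeta> i * f ((\<zeta> i)\<^sup>2) + cnj (\<zeta> i) * f ((cnj (\<zeta> i))\<^sup>2)) / 2) w v *\<^sub>v v i"
        by (simp add: ketbra_sum_mult_basis[OF basis(2,1) i])
    qed simp
    then show ?thesis using N[OF \<psi>] by simp
  qed
  show ?thesis
    by (rule that[OF wf[unfolded D_def] count])
      (use main in \<open>unfold realizes_def d_def D_def, blast\<close>)
qed

section \<open>Approximating the unitaries\<close>

text \<open>For \<sigma> = cos \<theta> the right side is sin (2 \<theta>), the distance of the walk
  eigenvalue from the real axis. It is at least \<sigma> up to 1/2 and at least sqrt (1 -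
  \<sigma>^2) beyond.\<close>

lemma two_sin_cos_ge:
  fixes \<sigma> \<delta> :: real
  assumes "0 < \<delta>" "\<delta> \<le> 1/2" "\<delta> \<le> \<sigma>" "\<sigma> \<le> 1 - \<delta>"
  shows "\<delta> \<le> 2 * \<sigma> * sqrt (1 - \<sigma>\<^sup>2)"
proof (rule power2_le_imp_le)
  have s1: "\<sigma>\<^sup>2 \<le> 1" using assms by (intro power_le_one) auto
  have "\<delta>\<^sup>2 \<le> 4 * \<sigma>\<^sup>2 * (1 - \<sigma>\<^sup>2)"
  proof (cases "\<sigma> \<le> 1/2")
    case True
    have "\<sigma>\<^sup>2 \<le> (1/2)\<^sup>2" using True assms by (intro power_mono) auto
    then have "1 \<le> 4 * (1 - \<sigma>\<^sup>2)" by (simp add: power2_eq_square)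
    then have "\<sigma>\<^sup>2 * 1 \<le> \<sigma>\<^sup>2 * (4 * (1 - \<sigma>\<^sup>2))" by (intro mult_left_mono) auto
    moreover have "\<delta>\<^sup>2 \<le> \<sigma>\<^sup>2" using assms by (intro power_mono) auto
    ultimately show ?thesis by (simp add: algebra_simps)
  next
    case False
    have "(1/2)\<^sup>2 \<le> \<sigma>\<^sup>2" using False by (intro power_mono) auto
    then have "1 \<le> 4 * \<sigma>\<^sup>2" by (simp add: power2_eq_square)
    then have "1 - \<sigma>\<^sup>2 \<le> 4 * \<sigma>\<^sup>2 * (1 - \<sigma>\<^sup>2)"
      using mult_right_mono[of 1 "4 * \<sigma>\<^sup>2" "1 - \<sigma>\<^sup>2"] s1 by simp
    moreover have "\<sigma>\<^sup>2 \<le> (1 - \<delta>)\<^sup>2" using assms by (intro power_mono) auto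
    then have "2 * \<delta> - \<delta>\<^sup>2 \<le> 1 - \<sigma>\<^sup>2" by (simp add: power2_eq_square algebra_simps)
    moreover have "\<delta>\<^sup>2 \<le> 2 * \<delta> - \<delta>\<^sup>2"
    proof -
      have "\<delta> * \<delta> \<le> \<delta> * (1/2)" using assms by (intro mult_left_mono) auto
      then show ?thesis using assms(1) by (simp add: power2_eq_square)
    qed
    ultimately show ?thesis by (meson order_trans)
  qed
  then show "\<delta>\<^sup>2 \<le> (2 * \<sigma> * sqrt (1 - \<sigma>\<^sup>2))\<^sup>2"
    using s1 by (simp add: power_mult_distrib)
qed (use assms in \<open>auto intro!: mult_nonneg_nonneg simp: power_le_one\<close>)

text \<open>\<open>V\<close> is diagonal between the same singular bases as the target, so the error
  is scalar: a unimodular \<zeta> is replaced by \<zeta> t + cnj \<zeta> t', with t within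
  \<epsilon>/2 of 1 and t' within \<epsilon>/2 of 0. \<open>\<tau>\<close> is the sign of the
  imaginary part to be kept.\<close>

lemma approximation_steps:
  fixes \<delta> \<epsilon> \<tau> :: real
  assumes \<delta>: "0 < \<delta>" "\<delta> \<le> 1/2" and \<epsilon>: "0 < \<epsilon>" "\<epsilon> \<le> 1/2" and \<tau>: "\<tau> = 1 \<or> \<tau> = -1"
  obtains ts where "wf_steps (4 * 2 ^ (l + s)) ts" "real (oracle_steps ts) \<le> 242 * (1 / \<delta> * ln (1 / \<epsilon>))"
    "\<forall>U A \<sigma> w v. block_encodes l s U A \<longrightarrow> is_svd (2 ^ s) A \<sigma> w v \<longrightarrow>
      (\<forall>i<2 ^ s. \<delta> \<le> \<sigma> i \<and> \<sigma> i \<le> 1 - \<delta>) \<longrightarrow>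
      (\<exists>V\<in>carrier_mat (2 ^ s) (2 ^ s).
        op_norm (ketbra_sum (2 ^ s) (\<lambda>i. Complex (\<sigma> i) (\<tau> * sqrt (1 - (\<sigma> i)\<^sup>2))) w v - V) \<le> \<epsilon> \<and>
        realizes l s U ts ((1 / 4) \<cdot>\<^sub>m V) \<and>
        (\<forall>\<psi>\<in>carrier_vec (2 ^ s). vnorm \<psi> = 1 \<longrightarrow> 1 / 2 \<le> vnorm (V *\<^sub>v \<psi>)))"
proof -
  have \<tau>1: "\<bar>\<tau>\<bar> = 1" using \<tau> by auto
  have \<eta>: "0 < \<epsilon> / 2" "\<epsilon> / 2 < 1" and \<delta>1: "\<delta> \<le> 1" using \<epsilon> \<delta> by auto
  obtain M :: nat and F where deg: "degree F \<le> 2 * M" and M: "real M \<le> 5 / \<delta> * (log 2 (1 / (\<epsilon> / 2)) + 2)"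
    and F: "\<And>z. cmod z = 1 \<Longrightarrow> \<exists>t. 0 \<le> t \<and> t \<le> 1 \<and> poly F z = z ^ M * of_real t \<and>
       (\<tau> * Im z \<ge> \<delta> \<longrightarrow> t \<ge> 1 - \<epsilon> / 2) \<and> (\<tau> * Im z \<le> - \<delta> \<longrightarrow> t \<le> \<epsilon> / 2)"
    by (rule half_circle_filter[OF \<delta>(1) \<delta>1 \<eta> \<tau>1]) (rule that)
  \<comment> \<open>Halving makes the modulus strictly less than 1, as the complementary polynomial
    demands. With the mean over two eigenvalues it produces the factor 1/4.\<close>
  define H where "H = smult (1 / 2) F"
  have degH: "degree H \<le> 2 * M" using deg by (simp add: H_def)
  have smallH: "cmod (poly H z) < 1" if z: "cmod z = 1" for z
  proof -
    obtain t where "0 \<le> t" "t \<le> 1" "poly F z = z ^ M * of_real t" using F[OF z] by auto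
    then show ?thesis using z by (simp add: H_def norm_mult norm_power norm_divide)
  qed
  obtain ts where ts: "wf_steps (4 * 2 ^ (l + s)) ts" "oracle_steps ts = 6 * M + 1"
    and realizes: "\<forall>U A \<sigma> w v \<zeta>. block_encodes l s U A \<longrightarrow> is_svd (2 ^ s) A \<sigma> w v \<longrightarrow>
      (\<forall>i<2 ^ s. \<zeta> i * cnj (\<zeta> i) = 1 \<and> Re (\<zeta> i) = \<sigma> i \<and> Im (\<zeta> i) \<noteq> 0) \<longrightarrow>
      realizes l s U ts (ketbra_sum (2 ^ s) (\<lambda>i. (\<zeta> i * (poly H ((\<zeta> i)\<^sup>2) / ((\<zeta> i)\<^sup>2) ^ M) +
          cnj (\<zeta> i) * (poly H ((cnj (\<zeta> i))\<^sup>2) / ((cnj (\<zeta> i))\<^sup>2) ^ M)) / 2) w v)"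
    by (rule singular_value_transform_steps[OF degH, of l s], erule smallH, rule that)
  \<comment> \<open>\<open>M\<close> is at most 40 L/\<delta>, so 6M gives 240; the one remaining
    call is at most 2 L/\<delta>, since L is at least 1/2.\<close>
  have count: "real (oracle_steps ts) \<le> 242 * (1 / \<delta> * ln (1 / \<epsilon>))"
  proof -
    define L where "L = ln (1 / \<epsilon>)"
    have ln2: "ln (2::real) \<ge> 1/2" using ln_le_minus_one[of "1/2"] by (simp add: ln_div)
    have "1 / \<epsilon> \<ge> 2" using \<epsilon> by (simp add: field_simps)
    then have L2: "L \<ge> ln 2" unfolding L_def using \<epsilon> by (subst ln_le_cancel_iff) auto
    then have L: "L \<ge> 1/2" using ln2 by linarith
    have "log 2 (1 / (\<epsilon> / 2)) = (ln 2 + L) / ln 2"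
      using \<epsilon> by (simp add: log_def L_def ln_div)
    also have "\<dots> + 2 \<le> 4 * (L / ln 2)" using L2 ln2 by (simp add: field_simps)
    also have "\<dots> \<le> 8 * L"
    proof -
      have "L * 1 \<le> L * (2 * ln 2)" using ln2 L by (intro mult_left_mono) auto
      then show ?thesis using ln2 by (simp add: field_simps)
    qed
    finally have "5 / \<delta> * (log 2 (1 / (\<epsilon> / 2)) + 2) \<le> 5 / \<delta> * (8 * L)"
      using \<delta> by (intro mult_left_mono) auto
    with M have "real M \<le> 40 * (1 / \<delta> * L)" by simp
    moreover have "1 \<le> 2 * (1 / \<delta> * L)"
    proof -
      have "1 / 2 * 1 \<le> L * (1 / \<delta>)" using \<delta> L by (intro mult_mono) auto
      then show ?thesis by (simp add: mult.commute)
    qed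
    ultimately show ?thesis unfolding ts(2) L_def by simp
  qed
  have main: "\<exists>V\<in>carrier_mat (2 ^ s) (2 ^ s).
        op_norm (ketbra_sum (2 ^ s) (\<lambda>i. Complex (\<sigma> i) (\<tau> * sqrt (1 - (\<sigma> i)\<^sup>2))) w v - V) \<le> \<epsilon> \<and>
        realizes l s U ts ((1 / 4) \<cdot>\<^sub>m V) \<and>
        (\<forall>\<psi>\<in>carrier_vec (2 ^ s). vnorm \<psi> = 1 \<longrightarrow> 1 / 2 \<le> vnorm (V *\<^sub>v \<psi>))"
    if enc: "block_encodes l s U A" and svd: "is_svd (2 ^ s) A \<sigma> w v"
      and \<sigma>: "\<And>i. i < 2 ^ s \<Longrightarrow> \<delta> \<le> \<sigma> i \<and> \<sigma> i \<le> 1 - \<delta>" for U A \<sigma> w v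
  proof -
    define \<zeta> where "\<zeta> = (\<lambda>i. Complex (\<sigma> i) (\<tau> * sqrt (1 - (\<sigma> i)\<^sup>2)))"
    define h where "h = (\<lambda>i. (\<zeta> i * (poly H ((\<zeta> i)\<^sup>2) / ((\<zeta> i)\<^sup>2) ^ M) +
          cnj (\<zeta> i) * (poly H ((cnj (\<zeta> i))\<^sup>2) / ((cnj (\<zeta> i))\<^sup>2) ^ M)) / 2)"
    define g where "g = (\<lambda>i. 4 * h i)"
    define V where "V = ketbra_sum (2 ^ s) g w v"
    have basis: "orthonormal_basis (2 ^ s) w" "orthonormal_basis (2 ^ s) v" using svd by (auto simp: is_svd_def)
    have \<zeta>: "\<zeta> i * cnj (\<zeta> i) = 1" "Re (\<zeta> i) = \<sigma> i" "\<delta> \<le> \<tau> * Im ((\<zeta> i)\<^sup>2)" if "i < 2 ^ s" for i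
    proof -
      have s1: "(\<sigma> i)\<^sup>2 \<le> 1" using \<sigma>[OF that] \<delta> by (intro power_le_one) auto
      then show "\<zeta> i * cnj (\<zeta> i) = 1"
        using \<tau> by (auto simp: \<zeta>_def complex_eq_iff power2_eq_square real_sqrt_mult_self)
      show "Re (\<zeta> i) = \<sigma> i" by (simp add: \<zeta>_def)
      show "\<delta> \<le> \<tau> * Im ((\<zeta> i)\<^sup>2)"
        using two_sin_cos_ge[OF \<delta>, of "\<sigma> i"] \<sigma>[OF that] \<tau> by (auto simp: \<zeta>_def power2_eq_square mult.assoc)
    qed
    have nz: "Im (\<zeta> i) \<noteq> 0" if "i < 2 ^ s" for i
      using \<zeta>(3)[OF that] \<delta> by (auto simp: Im_power2)
    have cm: "cmod (\<zeta> i) = 1" if "i < 2 ^ s" for i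
      using \<zeta>(1)[OF that] complex_mod_sqrt_Re_mult_cnj[of "\<zeta> i"] by simp
    have close: "cmod (\<zeta> i - g i) \<le> \<epsilon>" if i: "i < 2 ^ s" for i
    proof -
      define \<mu> where "\<mu> = (\<zeta> i)\<^sup>2"
      have \<mu>: "cmod \<mu> = 1" "cmod (cnj \<mu>) = 1" using cm[OF i] by (auto simp: \<mu>_def norm_power)
      obtain t where t: "t \<le> 1" "poly F \<mu> = \<mu> ^ M * of_real t" "t \<ge> 1 - \<epsilon> / 2"
        using F[OF \<mu>(1)] \<zeta>(3)[OF i] by (auto simp: \<mu>_def)
      have "\<tau> * Im (cnj \<mu>) \<le> - \<delta>" using \<zeta>(3)[OF i, folded \<mu>_def] by simp
      then obtain t' where t': "0 \<le> t'" "poly F (cnj \<mu>) = cnj \<mu> ^ M * of_real t'" "t' \<le> \<epsilon> / 2"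
        using F[OF \<mu>(2)] by auto
      have "\<mu> \<noteq> 0" using \<mu> by auto
      have "g i = \<zeta> i * of_real t + cnj (\<zeta> i) * of_real t'"
        unfolding g_def h_def using \<open>\<mu> \<noteq> 0\<close> t(2) t'(2)
        by (simp add: H_def flip: \<mu>_def complex_cnj_power)
      then have "\<zeta> i - g i = \<zeta> i * of_real (1 - t) + cnj (\<zeta> i) * of_real (- t')"
        by (simp add: algebra_simps)
      then have "cmod (\<zeta> i - g i) \<le> cmod (\<zeta> i * of_real (1 - t)) + cmod (cnj (\<zeta> i) * of_real (- t'))"
        by (simp only: norm_triangle_ineq)
      also have "\<dots> = (1 - t) + t'"
        using t t' cm[OF i] unfolding norm_mult norm_of_real complex_mod_cnj by simp
      finally show ?thesis using t t' by linarith
    qed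
    show ?thesis
    proof (intro bexI[of _ V] conjI ballI impI)
      show "V \<in> carrier_mat (2 ^ s) (2 ^ s)" by (simp add: V_def)
      show "op_norm (ketbra_sum (2 ^ s) (\<lambda>i. Complex (\<sigma> i) (\<tau> * sqrt (1 - (\<sigma> i)\<^sup>2))) w v - V) \<le> \<epsilon>"
        unfolding V_def ketbra_sum_diff using close
        by (intro op_norm_ketbra_sum_le basis) (auto simp: \<zeta>_def)
      have "(1 / 4) \<cdot>\<^sub>m V = ketbra_sum (2 ^ s) h w v"
        unfolding V_def ketbra_sum_smult by (simp add: g_def)
      then show "realizes l s U ts ((1 / 4) \<cdot>\<^sub>m V)"
        using realizes[rule_format, OF enc svd, of \<zeta>, folded h_def] \<zeta>(1,2) nz by simp
      fix \<psi> :: "complex vec" assume \<psi>: "\<psi> \<in> carrier_vec (2 ^ s)" "vnorm \<psi> = 1"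
      \<comment> \<open>Being within \<epsilon> \<le> 1/2 of a unimodular number keeps every
        singular value of \<open>V\<close> at least 1/2, so no input state is suppressed.\<close>
      have "(1 / 2)\<^sup>2 \<le> (cmod (g i))\<^sup>2" if "i < 2 ^ s" for i
      proof (rule power_mono)
        have "cmod (\<zeta> i) \<le> cmod (g i) + cmod (\<zeta> i - g i)"
          using norm_triangle_ineq[of "g i" "\<zeta> i - g i"] by simp
        then show "1 / 2 \<le> cmod (g i)" using cm[OF that] close[OF that] \<epsilon> by linarith
      qed simp
      then have "(\<Sum>i<2 ^ s. (1 / 2)\<^sup>2 * (cmod (\<psi> \<bullet>c v i))\<^sup>2) \<le> (vnorm (V *\<^sub>v \<psi>))\<^sup>2"
        unfolding V_def vnorm_ketbra_sum[OF basis \<psi>(1)] by (intro sum_mono mult_right_mono) auto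
      then have "(1 / 2)\<^sup>2 * (vnorm \<psi>)\<^sup>2 \<le> (vnorm (V *\<^sub>v \<psi>))\<^sup>2"
        unfolding parseval_basis[OF basis(2) \<psi>(1)] by (simp add: sum_distrib_left)
      then have "(1 / 2)\<^sup>2 \<le> (vnorm (V *\<^sub>v \<psi>))\<^sup>2" using \<psi>(2) by simp
      then show "1 / 2 \<le> vnorm (V *\<^sub>v \<psi>)" by (rule power2_le_imp_le) simp
    qed
  qed
  show ?thesis by (rule that[OF ts(1) count]) (use main in blast)
qed

section \<open>Measuring and repeating until success\<close>

lemma measure_op_mult_vec_index:
  assumes "\<phi> \<in> carrier_vec (4 * 2 ^ (l + s))" "i < 4 * 2 ^ (l + s)"
  shows "(measure_op 2 l s q b *\<^sub>v \<phi>) $ i = (if qubit_value (2 + l) q (i div 2 ^ s) = b then \<phi> $ i else 0)"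
proof -
  let ?c = "\<lambda>k. if qubit_value (2 + l) q k = b then 1 else 0 :: complex"
  have dims: "4 * 2 ^ (l + s) = (2 ^ (2 + l) * 2 ^ s :: nat)" by (simp add: power_add)
  have i: "i < 2 ^ (2 + l) * 2 ^ s" using assms(2) unfolding dims .
  have "(measure_op 2 l s q b *\<^sub>v \<phi>) $ i =
      (\<Sum>k<2 ^ (2 + l). mat_diag (2 ^ (2 + l)) ?c $$ (i div 2 ^ s, k) * \<phi> $ (k * 2 ^ s + i mod 2 ^ s))"
    using assms(1) i unfolding measure_op_def basis_projector_def dims
    by (subst kron_one_mult_vec_index) (simp_all add: mat_diag_def)
  also have "\<dots> = (\<Sum>k<2 ^ (2 + l). if k = i div 2 ^ s then ?c k * \<phi> $ i else 0)"
    using div_mod_less(1)[OF i] by (intro sum.cong refl) (auto simp: mat_diag_def div_mult_mod_eq)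
  finally show ?thesis using div_mod_less(1)[OF i] by simp
qed

lemma measure_op_mult_vec_carrier:
  assumes "\<phi> \<in> carrier_vec (4 * 2 ^ (l + s))"
  shows "measure_op 2 l s q b *\<^sub>v \<phi> \<in> carrier_vec (4 * 2 ^ (l + s))"
  by (intro carrier_vecI) (simp add: measure_op_def basis_projector_def mat_diag_def power_add)

lemma measure_op_norms:
  assumes "\<phi> \<in> carrier_vec (4 * 2 ^ (l + s))"
  shows "(vnorm (measure_op 2 l s q 0 *\<^sub>v \<phi>))\<^sup>2 + (vnorm (measure_op 2 l s q 1 *\<^sub>v \<phi>))\<^sup>2 = (vnorm \<phi>)\<^sup>2"
proof -
  have "qubit_value (2 + l) q k = 0 \<or> qubit_value (2 + l) q k = 1" for k by (auto simp: qubit_value_def)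
  then have "(\<Sum>i<4 * 2 ^ (l + s). (cmod ((measure_op 2 l s q 0 *\<^sub>v \<phi>) $ i))\<^sup>2 +
      (cmod ((measure_op 2 l s q 1 *\<^sub>v \<phi>) $ i))\<^sup>2) = (\<Sum>i<4 * 2 ^ (l + s). (cmod (\<phi> $ i))\<^sup>2)"
  proof (intro sum.cong refl)
    fix i :: nat assume "i \<in> {..<4 * 2 ^ (l + s)}"
    then have i: "i < 4 * 2 ^ (l + s)" by simp
    from \<open>\<And>k. qubit_value (2 + l) q k = 0 \<or> qubit_value (2 + l) q k = 1\<close>[of "i div 2 ^ s"]
    show "(cmod ((measure_op 2 l s q 0 *\<^sub>v \<phi>) $ i))\<^sup>2 + (cmod ((measure_op 2 l s q 1 *\<^sub>v \<phi>) $ i))\<^sup>2 = (cmod (\<phi> $ i))\<^sup>2"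
      unfolding measure_op_mult_vec_index[OF assms i] by (elim disjE) simp_all
  qed
  then show ?thesis
    using assms measure_op_mult_vec_carrier[OF assms, THEN carrier_vecD] carrier_vecD[OF assms]
    by (simp add: vnorm_power2 sum.distrib del: index_mult_mat_vec dim_mult_mat_vec)
qed

text \<open>Defined for partial lists so that an induction over the measured qubits can track how
  much mass has been diverted so far.\<close>

definition keep_zero :: "nat \<Rightarrow> nat \<Rightarrow> nat list \<Rightarrow> complex vec \<Rightarrow> complex vec" where
  "keep_zero l s qs \<phi> = vec (4 * 2 ^ (l + s))
     (\<lambda>i. if \<forall>q\<in>set qs. qubit_value (2 + l) q (i div 2 ^ s) = 0 then \<phi> $ i else 0)"

lemma keep_zero_Cons:
  assumes "\<phi> \<in> carrier_vec (4 * 2 ^ (l + s))"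
  shows "keep_zero l s qs (measure_op 2 l s q 0 *\<^sub>v \<phi>) = keep_zero l s (q # qs) \<phi>"
  by (rule eq_vecI) (auto simp: keep_zero_def measure_op_mult_vec_index[OF assms] simp del: index_mult_mat_vec)

text \<open>Indices below \<open>2 ^ s\<close> have all auxiliary qubits 0, so projecting on outcome
  0 leaves them alone.\<close>

lemma truncate_measure_op:
  assumes "\<phi> \<in> carrier_vec (4 * 2 ^ (l + s))"
  shows "truncate (2 ^ s) (measure_op 2 l s q 0 *\<^sub>v \<phi>) = truncate (2 ^ s) \<phi>"
proof (rule eq_vecI)
  fix i assume "i < dim_vec (truncate (2 ^ s) \<phi>)"
  then have i: "i < 2 ^ s" by simp
  then have "i < 4 * 2 ^ (l + s)" by (simp add: power_add less_le_trans)
  then show "truncate (2 ^ s) (measure_op 2 l s q 0 *\<^sub>v \<phi>) $ i = truncate (2 ^ s) \<phi> $ i"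
    using i measure_op_mult_vec_index[OF assms, of i q 0] by (simp add: truncate_def qubit_value_def del: index_mult_mat_vec)
qed simp

text \<open>Qubit \<open>q\<close> is bit \<open>n - 1 - q\<close>, and the bits from
  \<open>n\<close> on vanish by the size of \<open>k\<close>.\<close>

lemma qubits_zero_iff:
  assumes "k < 2 ^ n"
  shows "(\<forall>q<n. qubit_value n q k = 0) \<longleftrightarrow> k = 0"
proof
  assume zero: "\<forall>q<n. qubit_value n q k = 0"
  have "\<not> bit k m" for m
  proof (cases "m < n")
    case True
    then have "qubit_value n (n - 1 - m) k = 0" using zero by simp
    then show ?thesis using True by (simp add: qubit_value_def bit_iff_odd even_iff_mod_2_eq_zero)
  next
    case False
    then have "k < 2 ^ m" using assms by (meson less_le_trans not_less one_le_numeral power_increasing)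
    then show ?thesis by (simp add: bit_iff_odd)
  qed
  then show "k = 0" by (intro bit_eqI) simp
qed (simp add: qubit_value_def)

lemma vnorm_pad: "dim_vec x \<le> D \<Longrightarrow> vnorm (pad D x) = vnorm x"
proof -
  assume "dim_vec x \<le> D"
  then have "(\<Sum>i<D. (cmod (pad D x $ i))\<^sup>2) = (\<Sum>i<dim_vec x. (cmod (x $ i))\<^sup>2)"
    by (intro sum.mono_neutral_cong_right) (auto simp: pad_def)
  then show ?thesis by (simp add: vnorm_def)
qed

lemma vnorm_truncate_le:
  assumes "d \<le> dim_vec x"
  shows "(vnorm (truncate d x))\<^sup>2 \<le> (vnorm x)\<^sup>2"
  unfolding vnorm_power2 using assms by (auto simp: truncate_def intro!: sum_mono2)

lemma vnorm_keep_zero_all: "vnorm (keep_zero l s [0..<2 + l] \<phi>) = vnorm (truncate (2 ^ s) \<phi>)"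
proof -
  have le: "(2::nat) ^ s \<le> 4 * 2 ^ (l + s)" by (simp add: power_add)
  have "keep_zero l s [0..<2 + l] \<phi> = pad (4 * 2 ^ (l + s)) (truncate (2 ^ s) \<phi>)"
  proof (rule eq_vecI)
    fix i assume "i < dim_vec (pad (4 * 2 ^ (l + s)) (truncate (2 ^ s) \<phi>))"
    then have i: "i < 4 * 2 ^ (l + s)" by simp
    then have "i div 2 ^ s < 2 ^ (2 + l)" by (intro div_mod_less(1)) (simp add: power_add mult_ac)
    then have "(\<forall>q\<in>set [0..<2 + l]. qubit_value (2 + l) q (i div 2 ^ s) = 0) \<longleftrightarrow> i div 2 ^ s = 0"
      unfolding set_upt atLeast0LessThan using qubits_zero_iff[of "i div 2 ^ s" "2 + l"] by (simp only: Ball_def lessThan_iff)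
    also have "\<dots> \<longleftrightarrow> i < 2 ^ s" by (simp add: div_eq_0_iff)
    finally have "keep_zero l s [0..<2 + l] \<phi> $ i = (if i < 2 ^ s then \<phi> $ i else 0)"
      unfolding keep_zero_def index_vec[OF i] by (simp only:)
    then show "keep_zero l s [0..<2 + l] \<phi> $ i = pad (4 * 2 ^ (l + s)) (truncate (2 ^ s) \<phi>) $ i"
      using i by (simp add: pad_def truncate_def)
  qed (simp add: keep_zero_def)
  then show ?thesis using le by (simp add: vnorm_pad)
qed

fun measure_zero :: "nat list \<Rightarrow> procedure \<Rightarrow> procedure \<Rightarrow> procedure" where
  "measure_zero [] P R = P"
| "measure_zero (q # qs) P R = Measure q (measure_zero qs P R) R"

text \<open>A mass balance: each outcome 1 hands its branch to \<open>R\<close>, which succeeds on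
  the fraction \<rho> of the mass it receives, and these masses add up to what
  \<open>keep_zero\<close> has lost. \<open>T\<close> plays the bra of the success flag, and
  \<open>X\<close> collects the system states left by \<open>R\<close>.\<close>

lemma measure_zero_outcomes:
  fixes l s U \<psi> and T :: "complex mat"
  defines "outcomes P \<phi> \<equiv> map (\<lambda>\<chi>. T *\<^sub>v \<chi>) (final_states 2 l s U \<psi> P \<phi>)"
  assumes P: "\<And>\<phi>. \<phi> \<in> carrier_vec (4 * 2 ^ (l + s)) \<Longrightarrow> outcomes P \<phi> = [truncate (2 ^ s) \<phi>]"
    and R: "\<And>\<phi>. \<phi> \<in> carrier_vec (4 * 2 ^ (l + s)) \<Longrightarrow>
      (\<Sum>\<chi>\<leftarrow>outcomes R \<phi>. (vnorm \<chi>)\<^sup>2) = (vnorm \<phi>)\<^sup>2 * \<rho> \<and> set (outcomes R \<phi>) \<subseteq> X"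
    and \<phi>: "\<phi> \<in> carrier_vec (4 * 2 ^ (l + s))"
  shows "(\<Sum>\<chi>\<leftarrow>outcomes (measure_zero qs P R) \<phi>. (vnorm \<chi>)\<^sup>2) =
      (vnorm (truncate (2 ^ s) \<phi>))\<^sup>2 + ((vnorm \<phi>)\<^sup>2 - (vnorm (keep_zero l s qs \<phi>))\<^sup>2) * \<rho> \<and>
    set (outcomes (measure_zero qs P R) \<phi>) \<subseteq> insert (truncate (2 ^ s) \<phi>) X"
  using \<phi>
proof (induction qs arbitrary: \<phi>)
  case Nil
  have "keep_zero l s [] \<phi> = \<phi>" using Nil by (intro eq_vecI) (auto simp: keep_zero_def)
  then show ?case using P[OF Nil] by simp
next
  case (Cons q qs)
  let ?\<phi>0 = "measure_op 2 l s q 0 *\<^sub>v \<phi>" and ?\<phi>1 = "measure_op 2 l s q 1 *\<^sub>v \<phi>"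
  note c0 = measure_op_mult_vec_carrier[OF Cons.prems, of q 0]
  note c1 = measure_op_mult_vec_carrier[OF Cons.prems, of q 1]
  have "outcomes (measure_zero (q # qs) P R) \<phi> = outcomes (measure_zero qs P R) ?\<phi>0 @ outcomes R ?\<phi>1"
    by (simp add: outcomes_def)
  moreover have "(vnorm \<phi>)\<^sup>2 * \<rho> = (vnorm ?\<phi>0)\<^sup>2 * \<rho> + (vnorm ?\<phi>1)\<^sup>2 * \<rho>"
    unfolding measure_op_norms[OF Cons.prems, of q, symmetric] by (simp add: distrib_right)
  ultimately show ?case
    using Cons.IH[OF c0] R[OF c1]
    unfolding truncate_measure_op[OF Cons.prems] keep_zero_Cons[OF Cons.prems]
    by (auto simp: algebra_simps)
qed

lemma final_states_prepend:
  assumes "wf_steps (4 * 2 ^ (l + s)) ts" "unitary_mat (2 ^ (l + s)) U" "\<phi> \<in> carrier_vec (4 * 2 ^ (l + s))"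
  shows "final_states 2 l s U \<psi> (prepend ts P) \<phi> =
    final_states 2 l s U \<psi> P (steps_mat (4 * 2 ^ (l + s)) U ts *\<^sub>v \<phi>)"
  using assms(1,3)
proof (induction ts arbitrary: \<phi>)
  case Nil
  then show ?case by simp
next
  case (Cons t ts)
  have wf: "wf_steps (4 * 2 ^ (l + s)) [t]" "wf_steps (4 * 2 ^ (l + s)) ts"
    using Cons.prems(1) by (auto simp: wf_steps_def)
  \<comment> \<open>Every basis state satisfies the empty control condition, so the controlled part
    is everything.\<close>
  have op: "oracle_op 2 l s U {} dag = kron (1\<^sub>m 4) (if dag then mat_adjoint U else U)" for dag
  proof -
    have "basis_projector 2 (\<lambda>i. True) = 1\<^sub>m 4" "basis_projector 2 (\<lambda>i. False) = 0\<^sub>m 4 4"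
      by (auto simp: basis_projector_def mat_diag_def intro!: eq_matI)
    moreover have "kron (0\<^sub>m 4 4) (1\<^sub>m (2 ^ (l + s))) = 0\<^sub>m (4 * 2 ^ (l + s)) (4 * 2 ^ (l + s))"
      by (rule eq_matI) (auto simp: div_mod_less)
    moreover have "kron (1\<^sub>m 4) (if dag then mat_adjoint U else U) \<in> carrier_mat (4 * 2 ^ (l + s)) (4 * 2 ^ (l + s))"
      using unitary_mat_carrier[OF assms(2)] by auto
    ultimately show ?thesis by (simp add: oracle_op_def)
  qed
  have "step_mat U t *\<^sub>v \<phi> \<in> carrier_vec (4 * 2 ^ (l + s))"
    using unitary_mat_carrier[OF unitary_step_mat[OF wf(1) assms(2)]] Cons.prems(2) by simp
  from Cons.IH[OF wf(2) this] show ?case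
    unfolding steps_mat_Cons_vec[OF Cons.prems(1) assms(2) Cons.prems(2)]
    by (cases t) (simp_all add: op)
qed

text \<open>After the last failed attempt the rotation moves the fresh state off every success flag.\<close>

fun repeat_until_success :: "nat \<Rightarrow> nat \<Rightarrow> step list \<Rightarrow> procedure \<Rightarrow> nat \<Rightarrow> procedure" where
  "repeat_until_success l s ts P 0 = Prepare (Gate (rotation (2 ^ (l + s)) 0 1) P)"
| "repeat_until_success l s ts P (Suc k) =
     Prepare (prepend ts (measure_zero [0..<2 + l] P (repeat_until_success l s ts P k)))"

lemma prepared_state:
  assumes "\<psi> \<in> carrier_vec (2 ^ s)"
  shows "kron_vec (unit_vec (2 ^ (2 + l)) 0) \<psi> = pad (4 * 2 ^ (l + s)) \<psi>"
proof (rule eq_vecI)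
  fix i assume "i < dim_vec (pad (4 * 2 ^ (l + s)) \<psi>)"
  then have i: "i < 2 ^ (2 + l) * 2 ^ s" by (simp add: power_add)
  have "i div 2 ^ s = 0 \<longleftrightarrow> i < 2 ^ s" by (simp add: div_eq_0_iff)
  then show "kron_vec (unit_vec (2 ^ (2 + l)) 0) \<psi> $ i = pad (4 * 2 ^ (l + s)) \<psi> $ i"
    using assms i div_mod_less[OF i] by (auto simp: kron_vec_def pad_def power_add)
qed (use assms in \<open>simp add: kron_vec_def power_add\<close>)

lemma final_states_Prepare:
  assumes "\<psi> \<in> carrier_vec (2 ^ s)"
  shows "final_states 2 l s U \<psi> (Prepare P) \<phi> =
    final_states 2 l s U \<psi> P (complex_of_real (vnorm \<phi>) \<cdot>\<^sub>v pad (4 * 2 ^ (l + s)) \<psi>)"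
  unfolding final_states.simps prepared_state[OF assms] ..

text \<open>A failure restarts from a fresh copy, so failure probabilities multiply. All branches
  end in nonnegative multiples of one vector, hence the conditional state is exact without a phase
  correction.\<close>

lemma repeat_until_success_outcomes:
  fixes l s k U \<psi> and T :: "complex mat"
  defines "outcomes P \<phi> \<equiv> map (\<lambda>\<chi>. T *\<^sub>v \<chi>) (final_states 2 l s U \<psi> P \<phi>)"
  assumes P: "\<And>\<phi>. \<phi> \<in> carrier_vec (4 * 2 ^ (l + s)) \<Longrightarrow> outcomes P \<phi> = [truncate (2 ^ s) \<phi>]"
    and ts: "wf_steps (4 * 2 ^ (l + s)) ts" and U: "unitary_mat (2 ^ (l + s)) U"
    and N: "realizes l s U ts N" and \<psi>: "\<psi> \<in> carrier_vec (2 ^ s)" "vnorm \<psi> = 1"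
    and \<phi>: "\<phi> \<in> carrier_vec (4 * 2 ^ (l + s))"
  shows "(\<Sum>\<chi>\<leftarrow>outcomes (repeat_until_success l s ts P k) \<phi>. (vnorm \<chi>)\<^sup>2) =
      (vnorm \<phi>)\<^sup>2 * (1 - (1 - (vnorm (N *\<^sub>v \<psi>))\<^sup>2) ^ k) \<and>
    set (outcomes (repeat_until_success l s ts P k) \<phi>) \<subseteq> {complex_of_real c \<cdot>\<^sub>v (N *\<^sub>v \<psi>) |c. 0 \<le> c}"
  using \<phi>
proof (induction k arbitrary: \<phi>)
  let ?n = "4 * 2 ^ (l + s) :: nat" and ?D = "2 ^ (l + s) :: nat" and ?d = "2 ^ s :: nat"
  let ?S = "steps_mat ?n U ts"
  have dD: "?d \<le> ?D" "?d \<le> ?n" by (auto simp: power_add)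
  have truncate_N: "truncate ?d (?S *\<^sub>v pad ?n \<psi>) = N *\<^sub>v \<psi>" using N \<psi> by (simp add: realizes_def)
  then have dim_N: "dim_vec (N *\<^sub>v \<psi>) = ?d" by (metis dim_top)
  {
    case (0 \<phi>)
    let ?c = "complex_of_real (vnorm \<phi>)"
    have pad: "pad ?n \<psi> = two_level ?D (pad ?D \<psi>) (0\<^sub>v ?D)" using \<psi> dD by (simp add: two_level_pad)
    have rc: "rotation ?D 0 1 \<in> carrier_mat ?n ?n" by (rule unitary_mat_carrier[OF unitary_rotation]) simp
    have "rotation ?D 0 1 *\<^sub>v (?c \<cdot>\<^sub>v pad ?n \<psi>) =
        ?c \<cdot>\<^sub>v two_level ?D (0 \<cdot>\<^sub>v pad ?D \<psi> - cnj 1 \<cdot>\<^sub>v 0\<^sub>v ?D) (1 \<cdot>\<^sub>v pad ?D \<psi> + cnj 0 \<cdot>\<^sub>v 0\<^sub>v ?D)"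
      unfolding pad using rc by (simp add: mult_mat_vec[of _ ?n ?n] rotation_mult_two_level)
    then have "truncate ?d (rotation ?D 0 1 *\<^sub>v (?c \<cdot>\<^sub>v pad ?n \<psi>)) =
        ?c \<cdot>\<^sub>v truncate ?d (0 \<cdot>\<^sub>v pad ?D \<psi> - cnj 1 \<cdot>\<^sub>v 0\<^sub>v ?D)"
      using dD by (simp add: truncate_smult truncate_two_level)
    \<comment> \<open>The rotation has emptied block 00; zero is written as a multiple of the common
      vector to fit the set of outcomes.\<close>
    also have "\<dots> = complex_of_real 0 \<cdot>\<^sub>v (N *\<^sub>v \<psi>)"
    proof (rule eq_vecI)
      fix i assume "i < dim_vec (complex_of_real 0 \<cdot>\<^sub>v (N *\<^sub>v \<psi>))"
      then have i: "i < ?d" using dim_N by simp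
      then have "i < ?D" using dD(1) by (rule less_le_trans)
      then show "(?c \<cdot>\<^sub>v truncate ?d (0 \<cdot>\<^sub>v pad ?D \<psi> - cnj 1 \<cdot>\<^sub>v 0\<^sub>v ?D)) $ i = (complex_of_real 0 \<cdot>\<^sub>v (N *\<^sub>v \<psi>)) $ i"
        using i dim_N by (simp add: truncate_def del: index_mult_mat_vec dim_mult_mat_vec)
    qed (use dim_N in simp)
    finally have zero: "truncate ?d (rotation ?D 0 1 *\<^sub>v (?c \<cdot>\<^sub>v pad ?n \<psi>)) = complex_of_real 0 \<cdot>\<^sub>v (N *\<^sub>v \<psi>)" .
    have "rotation ?D 0 1 *\<^sub>v (?c \<cdot>\<^sub>v pad ?n \<psi>) \<in> carrier_vec ?n"
      using rc by (intro mult_mat_vec_carrier[of _ ?n ?n]) auto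
    from P[OF this] have "outcomes (repeat_until_success l s ts P 0) \<phi> = [complex_of_real 0 \<cdot>\<^sub>v (N *\<^sub>v \<psi>)]"
      unfolding zero by (simp add: outcomes_def final_states_Prepare[OF \<psi>(1)] del: final_states.simps(5))
    then show ?case by (auto simp: vnorm_smult simp del: of_real_0 intro: exI[of _ 0])
  next
    case (Suc k \<phi>)
    let ?c = "complex_of_real (vnorm \<phi>)"
    let ?\<phi> = "?S *\<^sub>v (?c \<cdot>\<^sub>v pad ?n \<psi>)"
    let ?R = "repeat_until_success l s ts P k"
    have S: "unitary_mat ?n ?S" by (rule unitary_steps_mat[OF ts U])
    have c: "?\<phi> \<in> carrier_vec ?n"
      using unitary_mat_carrier[OF S] by (intro mult_mat_vec_carrier[of _ ?n ?n]) auto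
    have "truncate ?d ?\<phi> = ?c \<cdot>\<^sub>v (N *\<^sub>v \<psi>)"
      using unitary_mat_carrier[OF S] dD truncate_N by (simp add: mult_mat_vec[of _ ?n ?n] truncate_smult)
    moreover have "vnorm ?\<phi> = vnorm \<phi>"
      using \<psi> dD by (subst vnorm_unitary[OF S]) (auto simp: vnorm_smult vnorm_pad)
    moreover have "outcomes (repeat_until_success l s ts P (Suc k)) \<phi> = outcomes (measure_zero [0..<2 + l] P ?R) ?\<phi>"
      by (simp add: outcomes_def final_states_Prepare[OF \<psi>(1)] final_states_prepend[OF ts U] del: final_states.simps(5))
    moreover note measure_zero_outcomes[where P = P and R = ?R and \<phi> = ?\<phi> and T = T and U = U and \<psi> = \<psi>
        and l = l and s = s and qs = "[0..<2 + l]" and \<rho> = "1 - (1 - (vnorm (N *\<^sub>v \<psi>))\<^sup>2) ^ k"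
        and X = "{complex_of_real c \<cdot>\<^sub>v (N *\<^sub>v \<psi>) |c. 0 \<le> c}", folded outcomes_def, OF P Suc.IH c]
    ultimately have
      "(\<Sum>\<chi>\<leftarrow>outcomes (repeat_until_success l s ts P (Suc k)) \<phi>. (vnorm \<chi>)\<^sup>2) =
        (vnorm (?c \<cdot>\<^sub>v (N *\<^sub>v \<psi>)))\<^sup>2 + ((vnorm \<phi>)\<^sup>2 - (vnorm (?c \<cdot>\<^sub>v (N *\<^sub>v \<psi>)))\<^sup>2) *
          (1 - (1 - (vnorm (N *\<^sub>v \<psi>))\<^sup>2) ^ k)"
      and sub: "set (outcomes (repeat_until_success l s ts P (Suc k)) \<phi>) \<subseteq>
        insert (?c \<cdot>\<^sub>v (N *\<^sub>v \<psi>)) {complex_of_real c \<cdot>\<^sub>v (N *\<^sub>v \<psi>) |c. 0 \<le> c}"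
      by (simp_all only: vnorm_keep_zero_all)
    \<comment> \<open>The recurrence p + (1 - p) (1 - (1 - p)^k) = 1 - (1 - p)^(k + 1), scaled by
      the squared norm.\<close>
    then have "(\<Sum>\<chi>\<leftarrow>outcomes (repeat_until_success l s ts P (Suc k)) \<phi>. (vnorm \<chi>)\<^sup>2) =
        (vnorm \<phi>)\<^sup>2 * (1 - (1 - (vnorm (N *\<^sub>v \<psi>))\<^sup>2) ^ Suc k)"
      by (simp add: vnorm_smult power_mult_distrib algebra_simps)
    moreover have "?c \<cdot>\<^sub>v (N *\<^sub>v \<psi>) \<in> {complex_of_real c \<cdot>\<^sub>v (N *\<^sub>v \<psi>) |c. 0 \<le> c}" by auto
    ultimately show ?case using sub by blast
  }
qed

text \<open>Truncating a unitary image cannot lengthen it. This gives p \<le> 1, so that powers of 1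
  - p can be bounded monotonically.\<close>

lemma vnorm_realized_le:
  assumes "wf_steps (4 * 2 ^ (l + s)) ts" "unitary_mat (2 ^ (l + s)) U" "realizes l s U ts N"
    "\<psi> \<in> carrier_vec (2 ^ s)"
  shows "(vnorm (N *\<^sub>v \<psi>))\<^sup>2 \<le> (vnorm \<psi>)\<^sup>2"
proof -
  let ?n = "4 * 2 ^ (l + s) :: nat"
  have S: "unitary_mat ?n (steps_mat ?n U ts)" by (rule unitary_steps_mat[OF assms(1,2)])
  have le: "2 ^ s \<le> ?n" by (simp add: power_add)
  have "N *\<^sub>v \<psi> = truncate (2 ^ s) (steps_mat ?n U ts *\<^sub>v pad ?n \<psi>)"
    using assms(3,4) by (simp add: realizes_def)
  then have "(vnorm (N *\<^sub>v \<psi>))\<^sup>2 \<le> (vnorm (steps_mat ?n U ts *\<^sub>v pad ?n \<psi>))\<^sup>2"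
    using vnorm_truncate_le[of "2 ^ s" "steps_mat ?n U ts *\<^sub>v pad ?n \<psi>"] le unitary_mat_carrier[OF S] by simp
  also have "\<dots> = (vnorm \<psi>)\<^sup>2"
    using le assms(4) by (simp add: vnorm_unitary[OF S] vnorm_pad)
  finally show ?thesis .
qed

lemma wf_measure_zero:
  assumes "wf_procedure 2 l s P" "wf_procedure 2 l s R" "set qs \<subseteq> {..<2 + l}"
  shows "wf_procedure 2 l s (measure_zero qs P R)"
  using assms by (induction qs) auto

lemma wf_prepend:
  assumes "wf_steps (4 * 2 ^ (l + s)) ts" "wf_procedure 2 l s P"
  shows "wf_procedure 2 l s (prepend ts P)"
  using assms by (induction ts P rule: prepend.induct) (auto simp: power_add)

lemma wf_repeat_until_success:
  assumes "wf_steps (4 * 2 ^ (l + s)) ts" "wf_procedure 2 l s P"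
  shows "wf_procedure 2 l s (repeat_until_success l s ts P k)"
proof (induction k)
  case 0
  have "unitary_mat (2 ^ (2 + l + s)) (rotation (2 ^ (l + s)) 0 1)"
    using unitary_rotation[of 0 1 "2 ^ (l + s)"] by (simp add: power_add)
  then show ?case using assms(2) by simp
next
  case (Suc k)
  have "wf_procedure 2 l s (measure_zero [0..<2 + l] P (repeat_until_success l s ts P k))"
    by (rule wf_measure_zero[OF assms(2) Suc]) auto
  then show ?case by (auto intro: wf_prepend[OF assms(1)])
qed

lemma calls_prepend:
  "unitary_calls (prepend ts P) = oracle_steps ts + unitary_calls P"
  "preparation_calls (prepend ts P) = preparation_calls P"
  by (induction ts P rule: prepend.induct) auto

lemma calls_measure_zero:
  "unitary_calls (measure_zero qs P R) \<le> max (unitary_calls P) (unitary_calls R)"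
  "preparation_calls (measure_zero qs P R) \<le> max (preparation_calls P) (preparation_calls R)"
  by (induction qs) auto

text \<open>On the worst branch each of the \<open>k\<close> attempts runs the circuit once; the
  default branch costs one more preparation and no oracle call.\<close>

lemma calls_repeat_until_success:
  assumes "unitary_calls P = 0" "preparation_calls P = 0"
  shows "unitary_calls (repeat_until_success l s ts P k) \<le> k * oracle_steps ts"
    and "preparation_calls (repeat_until_success l s ts P k) \<le> Suc k"
proof (induction k)
  case (Suc k)
  {
    case 1
    then show ?case
      using calls_measure_zero(1)[of "[0..<2 + l]" P "repeat_until_success l s ts P k"] Suc(1) assms
      by (simp add: calls_prepend del: upt_Suc)
  next
    case 2
    then show ?case
      using calls_measure_zero(2)[of "[0..<2 + l]" P "repeat_until_success l s ts P k"] Suc(2) assms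
      by (simp add: calls_prepend del: upt_Suc)
  }
qed (simp_all add: assms)

section \<open>Success flags\<close>

text \<open>The NOT gate on the first extra qubit: it exchanges blocks 00 and 10, and blocks 01 and
  11.\<close>

definition raise_flag :: "nat \<Rightarrow> complex mat" where
  "raise_flag D = kron (mat 4 4 (\<lambda>(i, j). if j = (i + 2) mod 4 then 1 else 0)) (1\<^sub>m D)"

lemma unitary_raise_flag: "unitary_mat (4 * D) (raise_flag D)"
  unfolding raise_flag_def
proof (intro unitary_kron unitary_mat_one)
  let ?Q = "mat 4 4 (\<lambda>(i, j). if j = (i + 2) mod 4 then 1 else 0 :: complex)"
  have four: "{0..<4::nat} = {0, 1, 2, 3}" by auto
  have lt4: "i = 0 \<or> i = 1 \<or> i = 2 \<or> i = 3" if "i < 4" for i :: nat using that by auto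
  have "mat_adjoint ?Q * ?Q = 1\<^sub>m 4"
  proof (rule eq_matI)
    fix i j assume "i < dim_row (1\<^sub>m 4 :: complex mat)" "j < dim_col (1\<^sub>m 4 :: complex mat)"
    then have "i < 4" "j < 4" by auto
    from lt4[OF this(1)] lt4[OF this(2)] show "(mat_adjoint ?Q * ?Q) $$ (i, j) = 1\<^sub>m 4 $$ (i, j)"
      by (elim disjE) (simp_all add: scalar_prod_def four)
  qed auto
  moreover from this have "?Q * mat_adjoint ?Q = 1\<^sub>m 4"
    by (rule mat_mult_left_right_inverse[rotated 2]) auto
  ultimately show "unitary_mat 4 ?Q" by (simp add: unitary_mat_def)
qed

lemma kron_ket: "b < 2 \<Longrightarrow> kron (ket 1 b) (ket n 0) = ket (Suc n) (b * 2 ^ n)"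
proof (rule eq_matI)
  fix i j assume b: "b < 2" and "i < dim_row (ket (Suc n) (b * 2 ^ n))" "j < dim_col (ket (Suc n) (b * 2 ^ n))"
  then have ij: "i < 2 * 2 ^ n" "j = 0" by (auto simp: ket_def)
  have "i = b * 2 ^ n \<longleftrightarrow> i div 2 ^ n = b \<and> i mod 2 ^ n = 0"
    by (metis add.right_neutral div_mult_mod_eq mod_mult_self2_is_0 mult.commute nonzero_mult_div_cancel_left power_not_zero zero_neq_numeral)
  then show "kron (ket 1 b) (ket n 0) $$ (i, j) = ket (Suc n) (b * 2 ^ n) $$ (i, j)"
    using ij div_mod_less[OF ij(1)] by (auto simp: ket_def)
qed (auto simp: ket_def)

definition finish :: "nat \<Rightarrow> nat \<Rightarrow> nat \<Rightarrow> procedure" where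
  "finish l s b = Gate (if b = 0 then 1\<^sub>m (4 * 2 ^ (l + s)) else raise_flag (2 ^ (l + s))) Halt"

text \<open>The last gate moves block 00 to the requested flag, so reading either flag returns the
  same amplitude and one analysis covers both operators.\<close>

lemma finish_outcomes:
  assumes "b < 2" "\<phi> \<in> carrier_vec (4 * 2 ^ (l + s))"
  shows "map (\<lambda>\<chi>. kron (mat_adjoint (kron (ket 1 b) (ket (l + 1) 0))) (1\<^sub>m (2 ^ s)) *\<^sub>v \<chi>)
    (final_states 2 l s U \<psi> (finish l s b) \<phi>) = [truncate (2 ^ s) \<phi>]"
proof -
  let ?D = "2 ^ (l + s) :: nat" and ?d = "2 ^ s :: nat"
  let ?G = "if b = 0 then 1\<^sub>m (4 * ?D) else raise_flag ?D"
  have "unitary_mat (4 * ?D) ?G" by (auto simp: unitary_mat_one unitary_raise_flag)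
  then have c: "?G *\<^sub>v \<phi> \<in> carrier_vec (4 * ?D)"
    using assms(2) by (intro mult_mat_vec_carrier[OF unitary_mat_carrier])
  have b: "b * 2 ^ (l + 1) < 2 ^ Suc (l + 1)" using assms(1) by simp
  have "kron (mat_adjoint (ket (Suc (l + 1)) (b * 2 ^ (l + 1)))) (1\<^sub>m ?d) *\<^sub>v (?G *\<^sub>v \<phi>) =
      vec ?d (\<lambda>i. (?G *\<^sub>v \<phi>) $ (b * 2 ^ (l + 1) * ?d + i))"
    by (intro kron_bra_mult_vec b) (simp only: carrier_vecD[OF c], simp add: power_add)
  also have "\<dots> = truncate ?d \<phi>"
  proof (rule eq_vecI)
    fix i assume "i < dim_vec (truncate ?d \<phi>)"
    then have i: "i < ?d" by simp
    moreover have "?d \<le> ?D" by (simp add: power_add)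
    ultimately have iD: "i < ?D" by (rule less_le_trans)
    show "vec ?d (\<lambda>i. (?G *\<^sub>v \<phi>) $ (b * 2 ^ (l + 1) * ?d + i)) $ i = truncate ?d \<phi> $ i"
    proof (cases "b = 0")
      case True
      then show ?thesis using i assms(2) by (simp add: truncate_def del: index_mult_mat_vec)
    next
      case False
      then have b1: "b = 1" using assms(1) by simp
      have idx: "b * 2 ^ (l + 1) * ?d + i = 2 * ?D + i" by (simp add: b1 power_add)
      have div: "(2 * ?D + i) div ?D = 2" "(2 * ?D + i) mod ?D = i" using iD by auto
      have four: "{..<4::nat} = {0, 1, 2, 3}" by auto
      have "(raise_flag ?D *\<^sub>v \<phi>) $ (2 * ?D + i) = \<phi> $ i"
        unfolding raise_flag_def using assms(2) iD
        by (subst kron_one_mult_vec_index) (auto simp: div four)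
      then have "(?G *\<^sub>v \<phi>) $ (b * 2 ^ (l + 1) * ?d + i) = \<phi> $ i"
        unfolding idx using False by (simp only: if_False)
      then show ?thesis using i by (simp add: truncate_def del: index_mult_mat_vec)
    qed
  qed simp
  finally show ?thesis unfolding kron_ket[OF assms(1)] finish_def by (simp only: final_states.simps list.map)
qed

lemma smult_mat_mult_vec:
  fixes A :: "complex mat"
  assumes "A \<in> carrier_mat n m" "x \<in> carrier_vec m"
  shows "(c \<cdot>\<^sub>m A) *\<^sub>v x = c \<cdot>\<^sub>v (A *\<^sub>v x)"
  using assms by (intro eq_vecI) (auto simp: scalar_prod_def sum_distrib_left mult.assoc intro!: sum.cong)

text \<open>Normalization removes the factor 1/4 and the scale of each branch. An attempt succeeds
  with probability p at least the square of 1/4 times 1/2, that is 1/64, and (1 - p)^k is at most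
  exp (- p k).\<close>

lemma repeat_until_success_implements:
  fixes V :: "complex mat"
  assumes b: "b < 2" and ts: "wf_steps (4 * 2 ^ (l + s)) ts" and U: "unitary_mat (2 ^ (l + s)) U"
    and V: "V \<in> carrier_mat (2 ^ s) (2 ^ s)" "realizes l s U ts ((1 / 4) \<cdot>\<^sub>m V)"
    and \<psi>: "\<psi> \<in> carrier_vec (2 ^ s)" "vnorm \<psi> = 1" "1 / 2 \<le> vnorm (V *\<^sub>v \<psi>)"
    and k: "64 * ln (1 / \<beta>) \<le> real k" and \<beta>: "0 < \<beta>"
  defines "P \<equiv> repeat_until_success l s ts (finish l s b) k"
  shows "implements 2 l s U \<psi> P (kron (ket 1 b) (ket (l + 1) 0)) V"
    and "1 - \<beta> \<le> success_probability 2 l s U \<psi> P (kron (ket 1 b) (ket (l + 1) 0))"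
proof -
  let ?n = "4 * 2 ^ (l + s) :: nat"
  let ?N = "(1 / 4) \<cdot>\<^sub>m V"
  let ?F = "kron (ket 1 b) (ket (l + 1) 0)"
  define \<phi> where "\<phi> = (unit_vec (2 ^ (2 + l + s)) 0 :: complex vec)"
  have \<phi>: "\<phi> \<in> carrier_vec ?n" by (simp add: \<phi>_def power_add)
  have "vnorm \<phi> = 1"
    by (simp add: vnorm_def \<phi>_def if_distrib[where f = cmod] if_distrib[where f = "\<lambda>x. x\<^sup>2"] sum.delta' cong: if_cong)
  then have outcomes: "(\<Sum>\<chi>\<leftarrow>success_states 2 l s U \<psi> P ?F. (vnorm \<chi>)\<^sup>2) = 1 - (1 - (vnorm (?N *\<^sub>v \<psi>))\<^sup>2) ^ k"
    "set (success_states 2 l s U \<psi> P ?F) \<subseteq> {complex_of_real c \<cdot>\<^sub>v (?N *\<^sub>v \<psi>) |c. 0 \<le> c}"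
    using repeat_until_success_outcomes[OF finish_outcomes[OF b] ts U V(2) \<psi>(1,2) \<phi>]
    unfolding success_states_def P_def \<phi>_def by simp_all
  have N: "?N *\<^sub>v \<psi> = (1 / 4) \<cdot>\<^sub>v (V *\<^sub>v \<psi>)" using V(1) \<psi>(1) by (rule smult_mat_mult_vec)
  show "implements 2 l s U \<psi> P ?F V"
    unfolding implements_def
  proof (intro ballI impI)
    fix \<chi> assume "\<chi> \<in> set (success_states 2 l s U \<psi> P ?F)" and nz: "vnorm \<chi> \<noteq> 0"
    then obtain c where c: "0 \<le> c" "\<chi> = complex_of_real c \<cdot>\<^sub>v (?N *\<^sub>v \<psi>)" using outcomes(2) by blast
    then have \<chi>: "\<chi> = complex_of_real (c / 4) \<cdot>\<^sub>v (V *\<^sub>v \<psi>)" by (simp add: N smult_smult_assoc)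
    have "c \<noteq> 0" using nz c(2) by (auto simp: vnorm_smult)
    then have "normalized \<chi> = normalized (V *\<^sub>v \<psi>)"
      using c(1) unfolding \<chi> normalized_def vnorm_smult by (simp add: smult_smult_assoc)
    then show "\<exists>\<theta>. normalized \<chi> = cis \<theta> \<cdot>\<^sub>v normalized (V *\<^sub>v \<psi>)"
      by (intro exI[of _ 0]) simp
  qed
  define p where "p = (vnorm (?N *\<^sub>v \<psi>))\<^sup>2"
  have "p \<le> 1" using vnorm_realized_le[OF ts U V(2) \<psi>(1)] \<psi>(2) by (simp add: p_def)
  have "(1 / 8)\<^sup>2 \<le> p" unfolding p_def
    using \<psi>(3) by (intro power_mono) (auto simp: N vnorm_smult)
  then have p: "1 / 64 \<le> p" by (simp add: power2_eq_square)
  have "(1 - p) ^ k \<le> exp (- p) ^ k"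
    using \<open>p \<le> 1\<close> exp_ge_add_one_self[of "- p"] by (intro power_mono) auto
  also have "\<dots> = exp (- (p * real k))" by (simp add: exp_of_nat_mult[symmetric] mult.commute)
  also have "\<dots> \<le> exp (- ln (1 / \<beta>))"
  proof -
    have "ln (1 / \<beta>) \<le> (1 / 64) * real k" using k by simp
    also have "\<dots> \<le> p * real k" using p by (intro mult_right_mono) auto
    finally show ?thesis by simp
  qed
  also have "\<dots> = \<beta>" using \<beta> by (simp add: ln_div)
  finally show "1 - \<beta> \<le> success_probability 2 l s U \<psi> P ?F"
    unfolding success_probability_def outcomes(1) p_def by simp
qed

theorem mainTheorem1:
  shows "\<exists>K::real. 0 < K \<and>
    (\<forall>(s::nat) (l::nat) (\<delta>::real) (\<epsilon>::real) (\<beta>::real).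
      1 \<le> s \<longrightarrow> 1 \<le> l \<longrightarrow> 0 < \<delta> \<longrightarrow> 0 < \<epsilon> \<longrightarrow> \<epsilon> \<le> 1/2 \<longrightarrow> 0 < \<beta> \<longrightarrow> \<beta> \<le> 1/2 \<longrightarrow>
      (\<exists>P :: nat \<Rightarrow> procedure.
        (\<forall>j\<in>{1, 2}.
          wf_procedure 2 l s (P j) \<and>
          real (unitary_calls (P j)) \<le> K * (1 / \<delta> * ln (1 / \<epsilon>) * ln (1 / \<beta>)) \<and>
          real (preparation_calls (P j)) \<le> K * ln (1 / \<beta>)) \<and>
        (\<forall>(A :: complex mat) U\<^sub>A \<sigma> w v U\<^sub>1 U\<^sub>2.
          A \<in> carrier_mat (2 ^ s) (2 ^ s) \<longrightarrow>
          (\<forall>x\<in>singular_values A. \<delta> \<le> x \<and> x \<le> 1 - \<delta>) \<longrightarrow>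
          block_encodes l s U\<^sub>A A \<longrightarrow>
          is_svd (2 ^ s) A \<sigma> w v \<longrightarrow>
          U\<^sub>1 = ketbra_sum (2 ^ s)
                 (\<lambda>i. complex_of_real (\<sigma> i) + \<i> * complex_of_real (sqrt (1 - (\<sigma> i)\<^sup>2))) w v \<longrightarrow>
          U\<^sub>2 = ketbra_sum (2 ^ s)
                 (\<lambda>i. complex_of_real (\<sigma> i) - \<i> * complex_of_real (sqrt (1 - (\<sigma> i)\<^sup>2))) w v \<longrightarrow>
          unitary_mat (2 ^ s) U\<^sub>1 \<and> unitary_mat (2 ^ s) U\<^sub>2 \<and>
          A = (1 / 2) \<cdot>\<^sub>m (U\<^sub>1 + U\<^sub>2) \<and>
          (\<exists>V\<^sub>1 \<in> carrier_mat (2 ^ s) (2 ^ s). \<exists>V\<^sub>2 \<in> carrier_mat (2 ^ s) (2 ^ s).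
            op_norm (U\<^sub>1 - V\<^sub>1) \<le> \<epsilon> \<and> op_norm (U\<^sub>2 - V\<^sub>2) \<le> \<epsilon> \<and>
            (\<forall>\<psi> \<in> carrier_vec (2 ^ s). vnorm \<psi> = 1 \<longrightarrow>
              implements 2 l s U\<^sub>A \<psi> (P 1) (kron (ket 1 0) (ket (l + 1) 0)) V\<^sub>1 \<and>
              success_probability 2 l s U\<^sub>A \<psi> (P 1) (kron (ket 1 0) (ket (l + 1) 0)) \<ge> 1 - \<beta> \<and>
              implements 2 l s U\<^sub>A \<psi> (P 2) (kron (ket 1 1) (ket (l + 1) 0)) V\<^sub>2 \<and>
              success_probability 2 l s U\<^sub>A \<psi> (P 2) (kron (ket 1 1) (ket (l + 1) 0)) \<ge> 1 - \<beta>)))))"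
\<comment> \<open>16000 exceeds 66 times 242 = 15972, attempts times calls per attempt.\<close>
proof (intro exI[of _ "16000::real"] conjI allI impI)
  fix s l :: nat and \<delta> \<epsilon> \<beta> :: real
  assume \<delta>: "0 < \<delta>" and \<epsilon>: "0 < \<epsilon>" "\<epsilon> \<le> 1/2" and \<beta>: "0 < \<beta>" "\<beta> \<le> 1/2"
  let ?d = "2 ^ s :: nat"
  define L where "L = ln (1 / \<epsilon>)"
  define B where "B = ln (1 / \<beta>)"
  have ln2: "ln (2::real) \<ge> 1/2" using ln_le_minus_one[of "1/2"] by (simp add: ln_div)
  have "2 \<le> 1 / \<epsilon>" "2 \<le> 1 / \<beta>" using \<epsilon> \<beta> by (auto simp: field_simps)
  then have "ln 2 \<le> L" "ln 2 \<le> B"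
    unfolding L_def B_def using \<epsilon> \<beta> by (auto simp only: ln_le_cancel_iff zero_less_numeral zero_less_divide_1_iff)
  then have L: "1/2 \<le> L" and B: "1/2 \<le> B" using ln2 by auto
  \<comment> \<open>Carries the hypothesis from the eigenvalue definition of singular values to the
    numbers of the given decomposition.\<close>
  have \<sigma>_bounds: "0 \<le> \<sigma> i" "\<delta> \<le> \<sigma> i" "\<sigma> i \<le> 1 - \<delta>"
    if "\<forall>x\<in>singular_values A. \<delta> \<le> x \<and> x \<le> 1 - \<delta>" "is_svd ?d A \<sigma> w v" "i < ?d" for A \<sigma> w v and i :: nat
  proof -
    show "0 \<le> \<sigma> i" using that by (simp add: is_svd_def)
    have "singular_values A = (\<lambda>i. cmod (complex_of_real (\<sigma> i))) ` {..<?d}"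
      using that(2) by (auto simp: is_svd_def singular_values_ketbra_sum)
    then have "\<sigma> i \<in> singular_values A" using that(3) \<open>0 \<le> \<sigma> i\<close> by (auto intro!: image_eqI[of _ _ i])
    then show "\<delta> \<le> \<sigma> i" "\<sigma> i \<le> 1 - \<delta>" using that(1) by auto
  qed
  show "\<exists>P :: nat \<Rightarrow> procedure.
        (\<forall>j\<in>{1, 2}.
          wf_procedure 2 l s (P j) \<and>
          real (unitary_calls (P j)) \<le> 16000 * (1 / \<delta> * ln (1 / \<epsilon>) * ln (1 / \<beta>)) \<and>
          real (preparation_calls (P j)) \<le> 16000 * ln (1 / \<beta>)) \<and>
        (\<forall>(A :: complex mat) U\<^sub>A \<sigma> w v U\<^sub>1 U\<^sub>2.
          A \<in> carrier_mat (2 ^ s) (2 ^ s) \<longrightarrow>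
          (\<forall>x\<in>singular_values A. \<delta> \<le> x \<and> x \<le> 1 - \<delta>) \<longrightarrow>
          block_encodes l s U\<^sub>A A \<longrightarrow>
          is_svd (2 ^ s) A \<sigma> w v \<longrightarrow>
          U\<^sub>1 = ketbra_sum (2 ^ s)
                 (\<lambda>i. complex_of_real (\<sigma> i) + \<i> * complex_of_real (sqrt (1 - (\<sigma> i)\<^sup>2))) w v \<longrightarrow>
          U\<^sub>2 = ketbra_sum (2 ^ s)
                 (\<lambda>i. complex_of_real (\<sigma> i) - \<i> * complex_of_real (sqrt (1 - (\<sigma> i)\<^sup>2))) w v \<longrightarrow>
          unitary_mat (2 ^ s) U\<^sub>1 \<and> unitary_mat (2 ^ s) U\<^sub>2 \<and>
          A = (1 / 2) \<cdot>\<^sub>m (U\<^sub>1 + U\<^sub>2) \<and>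
          (\<exists>V\<^sub>1 \<in> carrier_mat (2 ^ s) (2 ^ s). \<exists>V\<^sub>2 \<in> carrier_mat (2 ^ s) (2 ^ s).
            op_norm (U\<^sub>1 - V\<^sub>1) \<le> \<epsilon> \<and> op_norm (U\<^sub>2 - V\<^sub>2) \<le> \<epsilon> \<and>
            (\<forall>\<psi> \<in> carrier_vec (2 ^ s). vnorm \<psi> = 1 \<longrightarrow>
              implements 2 l s U\<^sub>A \<psi> (P 1) (kron (ket 1 0) (ket (l + 1) 0)) V\<^sub>1 \<and>
              success_probability 2 l s U\<^sub>A \<psi> (P 1) (kron (ket 1 0) (ket (l + 1) 0)) \<ge> 1 - \<beta> \<and>
              implements 2 l s U\<^sub>A \<psi> (P 2) (kron (ket 1 1) (ket (l + 1) 0)) V\<^sub>2 \<and>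
              success_probability 2 l s U\<^sub>A \<psi> (P 2) (kron (ket 1 1) (ket (l + 1) 0)) \<ge> 1 - \<beta>)))"
    (is "\<exists>P. ?calls P \<and> ?guarantee P")
  proof (cases "\<delta> \<le> 1/2")
    case False
    \<comment> \<open>For \<delta> > 1/2 the admissible interval is empty, while a matrix of size
      \<open>2 ^ s\<close> has a singular value. No input qualifies, and any procedure will
      do.\<close>
    have "False" if "\<forall>x\<in>singular_values A. \<delta> \<le> x \<and> x \<le> 1 - \<delta>" "is_svd ?d A \<sigma> w v" for A \<sigma> w v
      using \<sigma>_bounds(2,3)[OF that, of 0] False by simp
    then have guarantee: "?guarantee (\<lambda>_. Halt)" by blast
    have calls: "?calls (\<lambda>_. Halt)" using \<delta> L B by (simp add: L_def B_def)
    show ?thesis by (intro exI[of _ "\<lambda>_. Halt"] conjI calls guarantee)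
  next
    case True
    \<comment> \<open>The ceiling adds at most 1, which is at most 2 B because B is at least 1/2;
      hence 66.\<close>
    define k where "k = nat \<lceil>64 * B\<rceil>"
    have k: "64 * ln (1 / \<beta>) \<le> real k" "real k \<le> 66 * B"
      using B unfolding k_def B_def[symmetric] by linarith+
    obtain ts\<^sub>1 where ts1: "wf_steps (4 * 2 ^ (l + s)) ts\<^sub>1" "real (oracle_steps ts\<^sub>1) \<le> 242 * (1 / \<delta> * ln (1 / \<epsilon>))"
      and approx1: "\<forall>U A \<sigma> w v. block_encodes l s U A \<longrightarrow> is_svd (2 ^ s) A \<sigma> w v \<longrightarrow>
      (\<forall>i<2 ^ s. \<delta> \<le> \<sigma> i \<and> \<sigma> i \<le> 1 - \<delta>) \<longrightarrow>
      (\<exists>V\<in>carrier_mat (2 ^ s) (2 ^ s).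
        op_norm (ketbra_sum (2 ^ s) (\<lambda>i. Complex (\<sigma> i) (1 * sqrt (1 - (\<sigma> i)\<^sup>2))) w v - V) \<le> \<epsilon> \<and>
        realizes l s U ts\<^sub>1 ((1 / 4) \<cdot>\<^sub>m V) \<and>
        (\<forall>\<psi>\<in>carrier_vec (2 ^ s). vnorm \<psi> = 1 \<longrightarrow> 1 / 2 \<le> vnorm (V *\<^sub>v \<psi>)))"
      by (rule approximation_steps[OF \<delta> True \<epsilon>, of 1 l s]) (rule disjI1, rule refl, rule that)
    obtain ts\<^sub>2 where ts2: "wf_steps (4 * 2 ^ (l + s)) ts\<^sub>2" "real (oracle_steps ts\<^sub>2) \<le> 242 * (1 / \<delta> * ln (1 / \<epsilon>))"
      and approx2: "\<forall>U A \<sigma> w v. block_encodes l s U A \<longrightarrow> is_svd (2 ^ s) A \<sigma> w v \<longrightarrow>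
      (\<forall>i<2 ^ s. \<delta> \<le> \<sigma> i \<and> \<sigma> i \<le> 1 - \<delta>) \<longrightarrow>
      (\<exists>V\<in>carrier_mat (2 ^ s) (2 ^ s).
        op_norm (ketbra_sum (2 ^ s) (\<lambda>i. Complex (\<sigma> i) (-1 * sqrt (1 - (\<sigma> i)\<^sup>2))) w v - V) \<le> \<epsilon> \<and>
        realizes l s U ts\<^sub>2 ((1 / 4) \<cdot>\<^sub>m V) \<and>
        (\<forall>\<psi>\<in>carrier_vec (2 ^ s). vnorm \<psi> = 1 \<longrightarrow> 1 / 2 \<le> vnorm (V *\<^sub>v \<psi>)))"
      by (rule approximation_steps[OF \<delta> True \<epsilon>, of "-1" l s]) (rule disjI2, rule refl, rule that)
    \<comment> \<open>The index selects the circuit and the flag: 1 is the upper half circle with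
      flag 0, 2 the lower one with flag 1.\<close>
    define P where "P = (\<lambda>j. repeat_until_success l s (if j = 1 then ts\<^sub>1 else ts\<^sub>2) (finish l s (j - 1)) k)"
    have calls: "?calls P"
    proof
      fix j :: nat assume "j \<in> {1, 2}"
      define ts where "ts = (if j = 1 then ts\<^sub>1 else ts\<^sub>2)"
      have ts: "wf_steps (4 * 2 ^ (l + s)) ts" "real (oracle_steps ts) \<le> 242 * (1 / \<delta> * L)"
        using ts1 ts2 by (auto simp: ts_def L_def)
      have Pj: "P j = repeat_until_success l s ts (finish l s (j - 1)) k" by (simp add: P_def ts_def)
      have fin: "wf_procedure 2 l s (finish l s (j - 1))" "unitary_calls (finish l s (j - 1)) = 0"
        "preparation_calls (finish l s (j - 1)) = 0"
        using unitary_raise_flag[of "2 ^ (l + s)"] unitary_mat_one[of "4 * 2 ^ (l + s)"]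
        by (simp_all add: finish_def power_add)
      have "real (unitary_calls (P j)) \<le> real k * real (oracle_steps ts)"
        using calls_repeat_until_success(1)[OF fin(2,3)] unfolding Pj by (simp flip: of_nat_mult)
      also have "\<dots> \<le> (66 * B) * (242 * (1 / \<delta> * L))"
        using k(2) ts(2) B by (intro mult_mono) auto
      also have "\<dots> \<le> 16000 * (1 / \<delta> * L * B)"
      proof -
        have "0 \<le> 1 / \<delta> * L * B" using \<delta> L B by simp
        moreover have "(66 * B) * (242 * (1 / \<delta> * L)) = 15972 * (1 / \<delta> * L * B)" by (simp add: mult_ac)
        ultimately show ?thesis by linarith
      qed
      finally have "real (unitary_calls (P j)) \<le> 16000 * (1 / \<delta> * L * B)" .
      moreover have "real (preparation_calls (P j)) \<le> 16000 * B"
      proof -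
        have "preparation_calls (P j) \<le> Suc k"
          using calls_repeat_until_success(2)[OF fin(2,3)] unfolding Pj .
        then have "real (preparation_calls (P j)) \<le> real k + 1" by linarith
        then show ?thesis using k(2) B by linarith
      qed
      ultimately show "wf_procedure 2 l s (P j) \<and>
          real (unitary_calls (P j)) \<le> 16000 * (1 / \<delta> * ln (1 / \<epsilon>) * ln (1 / \<beta>)) \<and>
          real (preparation_calls (P j)) \<le> 16000 * ln (1 / \<beta>)"
        using wf_repeat_until_success[OF ts(1) fin(1), of k] unfolding Pj L_def B_def by blast
    qed
    have guarantee: "?guarantee P"
    proof (intro allI impI)
      fix A :: "complex mat" and U\<^sub>A \<sigma> w v U\<^sub>1 U\<^sub>2
      assume sv: "\<forall>x\<in>singular_values A. \<delta> \<le> x \<and> x \<le> 1 - \<delta>"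
        and enc: "block_encodes l s U\<^sub>A A" and svd: "is_svd ?d A \<sigma> w v"
        and U1: "U\<^sub>1 = ketbra_sum ?d (\<lambda>i. complex_of_real (\<sigma> i) + \<i> * complex_of_real (sqrt (1 - (\<sigma> i)\<^sup>2))) w v"
        and U2: "U\<^sub>2 = ketbra_sum ?d (\<lambda>i. complex_of_real (\<sigma> i) - \<i> * complex_of_real (sqrt (1 - (\<sigma> i)\<^sup>2))) w v"
      have basis: "orthonormal_basis ?d w" "orthonormal_basis ?d v"
        and A: "A = ketbra_sum ?d (\<lambda>i. complex_of_real (\<sigma> i)) w v" using svd by (auto simp: is_svd_def)
      have U: "unitary_mat (2 ^ (l + s)) U\<^sub>A" using enc by (simp add: block_encodes_def)
      have \<sigma>: "\<forall>i<?d. \<delta> \<le> \<sigma> i \<and> \<sigma> i \<le> 1 - \<delta>" using \<sigma>_bounds[OF sv svd] by blast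
      have sq: "(\<sigma> i)\<^sup>2 \<le> 1" if "i < ?d" for i
        using \<sigma>_bounds[OF sv svd that] \<delta> by (intro power_le_one) auto
      have "unitary_mat ?d U\<^sub>1" "unitary_mat ?d U\<^sub>2" unfolding U1 U2
        using sq by (auto intro!: unitary_ketbra_sum basis simp: complex_eq_iff power2_eq_square)
      moreover have "A = (1 / 2) \<cdot>\<^sub>m (U\<^sub>1 + U\<^sub>2)"
        unfolding A U1 U2 ketbra_sum_add ketbra_sum_smult by simp
      moreover have U1': "U\<^sub>1 = ketbra_sum ?d (\<lambda>i. Complex (\<sigma> i) (1 * sqrt (1 - (\<sigma> i)\<^sup>2))) w v"
        and U2': "U\<^sub>2 = ketbra_sum ?d (\<lambda>i. Complex (\<sigma> i) (-1 * sqrt (1 - (\<sigma> i)\<^sup>2))) w v"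
        unfolding U1 U2 by (simp_all add: complex_eq_iff Complex_eq)
      obtain V\<^sub>1 where V1: "V\<^sub>1 \<in> carrier_mat ?d ?d" "op_norm (U\<^sub>1 - V\<^sub>1) \<le> \<epsilon>" "realizes l s U\<^sub>A ts\<^sub>1 ((1 / 4) \<cdot>\<^sub>m V\<^sub>1)"
        "\<forall>\<psi>\<in>carrier_vec ?d. vnorm \<psi> = 1 \<longrightarrow> 1 / 2 \<le> vnorm (V\<^sub>1 *\<^sub>v \<psi>)"
        using approx1[rule_format, OF enc svd \<sigma>[rule_format], folded U1'] by blast
      obtain V\<^sub>2 where V2: "V\<^sub>2 \<in> carrier_mat ?d ?d" "op_norm (U\<^sub>2 - V\<^sub>2) \<le> \<epsilon>" "realizes l s U\<^sub>A ts\<^sub>2 ((1 / 4) \<cdot>\<^sub>m V\<^sub>2)"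
        "\<forall>\<psi>\<in>carrier_vec ?d. vnorm \<psi> = 1 \<longrightarrow> 1 / 2 \<le> vnorm (V\<^sub>2 *\<^sub>v \<psi>)"
        using approx2[rule_format, OF enc svd \<sigma>[rule_format], folded U2'] by blast
      have P12: "P 1 = repeat_until_success l s ts\<^sub>1 (finish l s 0) k"
        "P 2 = repeat_until_success l s ts\<^sub>2 (finish l s 1) k"
        by (simp_all add: P_def)
      have "implements 2 l s U\<^sub>A \<psi> (P 1) (kron (ket 1 0) (ket (l + 1) 0)) V\<^sub>1 \<and>
          success_probability 2 l s U\<^sub>A \<psi> (P 1) (kron (ket 1 0) (ket (l + 1) 0)) \<ge> 1 - \<beta> \<and>
          implements 2 l s U\<^sub>A \<psi> (P 2) (kron (ket 1 1) (ket (l + 1) 0)) V\<^sub>2 \<and>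
          success_probability 2 l s U\<^sub>A \<psi> (P 2) (kron (ket 1 1) (ket (l + 1) 0)) \<ge> 1 - \<beta>"
        if \<psi>: "\<psi> \<in> carrier_vec ?d" "vnorm \<psi> = 1" for \<psi>
        unfolding P12
        using repeat_until_success_implements[OF _ ts1(1) U V1(1,3) \<psi> V1(4)[rule_format, OF \<psi>] k(1) \<beta>(1), of 0]
          repeat_until_success_implements[OF _ ts2(1) U V2(1,3) \<psi> V2(4)[rule_format, OF \<psi>] k(1) \<beta>(1), of 1]
        by simp
      ultimately show "unitary_mat (2 ^ s) U\<^sub>1 \<and> unitary_mat (2 ^ s) U\<^sub>2 \<and>
          A = (1 / 2) \<cdot>\<^sub>m (U\<^sub>1 + U\<^sub>2) \<and>
          (\<exists>V\<^sub>1 \<in> carrier_mat (2 ^ s) (2 ^ s). \<exists>V\<^sub>2 \<in> carrier_mat (2 ^ s) (2 ^ s).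
            op_norm (U\<^sub>1 - V\<^sub>1) \<le> \<epsilon> \<and> op_norm (U\<^sub>2 - V\<^sub>2) \<le> \<epsilon> \<and>
            (\<forall>\<psi> \<in> carrier_vec (2 ^ s). vnorm \<psi> = 1 \<longrightarrow>
              implements 2 l s U\<^sub>A \<psi> (P 1) (kron (ket 1 0) (ket (l + 1) 0)) V\<^sub>1 \<and>
              success_probability 2 l s U\<^sub>A \<psi> (P 1) (kron (ket 1 0) (ket (l + 1) 0)) \<ge> 1 - \<beta> \<and>
              implements 2 l s U\<^sub>A \<psi> (P 2) (kron (ket 1 1) (ket (l + 1) 0)) V\<^sub>2 \<and>
              success_probability 2 l s U\<^sub>A \<psi> (P 2) (kron (ket 1 1) (ket (l + 1) 0)) \<ge> 1 - \<beta>))"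
        using V1(1,2) V2(1,2) by blast
    qed
    show ?thesis by (intro exI[of _ P] conjI calls guarantee)
  qed
qed simp

end
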